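(* Let $\rho<\frac12$ and let $(M^{2},g(t))$, $t\in[0,T)$, be a solution of the Ricci-Bourguignon flow $\frac{d}{dt}g(t)=-2Ric(g(t))+2\rho R(g(t))g(t)$, $g(0)=g_{0}$, on a closed Riemannian surface $(M^{2},g_{0})$. Let $\lambda(t)$ denote the evolution of the first eigenvalue of the weighted $p$-Laplacian $\Delta_{p,\phi}$ under the Ricci-Bourguignon flow, and let $\lambda(t,f(t))$ be the associated smooth function described in the context. All right-hand sides are evaluated at $t=t_{0}$. (1) If $\frac{\partial\phi}{\partial t}=\Delta\phi$ (with $\Delta$ the Laplace operator of $g(t)$), then $$\frac{d}{dt}\lambda(t,f(t))\Big|_{t=t_{0}}=(1-2\rho)\lambda(t_{0})\int_{M}R|f|^{p}\,d\mu-\left(1+\rho p-2\rho-\frac p2\right)\int_{M}R|\nabla f|^{p}\,d\mu+\lambda(t_{0})\int_{M}(\Delta\phi)|f|^{p}\,d\mu-\int_{M}(\Delta\phi)|\nabla f|^{p}\,d\mu .$$ (2) If $\phi$ is independent of $t$, then $$\frac{d}{dt}\lambda(t,f(t))\Big|_{t=t_{0}}=(1-2\rho)\lambda(t_{0})\int_{M}R|f|^{p}\,d\mu-\left(1+\rho p-2\rho-\frac p2\right)\int_{M}R|\nabla f|^{p}\,d\mu .$$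
   Context: $M$ is closed and oriented. $Ric$ and $R$ are the Ricci tensor and scalar curvature of $g(t)$. $d\nu$ is the Riemannian volume measure of $g(t)$, $\phi$ is a smooth function and $d\mu=e^{-\phi}d\nu$. $\rho$ is a real constant and $p\in[1,+\infty)$. The weighted $p$-Laplacian is $\Delta_{p,\phi}f=e^{\phi}\,\mathrm{div}(e^{-\phi}|\nabla f|^{p-2}\nabla f)$. A number $\Lambda$ is an eigenvalue of $\Delta_{p,\phi}$ (at time $t$) with eigenfunction $0\neq f\in W^{1,p}(M)$ if $-\Delta_{p,\phi}f=\Lambda|f|^{p-2}f$; $\lambda(t)$, the first eigenvalue, denotes the first (smallest) non-zero eigenvalue at time $t$. Standing assumption: $\lambda(t)$ exists and is $C^{1}$ in $t\in[0,T)$. Definition of $\lambda(t,f(t))$: fix $t_{0}\in[0,T)$. Let $f(t)$ be a family of functions on $M$, depending smoothly on $t$, such that $\int_{M}|f(t)|^{p}\,d\mu=1$ for all $t$ and $f(t_{0})$ is an eigenfunction of $\Delta_{p,\phi}$ at time $t_{0}$ for $\lambda(t_{0})$. Set $\lambda(t,f(t))=-\int_{M}f\,\Delta_{p,\phi}f\,d\mu$, where $\Delta_{p,\phi}$ and $d\mu$ are taken at time $t$. Both $f(t)$ and $\lambda(t,f(t))$ are assumed smooth, and $\lambda(t_{0},f(t_{0}))=\lambda(t_{0})$. *)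

theory Defs
  imports "HOL-Analysis.Analysis"
begin

section \<open>Functions of class \<open>C\<^sup>k\<close>\<close>

text \<open>Derivatives are taken within the set, so that the notion also covers half-open time
  intervals \<open>{0..<T}\<close> and cylinders \<open>{0..<T} \<times> V\<close> with \<open>V\<close> open (one-sided derivatives at time
  \<open>0\<close>).  On open sets this is ordinary differentiability.\<close>

primrec Ck_on :: "nat \<Rightarrow> 'a::real_normed_vector set \<Rightarrow> ('a \<Rightarrow> 'b::real_normed_vector) \<Rightarrow> bool" where
  "Ck_on 0 S f \<longleftrightarrow> continuous_on S f"
| "Ck_on (Suc k) S f \<longleftrightarrow> (\<forall>x\<in>S. f differentiable (at x within S)) \<and>
     (\<forall>v. Ck_on k S (\<lambda>x. frechet_derivative f (at x within S) v))"

definition smooth_on :: "'a::real_normed_vector set \<Rightarrow> ('a \<Rightarrow> 'b::real_normed_vector) \<Rightarrow> bool" where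
  "smooth_on S f \<longleftrightarrow> (\<forall>k. Ck_on k S f)"

section \<open>Closed oriented surfaces\<close>

text \<open>The surface is the whole type \<open>'m\<close>; a chart is an open set together with its coordinate
  map, whose values outside that set are irrelevant.\<close>

type_synonym 'm chart = "'m set \<times> ('m \<Rightarrow> real^2)"

abbreviation cdom :: "'m chart \<Rightarrow> 'm set" where "cdom c \<equiv> fst c"
abbreviation cimg :: "'m chart \<Rightarrow> (real^2) set" where "cimg c \<equiv> snd c ` fst c"

definition chart_inv :: "'m chart \<Rightarrow> real^2 \<Rightarrow> 'm" where
  "chart_inv c = inv_into (cdom c) (snd c)"

definition is_chart :: "('m::topological_space) chart \<Rightarrow> bool" where
  "is_chart c \<longleftrightarrow> open (cdom c) \<and> open (cimg c) \<and>
     homeomorphism (cdom c) (cimg c) (snd c) (chart_inv c)"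

definition jacobian :: "'m chart \<Rightarrow> 'm chart \<Rightarrow> 'm \<Rightarrow> real^2^2" where
  "jacobian c c' x = matrix (frechet_derivative (snd c' \<circ> chart_inv c) (at (snd c x)))"

definition oriented_atlas :: "('m::topological_space) chart set \<Rightarrow> bool" where
  "oriented_atlas A \<longleftrightarrow> (\<forall>c\<in>A. is_chart c) \<and> (\<Union>c\<in>A. cdom c) = UNIV \<and>
     (\<forall>c\<in>A. \<forall>c'\<in>A. smooth_on (snd c ` (cdom c \<inter> cdom c')) (snd c' \<circ> chart_inv c) \<and>
        (\<forall>x\<in>cdom c \<inter> cdom c'. det (jacobian c c' x) > 0))"

definition closed_oriented_surface ::
  "('m::{t2_space,second_countable_topology}) chart set \<Rightarrow> bool" where
  "closed_oriented_surface A \<longleftrightarrow> compact (UNIV :: 'm set) \<and> oriented_atlas A"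

text \<open>A chart around a point, used to evaluate scalars that do not depend on the chart.\<close>

definition chart_at :: "'m chart set \<Rightarrow> 'm \<Rightarrow> 'm chart" where
  "chart_at A x = (SOME c. c \<in> A \<and> x \<in> cdom c)"

definition C1_fun :: "('m::topological_space) chart set \<Rightarrow> ('m \<Rightarrow> real) \<Rightarrow> bool" where
  "C1_fun A u \<longleftrightarrow> (\<forall>c\<in>A. Ck_on 1 (cimg c) (u \<circ> chart_inv c))"

text \<open>The coordinate derivative \<open>\<partial>u/\<partial>x\<^sup>i\<close> in the chart \<open>c\<close>, again as a function on the surface.\<close>

definition pd :: "'m chart \<Rightarrow> 2 \<Rightarrow> ('m \<Rightarrow> real) \<Rightarrow> 'm \<Rightarrow> real" where
  "pd c i u x = frechet_derivative (u \<circ> chart_inv c) (at (snd c x)) (axis i 1)"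

section \<open>Tensor fields and Riemannian metrics\<close>

text \<open>Tensor fields are given by their components in every chart of the atlas, subject to the
  transformation law between charts.\<close>

type_synonym 'm vfield = "'m chart \<Rightarrow> 'm \<Rightarrow> real^2"
type_synonym 'm tensor2 = "'m chart \<Rightarrow> 'm \<Rightarrow> real^2^2"

definition vector_field :: "'m chart set \<Rightarrow> 'm vfield \<Rightarrow> bool" where
  "vector_field A X \<longleftrightarrow> (\<forall>c\<in>A. \<forall>c'\<in>A. \<forall>x\<in>cdom c \<inter> cdom c'. X c' x = jacobian c c' x *v X c x)"

definition riemannian_metric :: "('m::topological_space) chart set \<Rightarrow> 'm tensor2 \<Rightarrow> bool" where
  "riemannian_metric A g \<longleftrightarrow>
     (\<forall>c\<in>A. \<forall>c'\<in>A. \<forall>x\<in>cdom c \<inter> cdom c'.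
        g c x = transpose (jacobian c c' x) ** g c' x ** jacobian c c' x) \<and>
     (\<forall>c\<in>A. smooth_on (cimg c) (g c \<circ> chart_inv c) \<and>
        (\<forall>x\<in>cdom c. transpose (g c x) = g c x \<and> (\<forall>v. v \<noteq> 0 \<longrightarrow> v \<bullet> (g c x *v v) > 0)))"

text \<open>\<open>\<nu>\<close> is the Riemannian volume measure: a Borel measure which is
  \<open>\<surd>det g dx\<^sup>1 dx\<^sup>2\<close> in every chart.  There is exactly one such measure.\<close>

definition volume_measure ::
  "('m::topological_space) chart set \<Rightarrow> 'm tensor2 \<Rightarrow> 'm measure \<Rightarrow> bool" where
  "volume_measure A g \<nu> \<longleftrightarrow> sets \<nu> = sets borel \<and>
     (\<forall>c\<in>A. \<forall>B\<in>sets borel. B \<subseteq> cdom c \<longrightarrow>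
        emeasure \<nu> B =
          (\<integral>\<^sup>+ y. indicator (snd c ` B) y * ennreal (sqrt (det (g c (chart_inv c y)))) \<partial>lborel))"

section \<open>Curvature\<close>

definition christoffel :: "'m tensor2 \<Rightarrow> 'm chart \<Rightarrow> 2 \<Rightarrow> 2 \<Rightarrow> 2 \<Rightarrow> 'm \<Rightarrow> real" where
  "christoffel g c k i j x = 1/2 * (\<Sum>l\<in>UNIV. matrix_inv (g c x) $ k $ l *
     (pd c i (\<lambda>y. g c y $ j $ l) x + pd c j (\<lambda>y. g c y $ i $ l) x - pd c l (\<lambda>y. g c y $ i $ j) x))"

text \<open>\<open>riemann g c l i j k\<close> is the \<open>l\<close>-th component of \<open>R(\<partial>\<^sub>i,\<partial>\<^sub>j)\<partial>\<^sub>k\<close>; with the contraction below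
  the round sphere has positive Ricci tensor.\<close>

definition riemann :: "'m tensor2 \<Rightarrow> 'm chart \<Rightarrow> 2 \<Rightarrow> 2 \<Rightarrow> 2 \<Rightarrow> 2 \<Rightarrow> 'm \<Rightarrow> real" where
  "riemann g c l i j k x =
     pd c i (christoffel g c l j k) x - pd c j (christoffel g c l i k) x +
     (\<Sum>m\<in>UNIV. christoffel g c l i m x * christoffel g c m j k x -
                christoffel g c l j m x * christoffel g c m i k x)"

definition ricci :: "'m tensor2 \<Rightarrow> 'm tensor2" where
  "ricci g c x = (\<chi> j k. \<Sum>i\<in>UNIV. riemann g c i i j k x)"

definition scalar_curv :: "'m chart set \<Rightarrow> 'm tensor2 \<Rightarrow> 'm \<Rightarrow> real" where
  "scalar_curv A g x = (let c = chart_at A x in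
     \<Sum>j\<in>UNIV. \<Sum>k\<in>UNIV. matrix_inv (g c x) $ j $ k * ricci g c x $ j $ k)"

section \<open>Gradient, norm and Laplace operator\<close>

definition grad :: "'m tensor2 \<Rightarrow> ('m \<Rightarrow> real) \<Rightarrow> 'm vfield" where
  "grad g u c x = matrix_inv (g c x) *v (\<chi> i. pd c i u x)"

definition vnorm :: "'m chart set \<Rightarrow> 'm tensor2 \<Rightarrow> 'm vfield \<Rightarrow> 'm \<Rightarrow> real" where
  "vnorm A g X x = (let c = chart_at A x in sqrt (X c x \<bullet> (g c x *v X c x)))"

definition laplacian :: "'m chart set \<Rightarrow> 'm tensor2 \<Rightarrow> ('m \<Rightarrow> real) \<Rightarrow> 'm \<Rightarrow> real" where
  "laplacian A g u x = (let c = chart_at A x in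
     (\<Sum>i\<in>UNIV. pd c i (\<lambda>y. sqrt (det (g c y)) * grad g u c y $ i) x) / sqrt (det (g c x)))"

section \<open>Sobolev functions\<close>

text \<open>\<open>X\<close> is a weak gradient of \<open>u\<close> if in every chart the components \<open>g X\<close> of the dual covector
  field are weak partial derivatives of \<open>u\<close>, tested against smooth \<open>\<eta>\<close> with compact support in
  the image of the chart.  The integrability conditions say that \<open>u\<close> and \<open>X\<close> are locally
  integrable.  Weak gradients are unique up to null sets, and a \<open>C\<^sup>1\<close> function has its classical
  gradient as a weak gradient.\<close>

definition has_weak_grad ::
  "('m::topological_space) chart set \<Rightarrow> 'm tensor2 \<Rightarrow> ('m \<Rightarrow> real) \<Rightarrow> 'm vfield \<Rightarrow> bool" where
  "has_weak_grad A g u X \<longleftrightarrow> vector_field A X \<and>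
     (\<forall>c\<in>A. (\<lambda>x. indicator (cdom c) x *\<^sub>R X c x) \<in> borel_measurable borel) \<and>
     (\<forall>c\<in>A. \<forall>i. \<forall>\<eta>::real^2 \<Rightarrow> real.
        smooth_on UNIV \<eta> \<and> compact (closure {y. \<eta> y \<noteq> 0}) \<and> closure {y. \<eta> y \<noteq> 0} \<subseteq> cimg c \<longrightarrow>
        (let u' = (\<lambda>y. u (chart_inv c y) * frechet_derivative \<eta> (at y) (axis i 1));
             w = (\<lambda>y. (g c (chart_inv c y) *v X c (chart_inv c y)) $ i * \<eta> y)
         in integrable lborel u' \<and> integrable lborel w \<and>
            (LINT y|lborel. u' y) = - (LINT y|lborel. w y)))"

definition weak_grad ::
  "('m::topological_space) chart set \<Rightarrow> 'm tensor2 \<Rightarrow> ('m \<Rightarrow> real) \<Rightarrow> 'm vfield" where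
  "weak_grad A g u = (SOME X. has_weak_grad A g u X)"

definition sobolev :: "('m::topological_space) chart set \<Rightarrow> 'm tensor2 \<Rightarrow> 'm measure \<Rightarrow>
    real \<Rightarrow> ('m \<Rightarrow> real) \<Rightarrow> bool" where
  "sobolev A g \<nu> p u \<longleftrightarrow> u \<in> borel_measurable borel \<and> integrable \<nu> (\<lambda>x. \<bar>u x\<bar> powr p) \<and>
     (\<exists>X. has_weak_grad A g u X) \<and> integrable \<nu> (\<lambda>x. vnorm A g (weak_grad A g u) x powr p)"

section \<open>The weighted \<open>p\<close>-Laplacian\<close>

text \<open>For \<open>f \<in> W\<^sup>1\<^sup>,\<^sup>p\<close> (and, if \<open>p < 2\<close>, even for smooth \<open>f\<close>) the field \<open>|\<nabla>f|\<^sup>p\<^sup>-\<^sup>2 \<nabla>f\<close> need not be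
  differentiable, so its divergence is a distribution.  Distributions here are functionals on
  \<open>C\<^sup>1\<close> functions, a function \<open>h\<close> being identified with \<open>\<psi> \<mapsto> \<integral> h \<psi> d\<nu>\<close>; they are multiplied by
  \<open>C\<^sup>1\<close> functions in the usual way.\<close>

type_synonym 'm distr = "('m \<Rightarrow> real) \<Rightarrow> real"

definition fun_distr :: "'m measure \<Rightarrow> ('m \<Rightarrow> real) \<Rightarrow> 'm distr" where
  "fun_distr \<nu> h \<psi> = (LINT x|\<nu>. h x * \<psi> x)"

definition mult_distr :: "('m \<Rightarrow> real) \<Rightarrow> 'm distr \<Rightarrow> 'm distr" where
  "mult_distr a S \<psi> = S (\<lambda>x. a x * \<psi> x)"

definition div_distr :: "'m chart set \<Rightarrow> 'm measure \<Rightarrow> 'm vfield \<Rightarrow> 'm distr" where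
  "div_distr A \<nu> X \<psi> =
     - (LINT x|\<nu>. (let c = chart_at A x in \<Sum>i\<in>UNIV. X c x $ i * pd c i \<psi> x))"

text \<open>Since \<open>0 powr a = 0\<close>, the field \<open>|\<nabla>f|\<^sup>p\<^sup>-\<^sup>2 \<nabla>f\<close> and the function \<open>|f|\<^sup>p\<^sup>-\<^sup>2 f\<close> are \<open>0\<close> where \<open>\<nabla>f\<close>
  and \<open>f\<close> vanish, as they should be for \<open>p > 1\<close>.\<close>

definition p_laplacian :: "('m::topological_space) chart set \<Rightarrow> 'm tensor2 \<Rightarrow> 'm measure \<Rightarrow>
    ('m \<Rightarrow> real) \<Rightarrow> real \<Rightarrow> ('m \<Rightarrow> real) \<Rightarrow> 'm distr" where
  "p_laplacian A g \<nu> \<phi> p f =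
     (let X = weak_grad A g f in
      mult_distr (\<lambda>x. exp (\<phi> x))
        (div_distr A \<nu> (\<lambda>c x. (exp (- \<phi> x) * vnorm A g X x powr (p - 2)) *\<^sub>R X c x)))"

definition weighted :: "('m \<Rightarrow> real) \<Rightarrow> 'm measure \<Rightarrow> 'm measure" where
  "weighted \<phi> \<nu> = density \<nu> (\<lambda>x. ennreal (exp (- \<phi> x)))"

text \<open>The integral of a distribution against \<open>d\<mu> = e\<^sup>-\<^sup>\<phi> d\<nu>\<close>, i.e. its value at \<open>e\<^sup>-\<^sup>\<phi>\<close>.\<close>

definition integral_distr :: "('m \<Rightarrow> real) \<Rightarrow> 'm distr \<Rightarrow> real" where
  "integral_distr \<phi> S = S (\<lambda>x. exp (- \<phi> x))"

text \<open>For \<open>p = 1\<close> the expressions \<open>|f|\<^sup>p\<^sup>-\<^sup>2 f\<close> and \<open>|\<nabla>f|\<^sup>p\<^sup>-\<^sup>2 \<nabla>f\<close> have no continuous extension to the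
  zeros of \<open>f\<close> and \<open>\<nabla>f\<close>; the equation then makes sense only if these form a null set.\<close>

definition eigenfunction :: "('m::topological_space) chart set \<Rightarrow> 'm tensor2 \<Rightarrow> 'm measure \<Rightarrow>
    ('m \<Rightarrow> real) \<Rightarrow> real \<Rightarrow> real \<Rightarrow> ('m \<Rightarrow> real) \<Rightarrow> bool" where
  "eigenfunction A g \<nu> \<phi> p \<Lambda> f \<longleftrightarrow> sobolev A g \<nu> p f \<and> \<not> (AE x in \<nu>. f x = 0) \<and>
     (p = 1 \<longrightarrow> (AE x in \<nu>. f x \<noteq> 0 \<and> vnorm A g (weak_grad A g f) x \<noteq> 0)) \<and>
     (\<forall>\<psi>. C1_fun A \<psi> \<longrightarrow>
        - p_laplacian A g \<nu> \<phi> p f \<psi> = fun_distr \<nu> (\<lambda>x. \<Lambda> * (\<bar>f x\<bar> powr (p - 2) * f x)) \<psi>)"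

definition first_eigenvalue :: "('m::topological_space) chart set \<Rightarrow> 'm tensor2 \<Rightarrow>
    'm measure \<Rightarrow> ('m \<Rightarrow> real) \<Rightarrow> real \<Rightarrow> real \<Rightarrow> bool" where
  "first_eigenvalue A g \<nu> \<phi> p \<Lambda> \<longleftrightarrow> \<Lambda> \<noteq> 0 \<and> (\<exists>f. eigenfunction A g \<nu> \<phi> p \<Lambda> f) \<and>
     (\<forall>\<Lambda>' f. \<Lambda>' \<noteq> 0 \<and> eigenfunction A g \<nu> \<phi> p \<Lambda>' f \<longrightarrow> \<Lambda> \<le> \<Lambda>')"

text \<open>The quantity \<open>- \<integral> f \<Delta>\<^sub>p\<^sub>,\<^sub>\<phi> f d\<mu>\<close>.\<close>

definition p_energy :: "('m::topological_space) chart set \<Rightarrow> 'm tensor2 \<Rightarrow> 'm measure \<Rightarrow>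
    ('m \<Rightarrow> real) \<Rightarrow> real \<Rightarrow> ('m \<Rightarrow> real) \<Rightarrow> real" where
  "p_energy A g \<nu> \<phi> p f = - integral_distr \<phi> (mult_distr f (p_laplacian A g \<nu> \<phi> p f))"

section \<open>Time-dependent objects\<close>

definition in_chart :: "'m chart \<Rightarrow> (real \<Rightarrow> 'm \<Rightarrow> 'b) \<Rightarrow> real \<times> (real^2) \<Rightarrow> 'b" where
  "in_chart c u = (\<lambda>(t, y). u t (chart_inv c y))"

definition smooth_spacetime ::
  "('m::topological_space) chart set \<Rightarrow> real \<Rightarrow> (real \<Rightarrow> 'm \<Rightarrow> real) \<Rightarrow> bool" where
  "smooth_spacetime A T u \<longleftrightarrow> (\<forall>c\<in>A. smooth_on ({0..<T} \<times> cimg c) (in_chart c u))"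

text \<open>\<open>t \<mapsto> f(t)\<close> is smooth with values in the \<open>C\<^sup>1\<close> functions: all time derivatives \<open>F k\<close> of \<open>f\<close>
  exist and are of class \<open>C\<^sup>1\<close> on space-time.  Every \<open>f\<close> that is smooth on space-time has this
  property; more regularity in space is not to be expected of eigenfunctions if \<open>p \<noteq> 2\<close>.\<close>

definition smooth_in_time ::
  "('m::topological_space) chart set \<Rightarrow> real \<Rightarrow> (real \<Rightarrow> 'm \<Rightarrow> real) \<Rightarrow> bool" where
  "smooth_in_time A T f \<longleftrightarrow> (\<exists>F::nat \<Rightarrow> real \<Rightarrow> 'm \<Rightarrow> real. F 0 = f \<and>
     (\<forall>k. \<forall>c\<in>A. Ck_on 1 ({0..<T} \<times> cimg c) (in_chart c (F k))) \<and>
     (\<forall>k. \<forall>t\<in>{0..<T}. \<forall>x.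
        ((\<lambda>s. F k s x) has_real_derivative F (Suc k) t x) (at t within {0..<T})))"

definition ricci_bourguignon_flow :: "('m::topological_space) chart set \<Rightarrow> real \<Rightarrow> real \<Rightarrow>
    'm tensor2 \<Rightarrow> (real \<Rightarrow> 'm tensor2) \<Rightarrow> bool" where
  "ricci_bourguignon_flow A \<rho> T g0 g \<longleftrightarrow>
     (\<forall>t\<in>{0..<T}. riemannian_metric A (g t)) \<and>
     (\<forall>c\<in>A. smooth_on ({0..<T} \<times> cimg c) (in_chart c (\<lambda>t. g t c))) \<and>
     (\<forall>c\<in>A. \<forall>x\<in>cdom c. g 0 c x = g0 c x) \<and>
     (\<forall>c\<in>A. \<forall>x\<in>cdom c. \<forall>t\<in>{0..<T}.
        ((\<lambda>s. g s c x) has_vector_derivative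
           (- 2 *\<^sub>R ricci (g t) c x + (2 * \<rho> * scalar_curv A (g t) x) *\<^sub>R g t c x))
          (at t within {0..<T}))"

end

theory Submission
  imports Defs
begin

text \<open>In dimension two the algebraic symmetries of the curvature tensor force \<open>Ric = (R / 2) g\<close>, so the flow
  is the conformal flow \<open>\<partial>\<^sub>t g = h g\<close> with \<open>h = - (1 - 2 \<rho>) R\<close>.  Hence \<open>g(t) = a(t) g(t\<^sub>0)\<close> with a positive
  function \<open>a\<close>, the volume measure is \<open>d\<nu>(t) = a(t) d\<nu>(t\<^sub>0)\<close>, and the energy becomes an integral against the
  fixed measure \<open>d\<nu>(t\<^sub>0)\<close>:
  \<open>\<lambda>(t, f(t)) = \<integral> |\<nabla>f(t)|\<^sup>p a(t)\<^sup>1\<^sup>-\<^sup>p\<^sup>/\<^sup>2 e\<^sup>-\<^sup>\<phi>\<^sup>(\<^sup>t\<^sup>) d\<nu>(t\<^sub>0)\<close>, where the norm is that of \<open>g(t\<^sub>0)\<close>.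
  This is differentiated under the integral.  At \<open>t\<^sub>0\<close> the term containing \<open>\<partial>\<^sub>t f\<close> is
  \<open>p \<integral> |\<nabla>f|\<^sup>p\<^sup>-\<^sup>2 \<langle>\<nabla>f, \<nabla>\<partial>\<^sub>t f\<rangle> d\<mu> = p \<lambda> \<integral> |f|\<^sup>p\<^sup>-\<^sup>2 f \<partial>\<^sub>t f d\<mu>\<close> by the eigenvalue equation, and the right-hand side is
  \<open>- \<lambda> \<integral> |f|\<^sup>p (h - \<partial>\<^sub>t \<phi>) d\<mu>\<close> because the normalisation \<open>\<integral> |f|\<^sup>p d\<mu> = 1\<close> has derivative \<open>0\<close>.

  The energy is defined through an arbitrary weak gradient; by the fundamental lemma of the calculus
  of variations it may be replaced by the classical one, which \<open>f(t)\<close> has.\<close>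

section \<open>Smooth bump functions\<close>

text \<open>The delicate point is the power p/2 of q = |\<nabla>f|^2. For p < 2 it is singular at
  the critical points of f, which every C^1 function on a closed surface has, and f and \<partial>_t
  f are only assumed C^1 in space. Cauchy-Schwarz is what permits the differentiation: |\<partial>_t
  q| \<le> 2 |\<nabla>\<partial>_t f| sqrt q, so sqrt q is Lipschitz in time, uniformly in space.
  Hence q^(p/2) is Lipschitz too, and for p > 1 its time derivative at a zero of q is 0. For p = 1
  the notion of eigenfunction makes the zeros at \<open>t\<^sub>0\<close> a null set. The same
  argument with q = f^2 differentiates the normalisation. Under g(t) = a g(\<open>t\<^sub>0\<close>)
  the volume contributes the factor a and the gradient norm a^(-p/2), whence the exponent 1 - p/2.
  The coefficient 1 + \<rho>p - 2\<rho> - p/2 of the result is the product (1 - 2\<rho>)(1 - p/2).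
  The eigenvalue equation is tested against C^1 functions, so \<partial>_t f is admissible.\<close>

lemma Ck_on_Suc_imp: "Ck_on (Suc k) S f \<Longrightarrow> Ck_on k S f"
proof (induction k arbitrary: f)
  case 0
  then show ?case
    by (auto simp: continuous_on_eq_continuous_within intro: differentiable_imp_continuous_within)
next
  case (Suc k)
  have "f differentiable (at x within S)" if "x \<in> S" for x
    using Suc.prems that by simp
  moreover have "Ck_on k S (\<lambda>x. frechet_derivative f (at x within S) v)" for v
  proof -
    have "Ck_on (Suc k) S (\<lambda>x. frechet_derivative f (at x within S) v)"
      using Suc.prems by simp
    then show ?thesis by (rule Suc.IH)
  qed
  ultimately show ?case by simp
qed

text \<open>Derivatives on the whole space are unique, so an explicit candidate may replace
  \<open>frechet_derivative\<close>; the inductions below work with such candidates only.\<close>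

lemma Ck_on_UNIV_SucI:
  assumes "\<And>x. (f has_derivative f' x) (at x)" "\<And>v. Ck_on k UNIV (\<lambda>x. f' x v)"
  shows "Ck_on (Suc k) UNIV f"
proof -
  have "frechet_derivative f (at x) = f' x" for x
    using frechet_derivative_at[OF assms(1)] by simp
  then show ?thesis
    using assms by (auto simp: differentiable_def)
qed

lemma Ck_on_UNIV_SucE:
  assumes "Ck_on (Suc k) UNIV f"
  obtains f' where "\<And>x. (f has_derivative f' x) (at x)" "\<And>v. Ck_on k UNIV (\<lambda>x. f' x v)"
  using assms by (auto simp: frechet_derivative_works intro: that)

lemma Ck_on_const_UNIV: "Ck_on k UNIV (\<lambda>x. c)"
  by (induction k arbitrary: c) auto

lemma Ck_on_add_UNIV:
  assumes "Ck_on k UNIV f" "Ck_on k UNIV g"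
  shows "Ck_on k UNIV (\<lambda>x. f x + g x)"
  using assms
proof (induction k arbitrary: f g)
  case 0
  then show ?case by (auto intro: continuous_intros)
next
  case (Suc k)
  obtain f' where f': "\<And>x. (f has_derivative f' x) (at x)" "\<And>v. Ck_on k UNIV (\<lambda>x. f' x v)"
    using Ck_on_UNIV_SucE[OF Suc.prems(1)] by metis
  obtain g' where g': "\<And>x. (g has_derivative g' x) (at x)" "\<And>v. Ck_on k UNIV (\<lambda>x. g' x v)"
    using Ck_on_UNIV_SucE[OF Suc.prems(2)] by metis
  show ?case
    by (rule Ck_on_UNIV_SucI[where f' = "\<lambda>x v. f' x v + g' x v"])
       (auto intro!: derivative_intros f' g' Suc.IH)
qed

lemma Ck_on_mult_UNIV:
  fixes f g :: "'a::real_normed_vector \<Rightarrow> 'b::real_normed_algebra"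
  assumes "Ck_on k UNIV f" "Ck_on k UNIV g"
  shows "Ck_on k UNIV (\<lambda>x. f x * g x)"
  using assms
proof (induction k arbitrary: f g)
  case 0
  then show ?case by (auto intro: continuous_intros)
next
  case (Suc k)
  obtain f' where f': "\<And>x. (f has_derivative f' x) (at x)" "\<And>v. Ck_on k UNIV (\<lambda>x. f' x v)"
    using Ck_on_UNIV_SucE[OF Suc.prems(1)] by metis
  obtain g' where g': "\<And>x. (g has_derivative g' x) (at x)" "\<And>v. Ck_on k UNIV (\<lambda>x. g' x v)"
    using Ck_on_UNIV_SucE[OF Suc.prems(2)] by metis
  \<comment> \<open>The Leibniz rule contains the undifferentiated factors, so these are needed at
    order \<open>k\<close> as well.\<close>
  have fg: "Ck_on k UNIV f" "Ck_on k UNIV g"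
    using Suc.prems by (auto intro: Ck_on_Suc_imp simp del: Ck_on.simps)
  show ?case
    by (rule Ck_on_UNIV_SucI[where f' = "\<lambda>x v. f x * g' x v + f' x v * g x"])
       (auto intro!: derivative_eq_intros f' g' Ck_on_add_UNIV Suc.IH fg)
qed

lemma Ck_on_prod_UNIV:
  fixes f :: "'i \<Rightarrow> 'a::real_normed_vector \<Rightarrow> real"
  assumes "\<And>i. i \<in> I \<Longrightarrow> Ck_on k UNIV (f i)"
  shows "Ck_on k UNIV (\<lambda>x. \<Prod>i\<in>I. f i x)"
  using assms
  by (induction I rule: infinite_finite_induct) (auto intro: Ck_on_const_UNIV Ck_on_mult_UNIV)

text \<open>The derivatives of \<open>exp (- 1 / x)\<close>, extended by \<open>0\<close> to the left of the origin, are of this form.\<close>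

definition flat :: "real poly \<Rightarrow> real \<Rightarrow> real" where
  "flat P x = (if x > 0 then poly P (1 / x) * exp (- (1 / x)) else 0)"

lemma poly_times_exp_minus_tendsto_0:
  fixes P :: "real poly"
  shows "((\<lambda>x. poly P x * exp (- x)) \<longlongrightarrow> 0) at_top"
proof -
  have "((\<lambda>x. \<Sum>i\<le>degree P. coeff P i * (x ^ i / exp x)) \<longlongrightarrow> (\<Sum>i\<le>degree P. coeff P i * 0)) at_top"
    by (intro tendsto_intros tendsto_power_div_exp_0)
  then show ?thesis
    by (simp add: poly_altdef sum_distrib_right exp_minus divide_inverse mult.assoc)
qed

lemma flat_tendsto_0: "(flat P \<longlongrightarrow> 0) (at 0)"
proof -
  have "((\<lambda>x. poly P (1 / x) * exp (- (1 / x))) \<longlongrightarrow> 0) (at_right 0)"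
    using filterlim_compose[OF poly_times_exp_minus_tendsto_0 filterlim_inverse_at_top_right]
    by (simp add: inverse_eq_divide)
  then have "(flat P \<longlongrightarrow> 0) (at_right 0)"
    by (rule Lim_transform_eventually) (auto simp: flat_def eventually_at_right_less eventually_at_filter)
  moreover have "(flat P \<longlongrightarrow> 0) (at_left 0)"
    by (rule Lim_transform_eventually[OF tendsto_const]) (auto simp: flat_def eventually_at_filter)
  ultimately show ?thesis
    by (simp add: filterlim_at_split)
qed

text \<open>For x > 0 the derivative of P(1/x) exp(-1/x) is (1/x)^2 (P - P')(1/x) exp(-1/x), so the
  polynomial X^2 (P - P') takes the place of P.\<close>

lemma flat_has_real_derivative:
  "(flat P has_real_derivative flat (monom 1 2 * (P - pderiv P)) x) (at x)"
proof -
  consider "x > 0" | "x < 0" | "x = 0" by linarith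
  then show ?thesis
  proof cases
    case 1
    have "((\<lambda>x. poly P (1 / x) * exp (- (1 / x))) has_real_derivative
        flat (monom 1 2 * (P - pderiv P)) x) (at x)"
      using 1 by (auto intro!: derivative_eq_intros DERIV_chain'[OF _ poly_DERIV]
          simp: flat_def poly_monom field_simps power2_eq_square)
    then show ?thesis
      by (rule has_field_derivative_transform_within_open[where S = "{0<..}"])
         (use 1 in \<open>auto simp: flat_def\<close>)
  next
    case 2
    have "((\<lambda>x. 0) has_real_derivative flat (monom 1 2 * (P - pderiv P)) x) (at x)"
      using 2 by (simp add: flat_def)
    then show ?thesis
      by (rule has_field_derivative_transform_within_open[where S = "{..<0}"])
         (use 2 in \<open>auto simp: flat_def\<close>)
  next
    case 3
    \<comment> \<open>Dividing by h multiplies the polynomial in 1/h by its variable: the difference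
      quotient at the origin is again a flat function, and flat functions tend to 0 there.\<close>
    have "(\<lambda>h. (flat P (0 + h) - flat P 0) / h) = flat (pCons 0 P)"
      by (auto simp: flat_def)
    then show ?thesis
      using flat_tendsto_0[of "pCons 0 P"] 3 by (simp add: DERIV_def) (simp add: flat_def)
  qed
qed

text \<open>The induction runs over all polynomials at once because \<open>flat\<close> reproduces
  itself under differentiation; the affine argument contributes only the constant factor
  \<open>l v\<close>.\<close>

lemma Ck_on_flat_affine:
  fixes l :: "'a::real_normed_vector \<Rightarrow> real"
  assumes "bounded_linear l"
  shows "Ck_on k UNIV (\<lambda>y. flat P (l y + \<beta>))"
proof (induction k arbitrary: P)
  case 0
  have "isCont (flat P) x" for x
    using flat_has_real_derivative by (rule DERIV_isCont)
  then have "continuous_on UNIV (flat P)"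
    by (simp add: continuous_at_imp_continuous_on)
  moreover have "continuous_on UNIV (\<lambda>y. l y + \<beta>)"
    using assms by (intro continuous_intros linear_continuous_on)
  ultimately show ?case
    by (auto intro: continuous_on_compose2)
next
  case (Suc k)
  show ?case
  proof (rule Ck_on_UNIV_SucI[where f' = "\<lambda>y v. l v * flat (monom 1 2 * (P - pderiv P)) (l y + \<beta>)"])
    show "((\<lambda>y. flat P (l y + \<beta>)) has_derivative
        (\<lambda>v. l v * flat (monom 1 2 * (P - pderiv P)) (l y + \<beta>))) (at y)" for y
    proof -
      have "((\<lambda>y. l y + \<beta>) has_derivative l) (at y)"
        using bounded_linear_imp_has_derivative[OF assms] by (auto intro!: derivative_eq_intros)
      from has_derivative_compose[OF this flat_has_real_derivative[unfolded has_field_derivative_def]]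
      show ?thesis
        by (simp add: mult.commute)
    qed
    show "Ck_on k UNIV (\<lambda>y. l v * flat (monom 1 2 * (P - pderiv P)) (l y + \<beta>))" for v
      by (intro Ck_on_mult_UNIV Ck_on_const_UNIV Suc.IH)
  qed
qed

text \<open>Plateau functions are not needed: \<open>exp (- 1 / (n x))\<close> tends to \<open>1\<close> for every \<open>x > 0\<close> as \<open>n\<close> grows, so
  these functions tend to the indicator of the box.\<close>

definition box_bump :: "real \<Rightarrow> real^'n \<Rightarrow> real^'n \<Rightarrow> real^'n \<Rightarrow> real" where
  "box_bump n a b y = (\<Prod>i\<in>UNIV. flat 1 (n * y $ i - n * a $ i) * flat 1 (n * b $ i - n * y $ i))"

lemma smooth_on_box_bump: "smooth_on UNIV (box_bump n a b :: real^'n \<Rightarrow> real)"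
  unfolding smooth_on_def
proof
  fix k
  have "Ck_on k UNIV (\<lambda>y::real^'n. flat 1 (n * y $ i - n * a $ i))" for i
    using Ck_on_flat_affine[of "\<lambda>y::real^'n. n * y $ i" k 1 "- n * a $ i"]
    by (simp add: bounded_linear_mult_right[THEN bounded_linear_compose] bounded_linear_vec_nth)
  moreover have "Ck_on k UNIV (\<lambda>y::real^'n. flat 1 (n * b $ i - n * y $ i))" for i
  proof -
    have "bounded_linear (\<lambda>y::real^'n. - n * y $ i)"
      by (intro bounded_linear_mult_right[THEN bounded_linear_compose] bounded_linear_vec_nth)
    from Ck_on_flat_affine[OF this, of k 1 "n * b $ i"] show ?thesis
      by simp
  qed
  ultimately show "Ck_on k UNIV (box_bump n a b)"
    unfolding box_bump_def by (intro Ck_on_prod_UNIV Ck_on_mult_UNIV)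
qed

lemma flat_1_bounds: "0 \<le> flat 1 x" "flat 1 x \<le> 1" "flat 1 x \<noteq> 0 \<longleftrightarrow> x > 0"
  by (auto simp: flat_def)

lemma box_bump_bounds: "0 \<le> box_bump n a b y" "box_bump n a b y \<le> 1"
  unfolding box_bump_def by (auto intro!: prod_nonneg prod_le_1 mult_le_one flat_1_bounds mult_nonneg_nonneg)

lemma box_bump_nonzero:
  assumes "n > 0"
  shows "box_bump n a b y \<noteq> 0 \<longleftrightarrow> y \<in> box a b"
proof -
  have "n * b $ i - n * y $ i > 0 \<longleftrightarrow> y $ i < b $ i" "n * y $ i - n * a $ i > 0 \<longleftrightarrow> a $ i < y $ i" for i
    using assms by auto
  then show ?thesis
    unfolding box_bump_def using flat_1_bounds(3)
    by (auto simp: mem_box_cart)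
qed

lemma support_box_bump:
  assumes "n > 0"
  shows "compact (closure {y. box_bump n a b y \<noteq> 0})" "closure {y. box_bump n a b y \<noteq> 0} \<subseteq> cbox a b"
proof -
  have "{y. box_bump n a b y \<noteq> 0} = box a b"
    using box_bump_nonzero[OF assms] by auto
  then show "compact (closure {y. box_bump n a b y \<noteq> 0})" "closure {y. box_bump n a b y \<noteq> 0} \<subseteq> cbox a b"
    by (auto simp: bounded_box intro: closure_minimal[THEN subsetD, OF box_subset_cbox closed_cbox])
qed

lemma flat_1_tendsto_1:
  assumes "d > 0"
  shows "(\<lambda>n. flat 1 (real n * d)) \<longlonglongrightarrow> 1"
proof -
  have "(\<lambda>n. exp (- ((1 / d) * (1 / real n)))) \<longlonglongrightarrow> exp (- ((1 / d) * 0))"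
    by (intro tendsto_intros lim_1_over_n)
  moreover have "\<forall>\<^sub>F n in sequentially. exp (- ((1 / d) * (1 / real n))) = flat 1 (real n * d)"
    using eventually_gt_at_top[of 0] by eventually_elim (use assms in \<open>simp add: flat_def mult.commute\<close>)
  ultimately show ?thesis
    by (auto intro: Lim_transform_eventually)
qed

lemma box_bump_tendsto_indicator:
  fixes y :: "real^'a"
  shows "(\<lambda>n. box_bump (real n) a b y) \<longlonglongrightarrow> indicator (box a b) y"
proof (cases "y \<in> box a b")
  case True
  have "(\<lambda>n. flat 1 (real n * y $ i - real n * a $ i) * flat 1 (real n * b $ i - real n * y $ i)) \<longlonglongrightarrow> 1 * 1" for i
    unfolding right_diff_distrib[symmetric]
    using True by (intro tendsto_mult flat_1_tendsto_1) (auto simp: mem_box_cart)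
  then have "(\<lambda>n. box_bump (real n) a b y) \<longlonglongrightarrow> (\<Prod>i\<in>(UNIV :: 'a set). 1 * 1)"
    unfolding box_bump_def by (intro tendsto_prod)
  then show ?thesis
    using True by simp
next
  case False
  have "box_bump (real n) a b y = 0" if "n > 0" for n
    using box_bump_nonzero[of "real n" a b y] that False by auto
  then have "\<forall>\<^sub>F n in sequentially. 0 = box_bump (real n) a b y"
    by (intro eventually_mono[OF eventually_gt_at_top[of 0]]) simp
  then show ?thesis
    using False by (auto intro: Lim_transform_eventually[OF tendsto_const])
qed

section \<open>Charts and space-time derivatives\<close>

lemma frechet_derivative_within_open:
  assumes "open S" "x \<in> S"
  shows "frechet_derivative f (at x within S) = frechet_derivative f (at x)"
  using at_within_open[OF assms(2,1)] by simp

lemma Ck_on_1_iff: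
  "Ck_on 1 S f \<longleftrightarrow> (\<forall>x\<in>S. f differentiable (at x within S)) \<and>
     (\<forall>v. continuous_on S (\<lambda>x. frechet_derivative f (at x within S) v))"
  unfolding One_nat_def Ck_on.simps ..

text \<open>This makes derivatives within the time interval unique, including the one-sided ones at
  time 0.\<close>

lemma at_within_atLeastLessThan_neq_bot:
  fixes t T :: real
  assumes "t \<in> {0..<T}"
  shows "at t within {0..<T} \<noteq> bot"
proof -
  have "t islimpt {0..<T}"
  proof (rule connected_imp_perfect)
    have "(t + T) / 2 \<in> {0..<T}" "(t + T) / 2 \<noteq> t"
      using assms by auto
    then show "{0..<T} \<noteq> {a}" for a
      by (metis assms singletonD)
  qed (use assms in auto)
  then show ?thesis
    by (simp add: trivial_limit_within)
qed

lemma has_derivative_time_slice: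
  assumes "u differentiable (at (t, y) within I \<times> V)" "y \<in> V"
  shows "((\<lambda>s. u (s, y)) has_vector_derivative
      frechet_derivative u (at (t, y) within I \<times> V) (1, 0)) (at t within I)"
proof -
  define D where "D = frechet_derivative u (at (t, y) within I \<times> V)"
  have D: "(u has_derivative D) (at (t, y) within I \<times> V)"
    using assms(1) by (simp add: D_def frechet_derivative_works)
  have "((\<lambda>s. (s, y)) has_derivative (\<lambda>h. (h, 0))) (at t within I)"
    by (intro derivative_intros)
  moreover have "(u has_derivative D) (at (t, y) within (\<lambda>s. (s, y)) ` I)"
    using D by (rule has_derivative_subset) (use assms(2) in auto)
  ultimately have "((\<lambda>s. u (s, y)) has_derivative (\<lambda>h. D (h, 0))) (at t within I)"
    by (rule has_derivative_in_compose)
  moreover have "(\<lambda>h. D (h, 0)) = (\<lambda>h. h *\<^sub>R D (1, 0))"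
  proof
    show "D (h, 0) = h *\<^sub>R D (1, 0)" for h
      unfolding linear_cmul[OF has_derivative_linear[OF D], symmetric] by simp
  qed
  ultimately show ?thesis
    unfolding has_vector_derivative_def D_def[symmetric] by (simp only:)
qed

lemma has_derivative_space_slice:
  assumes "u differentiable (at (t, y) within I \<times> V)" "t \<in> I" "open V" "y \<in> V"
  shows "((\<lambda>y. u (t, y)) has_derivative
      (\<lambda>v. frechet_derivative u (at (t, y) within I \<times> V) (0, v))) (at y)"
proof -
  define D where "D = frechet_derivative u (at (t, y) within I \<times> V)"
  have D: "(u has_derivative D) (at (t, y) within I \<times> V)"
    using assms(1) by (simp add: D_def frechet_derivative_works)
  have "((\<lambda>y. (t, y)) has_derivative (\<lambda>h. (0, h))) (at y within V)"
    by (intro derivative_intros)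
  moreover have "(u has_derivative D) (at (t, y) within (\<lambda>y. (t, y)) ` V)"
    using D by (rule has_derivative_subset) (use assms(2) in auto)
  ultimately have "((\<lambda>y. u (t, y)) has_derivative (\<lambda>h. D (0, h))) (at y within V)"
    by (rule has_derivative_in_compose)
  then show ?thesis
    using at_within_open[OF assms(4,3)] by (simp add: D_def)
qed

lemma has_real_derivative_along_line:
  fixes k :: "'a::real_normed_vector \<Rightarrow> real"
  assumes "(k has_derivative k') (at (y + z *\<^sub>R e))"
  shows "((\<lambda>z. k (y + z *\<^sub>R e)) has_real_derivative k' e) (at z)"
proof -
  have "((\<lambda>z. y + z *\<^sub>R e) has_derivative (\<lambda>h. h *\<^sub>R e)) (at z)"
    by (auto intro!: derivative_eq_intros)
  from has_derivative_compose[OF this assms]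
  have "((\<lambda>z. k (y + z *\<^sub>R e)) has_derivative (\<lambda>h. k' (h *\<^sub>R e))) (at z)" .
  moreover have "(\<lambda>h. k' (h *\<^sub>R e)) = (*) (k' e)"
    by (intro ext) (simp add: linear_cmul[OF has_derivative_linear[OF assms]] mult.commute)
  ultimately show ?thesis
    by (simp add: has_field_derivative_def)
qed

text \<open>\<open>closed_segment\<close> allows \<open>s\<close> on either side of
  \<open>t\<close>. In this form bounds on derivatives within an interval become Lipschitz bounds at
  both kinds of points, interior and end points.\<close>

lemma mvt_within_interval:
  fixes w w' :: "real \<Rightarrow> real"
  assumes I: "is_interval I" "t \<in> I" "s \<in> I"
    and w: "\<And>r. r \<in> I \<Longrightarrow> (w has_real_derivative w' r) (at r within I)"
  shows "\<exists>r\<in>closed_segment t s. w s - w t = (s - t) * w' r"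
proof -
  have *: "\<exists>r\<in>closed_segment a b. w b - w a = (b - a) * w' r" if "a < b" "a \<in> I" "b \<in> I" for a b
  proof -
    have ab: "{a..b} \<subseteq> I"
      using I(1) that by (meson atLeastAtMost_iff is_interval_1 subsetI)
    have "\<exists>r\<in>{a<..<b}. w b - w a = (*) (w' r) (b - a)"
    proof (rule mvt_simple[OF \<open>a < b\<close>])
      fix r assume "a \<le> r" "r \<le> b"
      then have "r \<in> I"
        using ab by auto
      from has_derivative_subset[OF w[OF this, unfolded has_field_derivative_def] ab]
      show "(w has_derivative (*) (w' r)) (at r within {a..b})" .
    qed
    then show ?thesis
      using \<open>a < b\<close> by (auto simp: closed_segment_eq_real_ivl mult.commute)
  qed
  consider "t < s" | "s < t" | "s = t" by linarith
  then show ?thesis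
  proof cases
    case 2
    from *[OF this I(3,2)] obtain r where r: "r \<in> closed_segment s t" "w t - w s = (t - s) * w' r"
      by blast
    have "w s - w t = (s - t) * w' r"
      using r(2) by (simp add: algebra_simps)
    then show ?thesis
      using r(1) by (auto simp: closed_segment_commute)
  next
    case 1
    then show ?thesis
      using * I by blast
  qed auto
qed

text \<open>Interchange of a one-sided time derivative with a derivative in \<open>z\<close>: both difference
  quotients are taken by the mean value theorem, so only the continuity of \<open>V\<close> at one point matters.\<close>

lemma has_real_derivative_interchange:
  fixes u v V :: "real \<Rightarrow> real \<Rightarrow> real"
  assumes d: "d > 0" and I: "is_interval I" "t \<in> I"
    and u_t: "\<And>s z. s \<in> I \<Longrightarrow> \<bar>z\<bar> < d \<Longrightarrow> ((\<lambda>r. u r z) has_real_derivative v s z) (at s within I)"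
    and u_z: "\<And>s. s \<in> I \<Longrightarrow> (u s has_real_derivative W s) (at 0)"
    and v_z: "\<And>s z. s \<in> I \<Longrightarrow> \<bar>z\<bar> < d \<Longrightarrow> (v s has_real_derivative V s z) (at z)"
    and V_cont: "continuous (at (t, 0) within I \<times> UNIV) (\<lambda>(s, z). V s z)"
  shows "(W has_real_derivative V t 0) (at t within I)"
  unfolding has_field_derivative_iff Lim_within
proof (intro allI impI)
  fix e :: real
  assume "e > 0"
  then have "e / 2 > 0"
    by simp
  then obtain \<delta> where \<delta>: "\<delta> > 0"
    "\<And>s z. s \<in> I \<Longrightarrow> dist (s, z) (t, 0) < \<delta> \<Longrightarrow> dist (V s z) (V t 0) < e / 2"
    using V_cont unfolding continuous_within_eps_delta by fastforce
  \<comment> \<open>Half of \<open>\<delta>\<close> for each coordinate, since the distance of pairs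
    is at most the sum of the coordinate distances.\<close>
  define m where "m = min d (\<delta> / 2)"
  have m: "m > 0" "m \<le> d"
    using d \<delta> by (auto simp: m_def)
  have Vclose: "\<bar>V s z - V t 0\<bar> \<le> e / 2" if "s \<in> I" "\<bar>s - t\<bar> < m" "\<bar>z\<bar> < m" for s z
  proof -
    have "dist (s, z) (t, 0) \<le> \<bar>s - t\<bar> + \<bar>z\<bar>"
      unfolding dist_Pair_Pair dist_real_def by (rule order_trans[OF sqrt_sum_squares_le_sum_abs]) simp
    also have "\<dots> < \<delta>"
      using that by (simp add: m_def)
    finally show ?thesis
      using \<delta>(2)[of s z] that by (simp add: dist_real_def)
  qed
  have est: "\<bar>(u s z - u s 0) / z - (u t z - u t 0) / z - (s - t) * V t 0\<bar> \<le> \<bar>s - t\<bar> * (e / 2)"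
    if s: "s \<in> I" "\<bar>s - t\<bar> < m" and z: "\<bar>z\<bar> < m" "z \<noteq> 0" for s z
  proof -
    \<comment> \<open>The increment of \<open>w\<close> from \<open>t\<close> to \<open>s\<close> is
      the mixed second difference of \<open>u\<close>. A mean value in time and then one in
      \<open>z\<close> turn it into (s - t) z V(r, \<theta>).\<close>
    define w where "w r = u r z - u r 0" for r
    have w': "(w has_real_derivative v r z - v r 0) (at r within I)" if "r \<in> I" for r
      unfolding w_def using that z m d by (auto intro!: derivative_eq_intros u_t)
    from mvt_within_interval[OF I s(1) w'] obtain r
      where r: "r \<in> closed_segment t s" "w s - w t = (s - t) * (v r z - v r 0)"
      by auto
    have rI: "r \<in> I"
      using closed_segment_subset[OF I(2) s(1)] I(1) r(1) is_interval_convex_1 by blast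
    have rm: "\<bar>r - t\<bar> < m"
      using r(1) s(2) by (auto simp: closed_segment_eq_real_ivl split: if_splits)
    have "\<exists>\<theta>\<in>closed_segment 0 z. v r z - v r 0 = (z - 0) * V r \<theta>"
    proof (rule mvt_within_interval)
      show "is_interval {- m<..<m}" "0 \<in> {- m<..<m}" "z \<in> {- m<..<m}"
        using z m by (auto simp: is_interval_oo)
      show "(v r has_real_derivative V r \<theta>) (at \<theta> within {- m<..<m})" if "\<theta> \<in> {- m<..<m}" for \<theta>
        using v_z[OF rI, of \<theta>] that m by (auto intro: has_field_derivative_at_within)
    qed
    then obtain \<theta> where \<theta>: "\<theta> \<in> closed_segment 0 z" "v r z - v r 0 = z * V r \<theta>"
      by auto
    have "\<bar>\<theta>\<bar> < m"
      using \<theta>(1) z by (auto simp: closed_segment_eq_real_ivl split: if_splits)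
    have "(u s z - u s 0) / z - (u t z - u t 0) / z = (s - t) * V r \<theta>"
      using r(2) z(2) by (simp add: w_def \<theta>(2) diff_divide_distrib[symmetric])
    then have "\<bar>(u s z - u s 0) / z - (u t z - u t 0) / z - (s - t) * V t 0\<bar> = \<bar>s - t\<bar> * \<bar>V r \<theta> - V t 0\<bar>"
      by (metis abs_mult right_diff_distrib)
    also have "\<dots> \<le> \<bar>s - t\<bar> * (e / 2)"
      using Vclose[OF rI rm \<open>\<bar>\<theta>\<bar> < m\<close>] by (intro mult_left_mono) auto
    finally show ?thesis .
  qed
  \<comment> \<open>The estimate is uniform in \<open>z\<close>, so \<open>z\<close> may tend to 0
    first; the quotients in \<open>z\<close> become \<open>W\<close>. The limit keeps only a weak
    inequality, which is why \<open>e / 2\<close> was used.\<close>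
  have lim: "\<bar>W s - W t - (s - t) * V t 0\<bar> \<le> \<bar>s - t\<bar> * (e / 2)" if s: "s \<in> I" "\<bar>s - t\<bar> < m" for s
  proof -
    have q: "((\<lambda>z. (u s z - u s 0) / z) \<longlongrightarrow> W s) (at 0)" if "s \<in> I" for s
      using u_z[OF that] by (simp add: has_field_derivative_iff)
    have "((\<lambda>z. \<bar>(u s z - u s 0) / z - (u t z - u t 0) / z - (s - t) * V t 0\<bar>) \<longlongrightarrow>
        \<bar>W s - W t - (s - t) * V t 0\<bar>) (at 0)"
      using s I by (intro tendsto_intros q)
    moreover have "\<forall>\<^sub>F z in at 0. \<bar>(u s z - u s 0) / z - (u t z - u t 0) / z - (s - t) * V t 0\<bar> \<le> \<bar>s - t\<bar> * (e / 2)"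
      unfolding eventually_at using m est[OF s] by (intro exI[of _ m]) (auto simp: dist_real_def)
    ultimately show ?thesis
      by (rule tendsto_upperbound) simp
  qed
  show "\<exists>\<delta>>0. \<forall>s\<in>I. 0 < dist s t \<and> dist s t < \<delta> \<longrightarrow> dist ((W s - W t) / (s - t)) (V t 0) < e"
  proof (intro exI[of _ m] conjI ballI impI \<open>m > 0\<close>)
    fix s assume s: "s \<in> I" "0 < dist s t \<and> dist s t < m"
    then have "\<bar>W s - W t - (s - t) * V t 0\<bar> < \<bar>s - t\<bar> * e"
      using lim[of s] mult_pos_pos[OF _ \<open>e > 0\<close>, of "\<bar>s - t\<bar>"] by (simp add: dist_real_def)
    moreover have "(W s - W t) / (s - t) - V t 0 = (W s - W t - (s - t) * V t 0) / (s - t)"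
      using s by (simp add: field_simps)
    ultimately show "dist ((W s - W t) / (s - t)) (V t 0) < e"
      using s by (simp add: dist_real_def abs_divide pos_divide_less_eq mult.commute)
  qed
qed

section \<open>Functions on the surface read in charts\<close>

lemma chart_inv_simps:
  assumes "is_chart c"
  shows "x \<in> cdom c \<Longrightarrow> chart_inv c (snd c x) = x"
    and "y \<in> cimg c \<Longrightarrow> snd c (chart_inv c y) = y"
    and "y \<in> cimg c \<Longrightarrow> chart_inv c y \<in> cdom c"
  using assms unfolding is_chart_def homeomorphism_def by auto

lemma continuous_on_chart:
  assumes "is_chart c"
  shows "continuous_on (cdom c) (snd c)" "continuous_on (cimg c) (chart_inv c)"
  using assms unfolding is_chart_def homeomorphism_def by auto

lemma chart_at:
  assumes "oriented_atlas A"
  shows "chart_at A x \<in> A" "x \<in> cdom (chart_at A x)" "is_chart (chart_at A x)"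
proof -
  have "\<exists>c. c \<in> A \<and> x \<in> cdom c"
    using assms unfolding oriented_atlas_def by blast
  from someI_ex[OF this] show "chart_at A x \<in> A" "x \<in> cdom (chart_at A x)"
    unfolding chart_at_def by auto
  then show "is_chart (chart_at A x)"
    using assms unfolding oriented_atlas_def by blast
qed

lemma continuous_on_times_UNIV_locally:
  fixes F :: "'a::t2_space \<times> 'b::t2_space \<Rightarrow> 'c::topological_space"
  assumes "\<And>x. \<exists>U. open U \<and> x \<in> U \<and> continuous_on (S \<times> U) F"
  shows "continuous_on (S \<times> UNIV) F"
  unfolding continuous_on_eq_continuous_within
proof
  fix z :: "'a \<times> 'b" assume "z \<in> S \<times> UNIV"
  obtain U where U: "open U" "snd z \<in> U" "continuous_on (S \<times> U) F"
    using assms by blast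
  have "at z within S \<times> UNIV = at z within S \<times> U"
    using U by (intro at_within_nhd[of _ "UNIV \<times> U"]) (auto simp: open_Times mem_Times_iff)
  moreover have "z \<in> S \<times> U"
    using U \<open>z \<in> S \<times> UNIV\<close> by (auto simp: mem_Times_iff)
  ultimately show "continuous (at z within S \<times> UNIV) F"
    using U(3) by (metis continuous_on_eq_continuous_within)
qed

lemma continuous_on_atlas:
  fixes F :: "'a::t2_space \<times> 'm::t2_space \<Rightarrow> 'c::topological_space"
  assumes "oriented_atlas A" "\<And>c. c \<in> A \<Longrightarrow> continuous_on (S \<times> cdom c) F"
  shows "continuous_on (S \<times> UNIV) F"
proof (rule continuous_on_times_UNIV_locally)
  fix x
  have "open (cdom (chart_at A x))"
    using chart_at(3)[OF assms(1)] by (simp add: is_chart_def)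
  then show "\<exists>U. open U \<and> x \<in> U \<and> continuous_on (S \<times> U) F"
    using chart_at[OF assms(1)] assms(2) by blast
qed

lemma continuous_on_cdomI:
  assumes "is_chart c" "continuous_on (S \<times> cimg c) F"
  shows "continuous_on (S \<times> cdom c) (\<lambda>(t, x). F (t, snd c x))"
proof -
  have "continuous_on (S \<times> cdom c) (\<lambda>p. (fst p, snd c (snd p)))"
    by (intro continuous_intros continuous_on_compose2[OF continuous_on_chart(1)[OF assms(1)]]) auto
  then have "continuous_on (S \<times> cdom c) (\<lambda>p. F (fst p, snd c (snd p)))"
    by (rule continuous_on_compose2[OF assms(2)]) auto
  then show ?thesis
    by (simp add: case_prod_unfold)
qed

lemma in_chart_continuous_on_cdom:
  assumes "is_chart c" "continuous_on (S \<times> cimg c) (in_chart c u)"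
  shows "continuous_on (S \<times> cdom c) (\<lambda>(t, x). u t x)"
proof -
  have "continuous_on (S \<times> cdom c) (\<lambda>(t, x). in_chart c u (t, snd c x))"
    by (rule continuous_on_cdomI[OF assms])
  then show ?thesis
    by (rule continuous_on_eq) (auto simp: in_chart_def chart_inv_simps[OF assms(1)])
qed

text \<open>The components of the covector du. They do not involve the metric, so a change of metric
  acts on gradients only through the inverse matrix.\<close>

definition differential :: "'m chart \<Rightarrow> ('m \<Rightarrow> real) \<Rightarrow> 'm \<Rightarrow> real^2" where
  "differential c u x = (\<chi> i. pd c i u x)"

lemma
  assumes c: "is_chart c" and u: "Ck_on 1 ({0..<T} \<times> cimg c) (in_chart c u)"
    and t: "t \<in> {0..<T}" and x: "x \<in> cdom c"
  shows in_chart_time_derivative: "((\<lambda>s. u s x) has_vector_derivative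
      frechet_derivative (in_chart c u) (at (t, snd c x) within {0..<T} \<times> cimg c) (1, 0)) (at t within {0..<T})"
    and in_chart_space_derivative: "((u t \<circ> chart_inv c) has_derivative
      (\<lambda>v. frechet_derivative (in_chart c u) (at (t, snd c x) within {0..<T} \<times> cimg c) (0, v))) (at (snd c x))"
proof -
  have V: "open (cimg c)" "snd c x \<in> cimg c"
    using c x by (auto simp: is_chart_def)
  have d: "in_chart c u differentiable (at (t, snd c x) within {0..<T} \<times> cimg c)"
    using u t V(2) by (auto simp: Ck_on_1_iff)
  show "((\<lambda>s. u s x) has_vector_derivative
      frechet_derivative (in_chart c u) (at (t, snd c x) within {0..<T} \<times> cimg c) (1, 0)) (at t within {0..<T})"
    using has_derivative_time_slice[OF d V(2)] by (simp add: in_chart_def chart_inv_simps[OF c] x)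
  show "((u t \<circ> chart_inv c) has_derivative
      (\<lambda>v. frechet_derivative (in_chart c u) (at (t, snd c x) within {0..<T} \<times> cimg c) (0, v))) (at (snd c x))"
    using has_derivative_space_slice[OF d t V] by (simp add: in_chart_def o_def)
qed

lemma in_chart_pd_eq:
  assumes "is_chart c" "Ck_on 1 ({0..<T} \<times> cimg c) (in_chart c u)" "t \<in> {0..<T}" "x \<in> cdom c"
  shows "pd c i (u t) x =
    frechet_derivative (in_chart c u) (at (t, snd c x) within {0..<T} \<times> cimg c) (0, axis i 1)"
  using frechet_derivative_at[OF in_chart_space_derivative[OF assms], symmetric]
  by (simp add: pd_def)

lemma continuous_on_in_chart_pd:
  assumes c: "is_chart c" and u: "Ck_on 1 ({0..<T} \<times> cimg c) (in_chart c u)"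
  shows "continuous_on ({0..<T} \<times> cdom c) (\<lambda>(t, x). pd c i (u t) x)"
proof -
  have "continuous_on ({0..<T} \<times> cimg c)
      (\<lambda>z. frechet_derivative (in_chart c u) (at z within {0..<T} \<times> cimg c) (0, axis i 1))"
    using u by (simp add: Ck_on_1_iff)
  from continuous_on_cdomI[OF c this] show ?thesis
    by (rule continuous_on_eq) (auto simp: in_chart_pd_eq[OF assms])
qed

text \<open>By uniqueness any pointwise time derivative is the joint derivative in direction (1, 0),
  which is continuous. Continuity of the conformal factor and of \<partial>_t \<phi> is obtained in
  this way.\<close>

lemma continuous_on_in_chart_time_derivative:
  assumes c: "is_chart c" and u: "Ck_on 1 ({0..<T} \<times> cimg c) (in_chart c u)"
    and u': "\<And>t x. t \<in> {0..<T} \<Longrightarrow> x \<in> cdom c \<Longrightarrow>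
      ((\<lambda>s. u s x) has_vector_derivative u' t x) (at t within {0..<T})"
  shows "continuous_on ({0..<T} \<times> cdom c) (\<lambda>(t, x). u' t x)"
proof -
  have "continuous_on ({0..<T} \<times> cimg c)
      (\<lambda>z. frechet_derivative (in_chart c u) (at z within {0..<T} \<times> cimg c) (1, 0))"
    using u by (simp add: Ck_on_1_iff)
  from continuous_on_cdomI[OF c this]
  have "continuous_on ({0..<T} \<times> cdom c)
      (\<lambda>(t, x). frechet_derivative (in_chart c u) (at (t, snd c x) within {0..<T} \<times> cimg c) (1, 0))" .
  moreover have "frechet_derivative (in_chart c u) (at (t, snd c x) within {0..<T} \<times> cimg c) (1, 0) = u' t x"
    if "t \<in> {0..<T}" "x \<in> cdom c" for t x
    using in_chart_time_derivative[OF c u that] u'[OF that] at_within_atLeastLessThan_neq_bot[OF that(1)]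
      vector_derivative_unique_within by blast
  ultimately show ?thesis
    by (auto elim: continuous_on_eq)
qed

text \<open>\<partial>_t and \<partial>_i commute although \<open>u\<close> is only C^1: the mixed
  derivative exists and is continuous because \<partial>_t u = \<open>v\<close> is itself
  C^1.\<close>

lemma pd_time_derivative:
  assumes c: "is_chart c" and u: "Ck_on 1 ({0..<T} \<times> cimg c) (in_chart c u)"
    and v: "Ck_on 1 ({0..<T} \<times> cimg c) (in_chart c v)"
    and uv: "\<And>t x. t \<in> {0..<T} \<Longrightarrow> x \<in> cdom c \<Longrightarrow>
      ((\<lambda>s. u s x) has_real_derivative v t x) (at t within {0..<T})"
    and t: "t \<in> {0..<T}" and x: "x \<in> cdom c"
  shows "((\<lambda>s. pd c i (u s) x) has_real_derivative pd c i (v t) x) (at t within {0..<T})"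
proof -
  define y where "y = snd c x"
  define e where "e = (axis i 1 :: real^2)"
  have y: "y \<in> cimg c" "chart_inv c y = x"
    using x chart_inv_simps[OF c] by (auto simp: y_def)
  obtain d where d: "d > 0" "ball y d \<subseteq> cimg c"
    using c y(1) unfolding is_chart_def open_contains_ball by metis
  have yz: "y + z *\<^sub>R e \<in> cimg c" if "\<bar>z\<bar> < d" for z
    using that d(2) by (auto simp: dist_norm e_def)
  have line: "((\<lambda>z. w s (chart_inv c (y + z *\<^sub>R e))) has_real_derivative
      pd c i (w s) (chart_inv c (y + z *\<^sub>R e))) (at z)"
    if w: "Ck_on 1 ({0..<T} \<times> cimg c) (in_chart c w)" and s: "s \<in> {0..<T}" and z: "\<bar>z\<bar> < d" for w s z
  proof -
    have x': "chart_inv c (y + z *\<^sub>R e) \<in> cdom c" "snd c (chart_inv c (y + z *\<^sub>R e)) = y + z *\<^sub>R e"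
      using chart_inv_simps[OF c] yz[OF z] by auto
    show ?thesis
      using has_real_derivative_along_line[OF in_chart_space_derivative[OF c w s x'(1), unfolded x'(2)]]
        in_chart_pd_eq[OF c w s x'(1), of i, unfolded x'(2), folded e_def]
      by simp
  qed
  have "((\<lambda>s. pd c i (u s) x) has_real_derivative pd c i (v t) (chart_inv c (y + 0 *\<^sub>R e))) (at t within {0..<T})"
  proof (rule has_real_derivative_interchange[OF d(1)])
    show "is_interval {0..<T}" by (simp add: is_interval_co)
    show "t \<in> {0..<T}" by fact
    show "((\<lambda>r. u r (chart_inv c (y + z *\<^sub>R e))) has_real_derivative v s (chart_inv c (y + z *\<^sub>R e)))
        (at s within {0..<T})" if "s \<in> {0..<T}" "\<bar>z\<bar> < d" for s z
      using uv that yz chart_inv_simps[OF c] by blast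
    show "((\<lambda>z. u s (chart_inv c (y + z *\<^sub>R e))) has_real_derivative pd c i (u s) x) (at 0)"
      if "s \<in> {0..<T}" for s
      using line[OF u that, of 0] d(1) y by simp
    show "((\<lambda>z. v s (chart_inv c (y + z *\<^sub>R e))) has_real_derivative
        pd c i (v s) (chart_inv c (y + z *\<^sub>R e))) (at z)"
      if "s \<in> {0..<T}" "\<bar>z\<bar> < d" for s z
      by (rule line[OF v that])
    have cont: "continuous_on ({0..<T} \<times> {-d<..<d})
        (\<lambda>(s, z). pd c i (v s) (chart_inv c (y + z *\<^sub>R e)))"
    proof -
      have "continuous_on ({0..<T} \<times> {-d<..<d}) (\<lambda>p. (fst p, chart_inv c (y + snd p *\<^sub>R e)))"
        using yz by (intro continuous_intros continuous_on_compose2[OF continuous_on_chart(2)[OF c]]) auto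
      then have "continuous_on ({0..<T} \<times> {-d<..<d})
          (\<lambda>p. (\<lambda>(t, x). pd c i (v t) x) (fst p, chart_inv c (y + snd p *\<^sub>R e)))"
        by (rule continuous_on_compose2[OF continuous_on_in_chart_pd[OF c v]])
           (use yz chart_inv_simps[OF c] in auto)
      then show ?thesis
        by (simp add: case_prod_unfold)
    qed
    \<comment> \<open>Continuity is known on the strip of width \<open>d\<close> only, which agrees
      with the full cylinder near the point in question.\<close>
    have "at (t, 0) within {0..<T} \<times> {-d<..<d} = at (t, 0::real) within {0..<T} \<times> UNIV"
      using d(1) by (intro at_within_nhd[of _ "UNIV \<times> {-d<..<d}"]) (auto simp: open_Times)
    moreover have "(t, 0) \<in> {0..<T} \<times> {-d<..<d}"
      using t d(1) by auto
    ultimately show "continuous (at (t, 0) within {0..<T} \<times> UNIV)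
        (\<lambda>(s, z). pd c i (v s) (chart_inv c (y + z *\<^sub>R e)))"
      using cont by (metis continuous_on_eq_continuous_within)
  qed
  then show ?thesis
    using y by simp
qed

section \<open>Change of charts and the dual metric\<close>

lemma matrix_inv_mult:
  fixes G :: "'a::semiring_1^'n^'m"
  assumes "invertible G"
  shows "G ** matrix_inv G = mat 1" "matrix_inv G ** G = mat 1"
proof -
  have "G ** matrix_inv G = mat 1 \<and> matrix_inv G ** G = mat 1"
    using assms unfolding invertible_def matrix_inv_def by (rule someI_ex)
  then show "G ** matrix_inv G = mat 1" "matrix_inv G ** G = mat 1"
    by auto
qed

lemma matrix_inv_unique:
  fixes G :: "'a::semiring_1^'n^'m"
  assumes "G ** B = mat 1" "B ** G = mat 1"
  shows "matrix_inv G = B"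
proof -
  have "invertible G"
    using assms by (auto simp: invertible_def)
  then have "matrix_inv G ** (G ** B) = B"
    by (simp add: matrix_mul_assoc matrix_inv_mult)
  then show ?thesis
    using assms by simp
qed

lemma matrix_inv_scaleR:
  fixes G :: "real^'n^'n"
  assumes "invertible G" "a \<noteq> 0"
  shows "matrix_inv (a *\<^sub>R G) = (1 / a) *\<^sub>R matrix_inv G"
  using assms by (intro matrix_inv_unique)
    (auto simp: matrix_scaleR matrix_mul_assoc matrix_scalar_ac scalar_matrix_assoc matrix_inv_mult)

definition posdef :: "real^'n^'n \<Rightarrow> bool" where
  "posdef G \<longleftrightarrow> transpose G = G \<and> (\<forall>v. v \<noteq> 0 \<longrightarrow> v \<bullet> (G *v v) > 0)"

lemma inner_symmetric_matrix:
  fixes G :: "real^'n^'n"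
  assumes "transpose G = G"
  shows "v \<bullet> (G *v w) = w \<bullet> (G *v v)"
  using dot_lmul_matrix[of v G w] transpose_matrix_vector[of G v] assms by (simp add: inner_commute)

lemma posdef_invertible:
  assumes "posdef G"
  shows "invertible G"
proof -
  have "\<forall>v. G *v v = 0 \<longrightarrow> v = 0"
    using assms unfolding posdef_def by (metis inner_zero_right less_irrefl)
  then show ?thesis
    by (simp add: invertible_left_inverse matrix_left_invertible_ker)
qed

lemma posdef_inner_nonneg: "posdef G \<Longrightarrow> v \<bullet> (G *v v) \<ge> 0"
  unfolding posdef_def by (cases "v = 0") (auto intro: less_imp_le)

lemma posdef_Cauchy_Schwarz:
  fixes G :: "real^'n^'n"
  assumes "posdef G"
  shows "(v \<bullet> (G *v w))\<^sup>2 \<le> (v \<bullet> (G *v v)) * (w \<bullet> (G *v w))"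
proof (cases "w = 0")
  case False
  define s where "s = (v \<bullet> (G *v w)) / (w \<bullet> (G *v w))"
  have w: "w \<bullet> (G *v w) > 0"
    using assms False by (auto simp: posdef_def)
  have "0 \<le> (v - s *\<^sub>R w) \<bullet> (G *v (v - s *\<^sub>R w))"
    using assms by (rule posdef_inner_nonneg)
  also have "\<dots> = v \<bullet> (G *v v) - 2 * s * (v \<bullet> (G *v w)) + s * s * (w \<bullet> (G *v w))"
    using inner_symmetric_matrix[of G w v] assms
    by (simp add: matrix_vector_mult_diff_distrib matrix_vector_mult_scaleR inner_diff_left inner_diff_right posdef_def algebra_simps)
  also have "\<dots> = v \<bullet> (G *v v) - (v \<bullet> (G *v w))\<^sup>2 / (w \<bullet> (G *v w))"
    using w by (simp add: s_def power2_eq_square field_simps)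
  finally show ?thesis
    using w by (simp add: field_simps)
qed simp

lemma posdef_matrix_inv:
  fixes G :: "real^'n^'n"
  assumes "posdef G"
  shows "posdef (matrix_inv G)"
proof -
  have inv: "G ** matrix_inv G = mat 1" "matrix_inv G ** G = mat 1"
    using matrix_inv_mult[OF posdef_invertible[OF assms]] .
  have "G ** transpose (matrix_inv G) = mat 1" "transpose (matrix_inv G) ** G = mat 1"
    using arg_cong[OF inv(1), of transpose] arg_cong[OF inv(2), of transpose] assms
    by (simp_all add: matrix_transpose_mul posdef_def)
  then have "transpose (matrix_inv G) = matrix_inv G"
    using matrix_inv_unique by metis
  moreover have "v \<bullet> (matrix_inv G *v v) > 0" if "v \<noteq> 0" for v
  proof -
    have v: "G *v (matrix_inv G *v v) = v"
      by (simp add: matrix_vector_mul_assoc inv)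
    then have "matrix_inv G *v v \<noteq> 0"
      using that by auto
    then have "(matrix_inv G *v v) \<bullet> (G *v (matrix_inv G *v v)) > 0"
      using assms by (simp add: posdef_def)
    then show ?thesis
      by (simp add: v inner_commute)
  qed
  ultimately show ?thesis
    by (simp add: posdef_def)
qed

lemma posdef_2:
  fixes G :: "real^2^2"
  assumes "posdef G"
  shows "G $ 2 $ 1 = G $ 1 $ 2" "G $ 1 $ 1 > 0" "det G > 0"
proof -
  show sym: "G $ 2 $ 1 = G $ 1 $ 2"
    using assms unfolding posdef_def transpose_def by (metis vec_lambda_beta)
  have quad: "v \<bullet> (G *v v) = (v $ 1)\<^sup>2 * G $ 1 $ 1 + 2 * (v $ 1 * v $ 2 * G $ 1 $ 2) + (v $ 2)\<^sup>2 * G $ 2 $ 2" for v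
    by (simp add: inner_vec_def matrix_vector_mult_def sum_2 sym power2_eq_square algebra_simps)
  have "axis 1 1 \<noteq> (0 :: real^2)"
    by (simp add: axis_eq_0_iff)
  then have "axis 1 1 \<bullet> (G *v axis 1 1) > 0"
    using assms by (simp add: posdef_def)
  then show G11: "G $ 1 $ 1 > 0"
    by (simp add: quad axis_def)
  \<comment> \<open>This vector is \<open>G\<close>-orthogonal to the first basis vector, and its
    square length is the product of \<open>G $ 1 $ 1\<close> with the determinant.\<close>
  define v :: "real^2" where "v = vector [- G $ 1 $ 2, G $ 1 $ 1]"
  have "v \<noteq> 0"
    using G11 by (metis v_def vector_2(2) zero_index less_irrefl)
  then have "v \<bullet> (G *v v) > 0"
    using assms by (simp add: posdef_def)
  also have "v \<bullet> (G *v v) = G $ 1 $ 1 * det G"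
    unfolding quad by (simp add: v_def det_2 sym power2_eq_square algebra_simps)
  finally show "det G > 0"
    using G11 by (simp add: zero_less_mult_iff)
qed

lemma matrix_inv_2:
  fixes G :: "real^2^2"
  assumes "det G \<noteq> 0"
  shows "matrix_inv G $ 1 $ 1 = G $ 2 $ 2 / det G" "matrix_inv G $ 1 $ 2 = - G $ 1 $ 2 / det G"
    "matrix_inv G $ 2 $ 1 = - G $ 2 $ 1 / det G" "matrix_inv G $ 2 $ 2 = G $ 1 $ 1 / det G"
proof -
  define B :: "real^2^2" where
    "B = vector [vector [G $ 2 $ 2 / det G, - G $ 1 $ 2 / det G], vector [- G $ 2 $ 1 / det G, G $ 1 $ 1 / det G]]"
  have B: "B $ 1 $ 1 = G $ 2 $ 2 / det G" "B $ 1 $ 2 = - G $ 1 $ 2 / det G"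
    "B $ 2 $ 1 = - G $ 2 $ 1 / det G" "B $ 2 $ 2 = G $ 1 $ 1 / det G"
    by (simp_all add: B_def)
  have d: "det G = G $ 1 $ 1 * G $ 2 $ 2 - G $ 1 $ 2 * G $ 2 $ 1"
    by (rule det_2)
  have "G ** B = mat 1" "B ** G = mat 1"
    using assms by (simp_all add: vec_eq_iff forall_2 matrix_matrix_mult_def sum_2 B mat_def)
      (simp_all add: diff_divide_distrib[symmetric] add_divide_distrib[symmetric] d[symmetric] mult.commute)
  then have "matrix_inv G = B"
    by (rule matrix_inv_unique)
  then show "matrix_inv G $ 1 $ 1 = G $ 2 $ 2 / det G" "matrix_inv G $ 1 $ 2 = - G $ 1 $ 2 / det G"
    "matrix_inv G $ 2 $ 1 = - G $ 2 $ 1 / det G" "matrix_inv G $ 2 $ 2 = G $ 1 $ 1 / det G"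
    by (simp_all add: B)
qed

section \<open>Transformation laws between charts\<close>

lemma riemannian_metric_posdef:
  assumes "riemannian_metric A g" "c \<in> A" "x \<in> cdom c"
  shows "posdef (g c x)"
  using assms unfolding riemannian_metric_def posdef_def by blast

lemma jacobian_has_derivative:
  assumes A: "oriented_atlas A" and c: "c \<in> A" "c' \<in> A" and x: "x \<in> cdom c" "x \<in> cdom c'"
  shows "((snd c' \<circ> chart_inv c) has_derivative ((*v) (jacobian c c' x))) (at (snd c x))"
proof -
  have ch: "is_chart c" "is_chart c'"
    using A c by (auto simp: oriented_atlas_def)
  define V where "V = snd c ` (cdom c \<inter> cdom c')"
  have "V = cimg c \<inter> chart_inv c -` cdom c'"
    using chart_inv_simps[OF ch(1)] by (auto simp: V_def image_iff)
  moreover have "open (cimg c \<inter> chart_inv c -` cdom c')"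
    using ch by (intro continuous_open_preimage continuous_on_chart) (auto simp: is_chart_def)
  ultimately have V: "open V"
    by simp
  have xV: "snd c x \<in> V"
    using x by (auto simp: V_def)
  have "Ck_on 1 V (snd c' \<circ> chart_inv c)"
    using A c unfolding oriented_atlas_def V_def smooth_on_def by blast
  then have "(snd c' \<circ> chart_inv c) differentiable (at (snd c x))"
    using xV at_within_open[OF xV V] by (auto simp: Ck_on_1_iff)
  then have d: "((snd c' \<circ> chart_inv c) has_derivative
      frechet_derivative (snd c' \<circ> chart_inv c) (at (snd c x))) (at (snd c x))"
    by (simp add: frechet_derivative_works)
  moreover have "frechet_derivative (snd c' \<circ> chart_inv c) (at (snd c x)) = (*v) (jacobian c c' x)"
    unfolding jacobian_def using has_derivative_linear[OF d] by (auto simp: matrix_works linear_matrix_vector_mul_eq)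
  ultimately show ?thesis
    by simp
qed

lemma invertible_jacobian:
  assumes "oriented_atlas A" "c \<in> A" "c' \<in> A" "x \<in> cdom c" "x \<in> cdom c'"
  shows "invertible (jacobian c c' x)"
proof -
  have "det (jacobian c c' x) > 0"
    using assms unfolding oriented_atlas_def by blast
  then show ?thesis
    by (simp add: invertible_det_nz)
qed

lemma C1_fun_differentiable:
  assumes A: "oriented_atlas A" and u: "C1_fun A u" and c: "c \<in> A" "x \<in> cdom c"
  shows "((u \<circ> chart_inv c) has_derivative (\<lambda>v. differential c u x \<bullet> v)) (at (snd c x))"
proof -
  have ch: "open (cimg c)" "snd c x \<in> cimg c"
    using A c by (auto simp: oriented_atlas_def is_chart_def)
  define D where "D = frechet_derivative (u \<circ> chart_inv c) (at (snd c x))"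
  have "(u \<circ> chart_inv c) differentiable (at (snd c x))"
    using u c ch(2) unfolding C1_fun_def Ck_on_1_iff at_within_open[OF ch(2,1), symmetric] by blast
  then have d: "((u \<circ> chart_inv c) has_derivative D) (at (snd c x))"
    by (simp add: D_def frechet_derivative_works)
  have lin: "linear D"
    using has_derivative_linear[OF d] .
  have "D v = differential c u x \<bullet> v" for v
  proof -
    have "D v = D (\<Sum>i\<in>UNIV. v $ i *\<^sub>R axis i 1)"
      by (metis basis_expansion scalar_mult_eq_scaleR)
    also have "\<dots> = (\<Sum>i\<in>UNIV. v $ i * D (axis i 1))"
      by (simp add: linear_sum[OF lin] linear_cmul[OF lin])
    also have "\<dots> = differential c u x \<bullet> v"
      by (simp add: inner_vec_def differential_def pd_def D_def mult.commute)
    finally show ?thesis .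
  qed
  then have "D = (\<lambda>v. differential c u x \<bullet> v)"
    by auto
  with d show ?thesis
    by simp
qed

lemma differential_change_chart:
  assumes A: "oriented_atlas A" and u: "C1_fun A u"
    and c: "c \<in> A" "c' \<in> A" and x: "x \<in> cdom c" "x \<in> cdom c'"
  shows "differential c u x = transpose (jacobian c c' x) *v differential c' u x"
proof -
  define J where "J = jacobian c c' x"
  have ch: "is_chart c" "is_chart c'"
    using A c by (auto simp: oriented_atlas_def)
  have xx: "(snd c' \<circ> chart_inv c) (snd c x) = snd c' x"
    using chart_inv_simps[OF ch(1)] x by simp
  have d: "((u \<circ> chart_inv c' \<circ> (snd c' \<circ> chart_inv c)) has_derivative (\<lambda>v. differential c' u x \<bullet> (J *v v))) (at (snd c x))"
    using diff_chain_at[OF jacobian_has_derivative[OF A c x], of "u \<circ> chart_inv c'" "\<lambda>v. differential c' u x \<bullet> v"]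
      C1_fun_differentiable[OF A u c(2) x(2)]
    by (simp add: xx[unfolded o_def] o_def J_def)
  \<comment> \<open>The composition agrees with \<open>u\<close> read in \<open>c\<close> only over
    the overlap of the two charts, which is open around the point.\<close>
  have V: "open (cimg c \<inter> chart_inv c -` cdom c')"
    using ch by (intro continuous_open_preimage continuous_on_chart) (auto simp: is_chart_def)
  have "((u \<circ> chart_inv c) has_derivative (\<lambda>v. differential c' u x \<bullet> (J *v v))) (at (snd c x))"
    by (rule has_derivative_transform_within_open[OF d V])
       (use x chart_inv_simps[OF ch(1)] chart_inv_simps[OF ch(2)] in auto)
  with C1_fun_differentiable[OF A u c(1) x(1)]
  have "(\<lambda>v. differential c u x \<bullet> v) = (\<lambda>v. differential c' u x \<bullet> (J *v v))"
    by (rule has_derivative_unique)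
  then have "differential c u x \<bullet> v = (transpose J *v differential c' u x) \<bullet> v" for v
    by (simp add: dot_lmul_matrix fun_eq_iff)
  then show ?thesis
    by (metis J_def vector_eq_rdot)
qed

lemma grad_altdef: "grad g u c x = matrix_inv (g c x) *v differential c u x"
  by (simp add: grad_def differential_def)

lemma metric_grad:
  assumes "posdef (g c x)"
  shows "g c x *v grad g u c x = differential c u x"
  using matrix_inv_mult[OF posdef_invertible[OF assms]]
  by (simp add: grad_altdef matrix_vector_mul_assoc)

text \<open>Metric and differential both transform with the transposed Jacobian on the left.
  Cancelling this invertible factor leaves the defining equation of the gradient in the second
  chart.\<close>

lemma grad_change_chart:
  assumes A: "oriented_atlas A" and g: "riemannian_metric A g" and u: "C1_fun A u"
    and c: "c \<in> A" "c' \<in> A" and x: "x \<in> cdom c" "x \<in> cdom c'"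
  shows "grad g u c' x = jacobian c c' x *v grad g u c x"
proof -
  define J where "J = jacobian c c' x"
  have pos: "posdef (g c x)" "posdef (g c' x)"
    using riemannian_metric_posdef[OF g] c x by auto
  have gc: "g c x = transpose J ** g c' x ** J"
    using g c x unfolding riemannian_metric_def J_def by blast
  have "invertible (transpose J)"
    using invertible_jacobian[OF A c x] by (simp add: transpose_invertible J_def)
  then have inj: "w = w'" if "transpose J *v w = transpose J *v w'" for w w'
    using that by (metis matrix_inv_mult(2) matrix_vector_mul_assoc matrix_vector_mul_lid)
  have "transpose J *v (g c' x *v (J *v grad g u c x)) = g c x *v grad g u c x"
    unfolding gc by (simp only: matrix_vector_mul_assoc matrix_mul_assoc)
  also have "\<dots> = transpose J *v differential c' u x"
    using metric_grad[of g c x, OF pos(1)] differential_change_chart[OF A u c x] by (simp add: J_def)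
  finally have "g c' x *v (J *v grad g u c x) = differential c' u x"
    by (rule inj)
  then show ?thesis
    unfolding grad_altdef[of g u c'] J_def[symmetric]
    using matrix_inv_mult[OF posdef_invertible[OF pos(2)]]
    by (metis matrix_vector_mul_assoc matrix_vector_mul_lid)
qed

lemma vector_field_grad:
  assumes "oriented_atlas A" "riemannian_metric A g" "C1_fun A u"
  shows "vector_field A (grad g u)"
  using grad_change_chart[OF assms] unfolding vector_field_def by blast

lemma vector_field_inner_change_chart:
  assumes A: "oriented_atlas A" and X: "vector_field A X" and u: "C1_fun A u"
    and c: "c \<in> A" "c' \<in> A" and x: "x \<in> cdom c" "x \<in> cdom c'"
  shows "X c x \<bullet> differential c u x = X c' x \<bullet> differential c' u x"
proof -
  have "X c' x = jacobian c c' x *v X c x"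
    using X c x unfolding vector_field_def by blast
  then show ?thesis
    using differential_change_chart[OF A u c x] dot_lmul_matrix
    by (metis inner_commute transpose_matrix_vector)
qed

text \<open>The inner product of \<nabla>u and \<nabla>v, written as a pairing of a vector with a
  covector. The chart is kept as an argument so that the coordinate formula can be differentiated;
  independence of the chart is proved separately.\<close>

definition cometric :: "'m tensor2 \<Rightarrow> ('m \<Rightarrow> real) \<Rightarrow> ('m \<Rightarrow> real) \<Rightarrow> 'm chart \<Rightarrow> 'm \<Rightarrow> real" where
  "cometric g u v c x = grad g u c x \<bullet> differential c v x"

lemma cometric_change_chart:
  assumes "oriented_atlas A" "riemannian_metric A g" "C1_fun A u" "C1_fun A v"
    "c \<in> A" "c' \<in> A" "x \<in> cdom c" "x \<in> cdom c'"
  shows "cometric g u v c x = cometric g u v c' x"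
  unfolding cometric_def
  using vector_field_inner_change_chart[OF assms(1) vector_field_grad[OF assms(1-3)] assms(4-8)] .

lemma
  assumes "posdef (g c x)"
  shows cometric_nonneg: "cometric g u u c x \<ge> 0"
    and cometric_Cauchy_Schwarz: "(cometric g u v c x)\<^sup>2 \<le> cometric g u u c x * cometric g v v c x"
proof -
  have *: "cometric g u v c x = differential c u x \<bullet> (matrix_inv (g c x) *v differential c v x)" for u v
    using posdef_matrix_inv[OF assms] inner_symmetric_matrix
    unfolding cometric_def grad_altdef posdef_def by (metis inner_commute)
  show "cometric g u u c x \<ge> 0"
    using posdef_inner_nonneg[OF posdef_matrix_inv[OF assms]] by (simp add: *)
  show "(cometric g u v c x)\<^sup>2 \<le> cometric g u u c x * cometric g v v c x"
    unfolding * by (rule posdef_Cauchy_Schwarz[OF posdef_matrix_inv[OF assms]])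
qed

lemma vnorm_grad:
  assumes A: "oriented_atlas A" and g: "riemannian_metric A g" and u: "C1_fun A u" and c: "c \<in> A" "x \<in> cdom c"
  shows "vnorm A g (grad g u) x = sqrt (cometric g u u c x)"
proof -
  have "vnorm A g (grad g u) x = sqrt (cometric g u u (chart_at A x) x)"
    using metric_grad[of g "chart_at A x" x, OF riemannian_metric_posdef[OF g chart_at(1,2)[OF A]]]
    by (simp add: vnorm_def cometric_def Let_def)
  then show ?thesis
    using cometric_change_chart[OF A g u u chart_at(1)[OF A, of x] c(1) chart_at(2)[OF A] c(2)] by simp
qed

text \<open>Only the inverse matrix sees the scaling, as differentials are independent of the
  metric. Raised to the power p/2 this is the factor a^(-p/2) in the energy.\<close>

lemma cometric_scaleR:
  assumes "posdef (g c x)" "a \<noteq> 0" "g' c x = a *\<^sub>R g c x"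
  shows "cometric g' u v c x = cometric g u v c x / a"
  using assms by (simp add: cometric_def grad_altdef matrix_inv_scaleR[OF posdef_invertible] scaleR_matrix_vector_assoc[symmetric])

section \<open>The Ricci tensor of a surface\<close>

lemma Ck_on_cong:
  assumes "\<And>x. x \<in> S \<Longrightarrow> f x = g x"
  shows "Ck_on k S f \<longleftrightarrow> Ck_on k S g"
  using assms
proof (induction k arbitrary: f g)
  case 0
  then show ?case
    by (simp cong: continuous_on_cong)
next
  case (Suc k)
  have hd: "(f has_derivative D) (at x within S) \<longleftrightarrow> (g has_derivative D) (at x within S)" if "x \<in> S" for x D
    using has_derivative_transform[OF that, of f g] has_derivative_transform[OF that, of g f] Suc.prems by auto
  have fd: "frechet_derivative f (at x within S) = frechet_derivative g (at x within S)" if "x \<in> S" for x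
    unfolding frechet_derivative_def hd[OF that] ..
  have "f differentiable (at x within S) \<longleftrightarrow> g differentiable (at x within S)" if "x \<in> S" for x
    unfolding differentiable_def hd[OF that] ..
  moreover have "Ck_on k S (\<lambda>x. frechet_derivative f (at x within S) v) \<longleftrightarrow>
      Ck_on k S (\<lambda>x. frechet_derivative g (at x within S) v)" for v
    by (rule Suc.IH) (simp add: fd)
  ultimately show ?case
    by simp
qed

lemma Ck_on_bounded_linear:
  assumes L: "bounded_linear L" and S: "open S" and f: "Ck_on k S f"
  shows "Ck_on k S (\<lambda>x. L (f x))"
  using f
proof (induction k arbitrary: f)
  case 0
  then show ?case
    using bounded_linear.continuous_on[OF L] by simp
next
  case (Suc k)
  have d: "((\<lambda>x. L (f x)) has_derivative (\<lambda>v. L (frechet_derivative f (at x within S) v))) (at x within S)" if "x \<in> S" for x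
    using Suc.prems that by (intro bounded_linear.has_derivative[OF L]) (simp add: frechet_derivative_works)
  then have "frechet_derivative (\<lambda>x. L (f x)) (at x within S) = (\<lambda>v. L (frechet_derivative f (at x within S) v))"
    if "x \<in> S" for x
    using that at_within_open[OF that S] frechet_derivative_at by metis
  moreover have "Ck_on k S (\<lambda>x. L (frechet_derivative f (at x within S) v))" for v
    using Suc.prems by (intro Suc.IH) simp
  ultimately have "Ck_on k S (\<lambda>x. frechet_derivative (\<lambda>x. L (f x)) (at x within S) v)" for v
    by (subst Ck_on_cong[where g = "\<lambda>x. L (frechet_derivative f (at x within S) v)"]) auto
  then show ?case
    using d by (auto simp: differentiable_def)
qed

lemma Ck_on_2_differentiable:
  assumes "open V" "Ck_on 2 V k" "y \<in> V"
  shows "k differentiable (at y)" "(\<lambda>y. frechet_derivative k (at y) v) differentiable (at y)"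
    "continuous_on V (\<lambda>y. frechet_derivative (\<lambda>y. frechet_derivative k (at y) v) (at y) w)"
proof -
  have k: "(\<forall>x\<in>V. k differentiable (at x within V)) \<and>
      (\<forall>v. Ck_on (Suc 0) V (\<lambda>x. frechet_derivative k (at x within V) v))"
    using assms(2) unfolding numeral_2_eq_2 Ck_on.simps(2)[of "Suc 0"] .
  show "k differentiable (at y)"
    using bspec[OF conjunct1[OF k] assms(3)] unfolding at_within_open[OF assms(3,1)] .
  have "Ck_on 1 V (\<lambda>x. frechet_derivative k (at x) v)"
    using spec[OF conjunct2[OF k], folded One_nat_def]
    by (rule Ck_on_cong[THEN iffD1, rotated]) (simp add: frechet_derivative_within_open[OF assms(1)])
  then have d: "(\<forall>x\<in>V. (\<lambda>y. frechet_derivative k (at y) v) differentiable (at x within V)) \<and>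
    (\<forall>w. continuous_on V (\<lambda>x. frechet_derivative (\<lambda>y. frechet_derivative k (at y) v) (at x within V) w))"
    unfolding Ck_on_1_iff .
  show "(\<lambda>y. frechet_derivative k (at y) v) differentiable (at y)"
    using bspec[OF conjunct1[OF d] assms(3)] unfolding at_within_open[OF assms(3,1)] .
  show "continuous_on V (\<lambda>y. frechet_derivative (\<lambda>y. frechet_derivative k (at y) v) (at y) w)"
    using spec[OF conjunct2[OF d]]
    by (rule continuous_on_eq) (simp add: frechet_derivative_within_open[OF assms(1)])
qed

text \<open>An instance of the interchange lemma: the parameter along \<open>v\<close> plays the
  role of time, the parameter along \<open>w\<close> that of space, and uniqueness of derivatives
  identifies the two mixed derivatives.\<close>

lemma symmetric_second_derivative_C2:
  fixes k :: "'a::real_normed_vector \<Rightarrow> real"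
  assumes V: "open V" and k: "Ck_on 2 V k" and y: "y \<in> V"
  shows "frechet_derivative (\<lambda>y. frechet_derivative k (at y) v) (at y) w =
    frechet_derivative (\<lambda>y. frechet_derivative k (at y) w) (at y) v"
proof -
  have line: "((\<lambda>z. q (a + z *\<^sub>R e)) has_real_derivative frechet_derivative q (at (a + z *\<^sub>R e)) e) (at z)"
    if "q differentiable (at (a + z *\<^sub>R e))" for q :: "'a \<Rightarrow> real" and a e z
    using that unfolding frechet_derivative_works by (rule has_real_derivative_along_line)
  define P where "P p = y + fst p *\<^sub>R v + snd p *\<^sub>R w" for p :: "real \<times> real"
  have Pc: "continuous_on UNIV P"
    unfolding P_def by (intro continuous_intros)
  have "open (P -` V)"
    using open_vimage[OF V Pc] .
  moreover have "(0, 0) \<in> P -` V"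
    using y by (simp add: P_def)
  ultimately obtain U U' where U: "open U" "open U'" "(0, 0) \<in> U \<times> U'" "U \<times> U' \<subseteq> P -` V"
    by (rule open_prod_elim)
  then obtain d1 d2 where d1: "d1 > 0" "ball 0 d1 \<subseteq> U" and d2: "d2 > 0" "ball 0 d2 \<subseteq> U'"
    unfolding open_contains_ball by (metis mem_Sigma_iff)
  define d where "d = min d1 d2"
  have d: "d > 0"
    using d1 d2 by (simp add: d_def)
  have inV: "y + s *\<^sub>R v + z *\<^sub>R w \<in> V" if "\<bar>s\<bar> < d" "\<bar>z\<bar> < d" for s z
  proof -
    have "s \<in> ball 0 d1" "z \<in> ball 0 d2"
      using that by (auto simp: d_def)
    then have "(s, z) \<in> U \<times> U'"
      using d1 d2 by auto
    then show ?thesis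
      using U(4) by (auto simp: P_def)
  qed
  let ?D = "\<lambda>e y. frechet_derivative k (at y) e"
  have "((\<lambda>s. ?D w (y + s *\<^sub>R v)) has_real_derivative
      frechet_derivative (?D v) (at (y + 0 *\<^sub>R v + 0 *\<^sub>R w)) w) (at 0 within {-d<..<d})"
  proof (rule has_real_derivative_interchange[OF d, where u = "\<lambda>s z. k (y + s *\<^sub>R v + z *\<^sub>R w)"
        and v = "\<lambda>s z. ?D v (y + s *\<^sub>R v + z *\<^sub>R w)"
        and V = "\<lambda>s z. frechet_derivative (?D v) (at (y + s *\<^sub>R v + z *\<^sub>R w)) w"])
    show "is_interval {-d<..<d}" "0 \<in> {-d<..<d}"
      using d by (auto simp: is_interval_oo)
    show "((\<lambda>r. k (y + r *\<^sub>R v + z *\<^sub>R w)) has_real_derivative ?D v (y + s *\<^sub>R v + z *\<^sub>R w)) (at s within {-d<..<d})"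
      if "s \<in> {-d<..<d}" "\<bar>z\<bar> < d" for s z
    proof -
      have "y + s *\<^sub>R v + z *\<^sub>R w \<in> V"
        using that by (intro inV) auto
      then have "k differentiable (at ((y + z *\<^sub>R w) + s *\<^sub>R v))"
        using Ck_on_2_differentiable(1)[OF V k] by (simp add: add.assoc add.commute[of "z *\<^sub>R w"])
      have eq: "y + z *\<^sub>R w + r *\<^sub>R v = y + r *\<^sub>R v + z *\<^sub>R w" for r
        by simp
      show ?thesis
        using line[OF \<open>k differentiable (at ((y + z *\<^sub>R w) + s *\<^sub>R v))\<close>, unfolded eq]
        by (rule has_field_derivative_at_within)
    qed
    show "((\<lambda>z. k (y + s *\<^sub>R v + z *\<^sub>R w)) has_real_derivative ?D w (y + s *\<^sub>R v)) (at 0)"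
      if "s \<in> {-d<..<d}" for s
      using line[of k "y + s *\<^sub>R v" 0 w] inV[of s 0] that d Ck_on_2_differentiable(1)[OF V k] by auto
    show "((\<lambda>z. ?D v (y + s *\<^sub>R v + z *\<^sub>R w)) has_real_derivative
        frechet_derivative (?D v) (at (y + s *\<^sub>R v + z *\<^sub>R w)) w) (at z)"
      if "s \<in> {-d<..<d}" "\<bar>z\<bar> < d" for s z
      using line[of "?D v" "y + s *\<^sub>R v" z w] inV[of s z] that Ck_on_2_differentiable(2)[OF V k] by auto
    have "continuous_on (P -` V) (\<lambda>p. frechet_derivative (?D v) (at (P p)) w)"
      by (rule continuous_on_compose2[OF Ck_on_2_differentiable(3)[OF V k y]])
         (auto intro: continuous_on_subset[OF Pc])
    then have "continuous (at (0, 0)) (\<lambda>p. frechet_derivative (?D v) (at (P p)) w)"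
      using \<open>open (P -` V)\<close> \<open>(0, 0) \<in> P -` V\<close> by (simp add: continuous_on_eq_continuous_at)
    then show "continuous (at (0, 0) within {-d<..<d} \<times> UNIV)
        (\<lambda>(s, z). frechet_derivative (?D v) (at (y + s *\<^sub>R v + z *\<^sub>R w)) w)"
      by (simp add: P_def case_prod_unfold continuous_at_imp_continuous_within)
  qed
  then have "((\<lambda>s. ?D w (y + s *\<^sub>R v)) has_real_derivative frechet_derivative (?D v) (at y) w) (at 0)"
    using d at_within_open[of 0 "{-d<..<d}"] by simp
  moreover have "((\<lambda>s. ?D w (y + s *\<^sub>R v)) has_real_derivative frechet_derivative (?D w) (at y) v) (at 0)"
    using line[of "?D w" y 0 v] Ck_on_2_differentiable(2)[OF V k y] by simp
  ultimately show ?thesis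
    by (rule DERIV_unique)
qed

section \<open>Calculus of coordinate derivatives\<close>

abbreviation pd_ok :: "'m chart \<Rightarrow> ('m \<Rightarrow> real) \<Rightarrow> 'm \<Rightarrow> bool" where
  "pd_ok c u x \<equiv> (u \<circ> chart_inv c) differentiable (at (snd c x))"

lemma pd_eqI:
  assumes "((u \<circ> chart_inv c) has_derivative D) (at (snd c x))"
  shows "pd c i u x = D (axis i 1)"
  unfolding pd_def frechet_derivative_at[OF assms, symmetric] ..

lemma pd_okE:
  assumes "pd_ok c u x"
  obtains D where "((u \<circ> chart_inv c) has_derivative D) (at (snd c x))" "\<And>i. pd c i u x = D (axis i 1)"
  using assms pd_eqI unfolding differentiable_def by metis

lemma pd_const: "pd c i (\<lambda>y. a) x = 0"
  by (rule pd_eqI[where D = "\<lambda>_. 0", simplified]) (simp add: o_def)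

text \<open>Undifferentiated factors are evaluated at \<open>chart_inv c (snd c x)\<close> because
  \<open>x\<close> is not assumed to lie in the chart domain; on the domain this point is
  \<open>x\<close>.\<close>

lemma
  assumes "pd_ok c u x" "pd_ok c v x"
  shows pd_ok_add: "pd_ok c (\<lambda>y. u y + v y) x"
    and pd_add: "pd c i (\<lambda>y. u y + v y) x = pd c i u x + pd c i v x"
    and pd_ok_diff: "pd_ok c (\<lambda>y. u y - v y) x"
    and pd_diff: "pd c i (\<lambda>y. u y - v y) x = pd c i u x - pd c i v x"
    and pd_ok_mult: "pd_ok c (\<lambda>y. u y * v y) x"
    and pd_mult: "pd c i (\<lambda>y. u y * v y) x = pd c i u x * v (chart_inv c (snd c x)) + u (chart_inv c (snd c x)) * pd c i v x"
proof -
  obtain D where D: "((u \<circ> chart_inv c) has_derivative D) (at (snd c x))" "\<And>i. pd c i u x = D (axis i 1)"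
    using pd_okE[OF assms(1)] by metis
  obtain E where E: "((v \<circ> chart_inv c) has_derivative E) (at (snd c x))" "\<And>i. pd c i v x = E (axis i 1)"
    using pd_okE[OF assms(2)] by metis
  have add: "(((\<lambda>y. u y + v y) \<circ> chart_inv c) has_derivative (\<lambda>h. D h + E h)) (at (snd c x))"
    using has_derivative_add[OF D(1) E(1)] by (simp add: o_def)
  have diff: "(((\<lambda>y. u y - v y) \<circ> chart_inv c) has_derivative (\<lambda>h. D h - E h)) (at (snd c x))"
    using has_derivative_diff[OF D(1) E(1)] by (simp add: o_def)
  have mult: "(((\<lambda>y. u y * v y) \<circ> chart_inv c) has_derivative
      (\<lambda>h. u (chart_inv c (snd c x)) * E h + D h * v (chart_inv c (snd c x)))) (at (snd c x))"
    using has_derivative_mult[OF D(1) E(1)] by (simp add: o_def)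
  show "pd_ok c (\<lambda>y. u y + v y) x" "pd_ok c (\<lambda>y. u y - v y) x" "pd_ok c (\<lambda>y. u y * v y) x"
    using add diff mult by (auto simp: differentiable_def)
  show "pd c i (\<lambda>y. u y + v y) x = pd c i u x + pd c i v x"
    "pd c i (\<lambda>y. u y - v y) x = pd c i u x - pd c i v x"
    "pd c i (\<lambda>y. u y * v y) x = pd c i u x * v (chart_inv c (snd c x)) + u (chart_inv c (snd c x)) * pd c i v x"
    using pd_eqI[OF add, of i] pd_eqI[OF diff, of i] pd_eqI[OF mult, of i] by (simp_all add: D(2) E(2))
qed

lemma pd_ok_const: "pd_ok c (\<lambda>y. a) x"
  by (simp add: o_def)

lemma pd_ok_divide:
  assumes "pd_ok c u x" "pd_ok c v x" "v (chart_inv c (snd c x)) \<noteq> 0"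
  shows "pd_ok c (\<lambda>y. u y / v y) x"
  using differentiable_divide[of "u \<circ> chart_inv c" "snd c x" UNIV "v \<circ> chart_inv c"] assms by (simp add: o_def)

lemma
  assumes c: "is_chart c" and x: "x \<in> cdom c" and eq: "\<And>y. y \<in> cdom c \<Longrightarrow> u y = v y"
  shows pd_cong: "pd c i u x = pd c i v x" and pd_ok_cong: "pd_ok c u x \<longleftrightarrow> pd_ok c v x"
proof -
  have V: "open (cimg c)" "snd c x \<in> cimg c"
    using c x by (auto simp: is_chart_def)
  have "((u \<circ> chart_inv c) has_derivative D) (at (snd c x)) \<longleftrightarrow>
      ((v \<circ> chart_inv c) has_derivative D) (at (snd c x))" for D
    using has_derivative_transform_within_open[OF _ V, of "u \<circ> chart_inv c" D UNIV "v \<circ> chart_inv c"]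
      has_derivative_transform_within_open[OF _ V, of "v \<circ> chart_inv c" D UNIV "u \<circ> chart_inv c"]
      eq chart_inv_simps(3)[OF c] by auto
  then show "pd c i u x = pd c i v x" "pd_ok c u x \<longleftrightarrow> pd_ok c v x"
    by (simp_all add: pd_def frechet_derivative_def differentiable_def)
qed

lemma
  assumes c: "is_chart c" and u: "Ck_on 2 (cimg c) (u \<circ> chart_inv c)" and x: "x \<in> cdom c"
  shows pd_ok_C2: "pd_ok c u x" and pd_ok_pd: "pd_ok c (pd c i u) x"
    and pd_commute: "pd c i (pd c j u) x = pd c j (pd c i u) x"
proof -
  have V: "open (cimg c)" "snd c x \<in> cimg c"
    using c x by (auto simp: is_chart_def)
  let ?k = "u \<circ> chart_inv c"
  show "pd_ok c u x"
    using Ck_on_2_differentiable(1)[OF V(1) u V(2)] .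
  have eq: "(pd c i u \<circ> chart_inv c) y = frechet_derivative ?k (at y) (axis i 1)" if "y \<in> cimg c" for y i
    using that chart_inv_simps(2)[OF c] by (simp add: pd_def)
  have d: "((pd c i u \<circ> chart_inv c) has_derivative
      frechet_derivative (\<lambda>y. frechet_derivative ?k (at y) (axis i 1)) (at (snd c x))) (at (snd c x))" for i
  proof (rule has_derivative_transform_within_open[OF _ V])
    show "((\<lambda>y. frechet_derivative ?k (at y) (axis i 1)) has_derivative
      frechet_derivative (\<lambda>y. frechet_derivative ?k (at y) (axis i 1)) (at (snd c x))) (at (snd c x))"
      using Ck_on_2_differentiable(2)[OF V(1) u V(2)] by (simp add: frechet_derivative_works)
  qed (rule eq[symmetric])
  then show "pd_ok c (pd c i u) x"
    by (auto simp: differentiable_def)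
  show "pd c i (pd c j u) x = pd c j (pd c i u) x"
    unfolding pd_eqI[OF d] by (rule symmetric_second_derivative_C2[OF V(1) u V(2)])
qed

text \<open>Here \<open>E, F, H\<close> are the entries of \<open>g\<close> and \<open>r\<close> those of \<open>R(\<partial>\<^sub>1,\<partial>\<^sub>2)\<close>.  Lowering an index makes \<open>r\<close> skew, so in
  dimension two it is a multiple of the area form, and its contraction \<open>Ric\<close> is a multiple of \<open>g\<close>.\<close>

lemma skew_trace_form:
  fixes E F H r11 r12 r21 r22 :: real
  assumes D: "E * H - F * F \<noteq> 0"
    and skew: "E * r11 + F * r21 = 0" "F * r12 + H * r22 = 0" "E * r12 + F * r22 + (F * r11 + H * r21) = 0"
  defines "S \<equiv> (H * (- r21) - F * (- r22) - F * r11 + E * r12) / (E * H - F * F)"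
  shows "- r21 = S / 2 * E" "- r22 = S / 2 * F" "r11 = S / 2 * F" "r12 = S / 2 * H"
proof -
  define d where "d = E * H - F * F"
  \<comment> \<open>The single independent entry of the skew matrix obtained by lowering the index.
    The linear equations for \<open>r\<close> are then solved after multiplication by the
    determinant.\<close>
  define s where "s = E * r12 + F * r22"
  have r: "d * r11 = F * s" "d * r21 = - E * s" "d * r12 = H * s" "d * r22 = - F * s"
    using skew unfolding d_def s_def by algebra+
  have "S * d = H * (- r21) - F * (- r22) - F * r11 + E * r12"
    using D by (simp add: S_def d_def)
  then have "S * d * d = (H * (- r21) - F * (- r22) - F * r11 + E * r12) * d"
    by (simp only:)
  also have "\<dots> = H * (- (d * r21)) - F * (- (d * r22)) - F * (d * r11) + E * (d * r12)"
    by (simp add: algebra_simps)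
  also have "\<dots> = 2 * s * d"
    unfolding r by (simp add: d_def algebra_simps)
  finally have s: "s = S / 2 * d"
    using D by (simp add: d_def)
  have eq_scaled: "X = S / 2 * Y" if "d * X = Y * s" for X Y
    using that D unfolding s d_def[symmetric] by (simp add: field_simps)
  show "- r21 = S / 2 * E" "- r22 = S / 2 * F" "r11 = S / 2 * F" "r12 = S / 2 * H"
    using eq_scaled[of "- r21" E] eq_scaled[of "- r22" F] eq_scaled[of r11 F] eq_scaled[of r12 H] r by simp_all
qed

text \<open>The essential curvature input is that R(\<partial>_1, \<partial>_2) becomes skew after
  lowering an index, which follows from compatibility of the Christoffel symbols with the metric and
  from commuting second derivatives of the metric.\<close>

theorem ricci_surface:
  assumes c: "is_chart c" and smooth: "smooth_on (cimg c) (g c \<circ> chart_inv c)"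
    and pos: "\<And>x. x \<in> cdom c \<Longrightarrow> posdef (g c x)" and x: "x \<in> cdom c"
  shows "ricci g c x =
    ((\<Sum>j\<in>UNIV. \<Sum>k\<in>UNIV. matrix_inv (g c x) $ j $ k * ricci g c x $ j $ k) / 2) *\<^sub>R g c x"
proof -
  define G where "G j l y = g c y $ j $ l" for j l y
  define \<Gamma> where "\<Gamma> = christoffel g c"
  have xx: "chart_inv c (snd c y) = y" if "y \<in> cdom c" for y
    using chart_inv_simps[OF c] that by simp
  have C2: "Ck_on 2 (cimg c) (G j l \<circ> chart_inv c)" for j l
  proof -
    have "bounded_linear (\<lambda>M::real^2^2. M $ j $ l)"
      by (intro bounded_linear_compose[OF bounded_linear_vec_nth] bounded_linear_vec_nth)
    moreover have "open (cimg c)" "Ck_on 2 (cimg c) (g c \<circ> chart_inv c)"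
      using c smooth by (auto simp: is_chart_def smooth_on_def)
    ultimately show ?thesis
      using Ck_on_bounded_linear by (fastforce simp: G_def o_def)
  qed
  note ok1 = pd_ok_C2[OF c C2] and ok2 = pd_ok_pd[OF c C2] and comm = pd_commute[OF c C2]
  have Gsym: "G j l y = G l j y" if "y \<in> cdom c" for j l y
    using posdef_2(1)[OF pos[OF that]] exhaust_2[of j] exhaust_2[of l] by (auto simp: G_def)
  have dsym: "pd c i (G j l) y = pd c i (G l j) y" if "y \<in> cdom c" for i j l y
    by (rule pd_cong[OF c that Gsym])
  \<comment> \<open>The curvature differentiates the Christoffel symbols and hence the inverse
    metric, whose entries are entries of \<open>g\<close> up to sign divided by the
    determinant.\<close>
  have inv_ok: "pd_ok c (\<lambda>y. matrix_inv (g c y) $ j $ l) y" if y: "y \<in> cdom c" for j l y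
  proof -
    have det: "det (g c z) = G 1 1 z * G 2 2 z - G 1 2 z * G 2 1 z" for z
      by (simp add: det_2 G_def)
    have det_pos: "det (g c z) > 0" if "z \<in> cdom c" for z
      using posdef_2(3)[OF pos[OF that]] .
    have det_ok: "pd_ok c (\<lambda>z. det (g c z)) y"
      unfolding det by (intro pd_ok_diff pd_ok_mult ok1 y)
    have quot: "pd_ok c (\<lambda>z. a * G p q z / det (g c z)) y" for a p q
      using det_pos[OF y] by (intro pd_ok_divide pd_ok_mult pd_ok_const ok1 det_ok y) (simp add: xx y)
    have "\<exists>a p q. \<forall>z\<in>cdom c. matrix_inv (g c z) $ j $ l = a * G p q z / det (g c z)"
    proof -
      have "\<forall>z\<in>cdom c. det (g c z) \<noteq> 0"
        using det_pos by force
      then have m: "\<forall>z\<in>cdom c. matrix_inv (g c z) $ 1 $ 1 = 1 * G 2 2 z / det (g c z)"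
        "\<forall>z\<in>cdom c. matrix_inv (g c z) $ 1 $ 2 = (-1) * G 1 2 z / det (g c z)"
        "\<forall>z\<in>cdom c. matrix_inv (g c z) $ 2 $ 1 = (-1) * G 2 1 z / det (g c z)"
        "\<forall>z\<in>cdom c. matrix_inv (g c z) $ 2 $ 2 = 1 * G 1 1 z / det (g c z)"
        by (simp_all add: matrix_inv_2 G_def)
      show ?thesis
        using exhaust_2[of j] exhaust_2[of l] m by blast
    qed
    then obtain a p q where eq: "\<And>z. z \<in> cdom c \<Longrightarrow> matrix_inv (g c z) $ j $ l = a * G p q z / det (g c z)"
      by blast
    show ?thesis
      using iffD2[OF pd_ok_cong[OF c y, where u = "\<lambda>z. matrix_inv (g c z) $ j $ l"
            and v = "\<lambda>z. a * G p q z / det (g c z)"] quot] eq by blast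
  qed
  have \<Gamma>_def': "\<Gamma> m i k = (\<lambda>y. 1 / 2 * (\<Sum>l\<in>UNIV. matrix_inv (g c y) $ m $ l *
      (pd c i (G k l) y + pd c k (G i l) y - pd c l (G i k) y)))" for m i k
    unfolding \<Gamma>_def christoffel_def G_def ..
  have \<Gamma>_ok: "pd_ok c (\<Gamma> m i k) y" if "y \<in> cdom c" for m i k y
    unfolding \<Gamma>_def' sum_2
    by (intro pd_ok_mult pd_ok_const pd_ok_add pd_ok_diff inv_ok ok2 that)
  \<comment> \<open>Christoffel symbols of the first kind, which no longer contain the inverse
    metric.\<close>
  have lower: "G l 1 y * \<Gamma> 1 i k y + G l 2 y * \<Gamma> 2 i k y =
      1 / 2 * (pd c i (G k l) y + pd c k (G i l) y - pd c l (G i k) y)" if y: "y \<in> cdom c" for l i k y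
  proof -
    define w where "w l = pd c i (G k l) y + pd c k (G i l) y - pd c l (G i k) y" for l
    have "(g c y ** matrix_inv (g c y)) $ l $ n = (if l = n then 1 else 0)" for n
      using matrix_inv_mult(1)[OF posdef_invertible[OF pos[OF y]]] by (simp add: mat_def)
    then have inv: "G l 1 y * matrix_inv (g c y) $ 1 $ n + G l 2 y * matrix_inv (g c y) $ 2 $ n = (if l = n then 1 else 0)" for n
      by (simp add: matrix_matrix_mult_def sum_2 G_def)
    have "G l 1 y * \<Gamma> 1 i k y + G l 2 y * \<Gamma> 2 i k y =
      1 / 2 * ((G l 1 y * matrix_inv (g c y) $ 1 $ 1 + G l 2 y * matrix_inv (g c y) $ 2 $ 1) * w 1
        + (G l 1 y * matrix_inv (g c y) $ 1 $ 2 + G l 2 y * matrix_inv (g c y) $ 2 $ 2) * w 2)"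
      unfolding \<Gamma>_def' sum_2 w_def[symmetric] by (simp add: algebra_simps)
    also have "\<dots> = 1 / 2 * w l"
      unfolding inv using exhaust_2[of l] by auto
    finally show ?thesis
      by (simp add: w_def)
  qed
  \<comment> \<open>Differentiating the lowered identity expresses the derivatives of the
    Christoffel symbols by second derivatives of \<open>G\<close>, without a formula for derivatives
    of the inverse metric.\<close>
  have dlower: "pd c j (G l 1) x * \<Gamma> 1 i k x + G l 1 x * pd c j (\<Gamma> 1 i k) x
      + (pd c j (G l 2) x * \<Gamma> 2 i k x + G l 2 x * pd c j (\<Gamma> 2 i k) x) =
      1 / 2 * (pd c j (pd c i (G k l)) x + pd c j (pd c k (G i l)) x - pd c j (pd c l (G i k)) x)" for l i k j
  proof -
    have "pd c j (\<lambda>y. G l 1 y * \<Gamma> 1 i k y + G l 2 y * \<Gamma> 2 i k y) x =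
        pd c j (\<lambda>y. 1 / 2 * (pd c i (G k l) y + pd c k (G i l) y - pd c l (G i k) y)) x"
      by (rule pd_cong[OF c x lower])
    then show ?thesis
      using x by (simp only: pd_add pd_mult pd_diff pd_const pd_ok_add pd_ok_mult pd_ok_diff pd_ok_const ok1 ok2 \<Gamma>_ok xx mult_zero_left add_0)
  qed
  \<comment> \<open>The coordinate form of \<nabla>g = 0.\<close>
  have compat: "pd c i (G k l) x = G l 1 x * \<Gamma> 1 i k x + G l 2 x * \<Gamma> 2 i k x
      + (G k 1 x * \<Gamma> 1 i l x + G k 2 x * \<Gamma> 2 i l x)" for i k l
    unfolding lower[OF x] using dsym[OF x, of i l k] dsym[OF x, of l i k] dsym[OF x, of k i l] by (simp add: field_simps)
  define r where "r l k = riemann g c l 1 2 k x" for l k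
  have r: "r l k = pd c 1 (\<Gamma> l 2 k) x - pd c 2 (\<Gamma> l 1 k) x
      + (\<Gamma> l 1 1 x * \<Gamma> 1 2 k x - \<Gamma> l 2 1 x * \<Gamma> 1 1 k x + (\<Gamma> l 1 2 x * \<Gamma> 2 2 k x - \<Gamma> l 2 2 x * \<Gamma> 2 1 k x))" for l k
    by (simp add: r_def riemann_def \<Gamma>_def sum_2)
  \<comment> \<open>Lowering and symmetrising in \<open>l\<close>, \<open>k\<close> leaves second
    derivatives of \<open>G\<close>, which cancel because they commute, and quadratic terms in the
    Christoffel symbols, which cancel by \<open>compat\<close>.\<close>
  have skew: "G l 1 x * r 1 k + G l 2 x * r 2 k + (G k 1 x * r 1 l + G k 2 x * r 2 l) = 0" for l k
  proof -
    have low: "G l 1 x * pd c j (\<Gamma> 1 i k) x + G l 2 x * pd c j (\<Gamma> 2 i k) x =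
      1 / 2 * (pd c j (pd c i (G k l)) x + pd c j (pd c k (G i l)) x - pd c j (pd c l (G i k)) x)
      - pd c j (G l 1) x * \<Gamma> 1 i k x - pd c j (G l 2) x * \<Gamma> 2 i k x" for l i k j
      using dlower[of j l i k] by (simp add: field_simps)
    have "G l 1 x * r 1 k + G l 2 x * r 2 k + (G k 1 x * r 1 l + G k 2 x * r 2 l) =
       (G l 1 x * pd c 1 (\<Gamma> 1 2 k) x + G l 2 x * pd c 1 (\<Gamma> 2 2 k) x)
       - (G l 1 x * pd c 2 (\<Gamma> 1 1 k) x + G l 2 x * pd c 2 (\<Gamma> 2 1 k) x)
       + (G k 1 x * pd c 1 (\<Gamma> 1 2 l) x + G k 2 x * pd c 1 (\<Gamma> 2 2 l) x)
       - (G k 1 x * pd c 2 (\<Gamma> 1 1 l) x + G k 2 x * pd c 2 (\<Gamma> 2 1 l) x)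
       + (G l 1 x * \<Gamma> 1 1 1 x + G l 2 x * \<Gamma> 2 1 1 x) * \<Gamma> 1 2 k x
       - (G l 1 x * \<Gamma> 1 2 1 x + G l 2 x * \<Gamma> 2 2 1 x) * \<Gamma> 1 1 k x
       + (G l 1 x * \<Gamma> 1 1 2 x + G l 2 x * \<Gamma> 2 1 2 x) * \<Gamma> 2 2 k x
       - (G l 1 x * \<Gamma> 1 2 2 x + G l 2 x * \<Gamma> 2 2 2 x) * \<Gamma> 2 1 k x
       + (G k 1 x * \<Gamma> 1 1 1 x + G k 2 x * \<Gamma> 2 1 1 x) * \<Gamma> 1 2 l x
       - (G k 1 x * \<Gamma> 1 2 1 x + G k 2 x * \<Gamma> 2 2 1 x) * \<Gamma> 1 1 l x
       + (G k 1 x * \<Gamma> 1 1 2 x + G k 2 x * \<Gamma> 2 1 2 x) * \<Gamma> 2 2 l x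
       - (G k 1 x * \<Gamma> 1 2 2 x + G k 2 x * \<Gamma> 2 2 2 x) * \<Gamma> 2 1 l x"
      unfolding r by (simp only: algebra_simps)
    also have "\<dots> = 0"
      unfolding low compat[of 1] compat[of 2]
      by (simp add: comm[OF x, of 2 1] Gsym[OF x, of 2 1] algebra_simps)
    finally show ?thesis .
  qed
  have det: "G 1 1 x * G 2 2 x - G 1 2 x * G 1 2 x = det (g c x)"
    using Gsym[OF x, of 2 1] by (simp add: det_2 G_def)
  \<comment> \<open>The terms with equal antisymmetric indices vanish, so each contraction keeps one
    summand: R(\<partial>_2, \<partial>_1) in the first row, hence the sign, and R(\<partial>_1,
    \<partial>_2) in the second.\<close>
  have ric: "ricci g c x $ 1 $ k = - r 2 k" "ricci g c x $ 2 $ k = r 1 k" for k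
    by (simp_all add: ricci_def r_def riemann_def sum_2)
  define S where "S = (\<Sum>j\<in>UNIV. \<Sum>k\<in>UNIV. matrix_inv (g c x) $ j $ k * ricci g c x $ j $ k)"
  have dpos: "det (g c x) > 0"
    using posdef_2(3)[OF pos[OF x]] .
  have S: "S = (G 2 2 x * (- r 2 1) - G 1 2 x * (- r 2 2) - G 1 2 x * r 1 1 + G 1 1 x * r 1 2) /
      (G 1 1 x * G 2 2 x - G 1 2 x * G 1 2 x)"
    using dpos Gsym[OF x, of 2 1] unfolding S_def sum_2 ric det
    by (simp add: matrix_inv_2 G_def[symmetric] field_simps)
  have "G 1 1 x * r 1 1 + G 1 2 x * r 2 1 = 0" "G 1 2 x * r 1 2 + G 2 2 x * r 2 2 = 0"
    "G 1 1 x * r 1 2 + G 1 2 x * r 2 2 + (G 1 2 x * r 1 1 + G 2 2 x * r 2 1) = 0"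
    using skew[of 1 1] skew[of 2 2] skew[of 1 2] Gsym[OF x, of 2 1] by (simp_all add: mult.commute)
  from skew_trace_form[OF _ this, folded S] dpos[folded det] show ?thesis
    unfolding S_def[symmetric] using Gsym[OF x, of 2 1]
    by (simp add: vec_eq_iff forall_2 ric G_def)
qed

section \<open>Differentiation under the integral\<close>

abbreviation spacetime_continuous :: "real \<Rightarrow> (real \<Rightarrow> 'm::topological_space \<Rightarrow> real) \<Rightarrow> bool" where
  "spacetime_continuous T u \<equiv> continuous_on ({0..<T} \<times> UNIV) (\<lambda>(t, x). u t x)"

lemma spacetime_continuous_slice:
  assumes "spacetime_continuous T u" "t \<in> {0..<T}"
  shows "continuous_on UNIV (u t)"
proof -
  have "continuous_on UNIV (\<lambda>x. case (t, x) of (t, x) \<Rightarrow> u t x)"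
    by (rule continuous_on_compose2[OF assms(1)]) (use assms(2) in \<open>auto intro: continuous_intros\<close>)
  then show ?thesis
    by simp
qed

text \<open>The time interval is half-open, so uniform bounds hold only up to a time
  \<open>t1 < T\<close>, where the cylinder is compact; a derivative at one time sees no more than
  that.\<close>

lemma spacetime_continuous_bounded:
  fixes u :: "real \<Rightarrow> 'm::topological_space \<Rightarrow> real"
  assumes "spacetime_continuous T u" "compact (UNIV :: 'm set)" "t1 < T"
  obtains B where "B > 0" "\<And>t x. t \<in> {0..t1} \<Longrightarrow> \<bar>u t x\<bar> \<le> B"
proof -
  have "compact ({0..t1} \<times> (UNIV :: 'm set))"
    using assms(2) by (intro compact_Times) auto
  moreover have "continuous_on ({0..t1} \<times> (UNIV :: 'm set)) (\<lambda>(t, x). u t x)"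
    using assms(1) by (rule continuous_on_subset) (use assms(3) in auto)
  ultimately have "bounded ((\<lambda>(t, x). u t x) ` ({0..t1} \<times> (UNIV :: 'm set)))"
    by (intro compact_imp_bounded compact_continuous_image)
  then obtain B where B: "\<forall>z\<in>(\<lambda>(t, x). u t x) ` ({0..t1} \<times> (UNIV :: 'm set)). norm z \<le> B"
    unfolding bounded_iff by blast
  have "\<bar>u t x\<bar> \<le> max B 1" if "t \<in> {0..t1}" for t x
  proof -
    have "u t x \<in> (\<lambda>(t, x). u t x) ` ({0..t1} \<times> UNIV)"
      using that by (intro image_eqI[where x = "(t, x)"]) auto
    from bspec[OF B this] show ?thesis
      by auto
  qed
  then show ?thesis
    by (intro that[of "max B 1"]) auto
qed

text \<open>Mean value theorem for the power, whose derivative is increasing because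
  \<open>1 \<le> p\<close>. The intermediate point is positive, so the possible value 0 at an end
  does no harm.\<close>

lemma powr_diff_le:
  fixes p a b B :: real
  assumes "1 \<le> p" "0 \<le> a" "a \<le> B" "0 \<le> b" "b \<le> B"
  shows "\<bar>a powr p - b powr p\<bar> \<le> p * B powr (p - 1) * \<bar>a - b\<bar>"
proof -
  have *: "b powr p - a powr p \<le> p * B powr (p - 1) * (b - a)" if "0 \<le> a" "a < b" "b \<le> B" for a b
  proof -
    have "continuous_on {a..b} (\<lambda>x. x powr p)"
      using assms(1) that by (intro continuous_on_powr') (auto intro: continuous_intros)
    moreover have "((\<lambda>x. x powr p) has_derivative (*) (p * x powr (p - 1))) (at x)" if "a < x" "x < b" for x
      using has_real_derivative_powr[of x p] that \<open>0 \<le> a\<close> by (simp add: has_field_derivative_def)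
    ultimately obtain x where x: "a < x" "x < b" "b powr p - a powr p = p * x powr (p - 1) * (b - a)"
      using mvt[OF \<open>a < b\<close>, of "\<lambda>x. x powr p" "\<lambda>x. (*) (p * x powr (p - 1))"] by auto
    have "x powr (p - 1) \<le> B powr (p - 1)"
      using x that assms(1) by (intro powr_mono2) auto
    then show ?thesis
      unfolding x(3) using assms(1) x by (intro mult_right_mono mult_left_mono) auto
  qed
  have mono: "a powr p \<le> b powr p" if "a \<le> b" "0 \<le> a" for a b
    using that assms(1) by (intro powr_mono2) auto
  consider "a < b" | "b < a" | "a = b" by linarith
  then show ?thesis
    by cases (use *[of a b] *[of b a] mono[of a b] mono[of b a] assms in auto)
qed

text \<open>Regularising by \<open>\<epsilon>\<close> avoids the singularity of the square root at the zeros of \<open>q\<close>.\<close>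

lemma sqrt_Lipschitz_of_derivative_bound:
  fixes q q' :: "real \<Rightarrow> real"
  assumes I: "is_interval I" "s \<in> I" "t \<in> I"
    and q: "\<And>r. r \<in> I \<Longrightarrow> (q has_real_derivative q' r) (at r within I)"
    and nonneg: "\<And>r. r \<in> I \<Longrightarrow> q r \<ge> 0"
    and bound: "\<And>r. r \<in> I \<Longrightarrow> \<bar>q' r\<bar> \<le> 2 * C * sqrt (q r)" and C: "C \<ge> 0"
  shows "\<bar>sqrt (q t) - sqrt (q s)\<bar> \<le> C * \<bar>t - s\<bar>"
proof -
  have *: "\<bar>sqrt (q t + e) - sqrt (q s + e)\<bar> \<le> C * \<bar>t - s\<bar>" if e: "e > 0" for e
  proof -
    have "((\<lambda>r. sqrt (q r + e)) has_real_derivative q' r / (2 * sqrt (q r + e))) (at r within I)" if "r \<in> I" for r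
      using nonneg[OF that] e by (auto intro!: derivative_eq_intros q that simp: field_simps)
    from mvt_within_interval[OF I this] obtain r
      where r: "r \<in> closed_segment s t" "sqrt (q t + e) - sqrt (q s + e) = (t - s) * (q' r / (2 * sqrt (q r + e)))"
      by blast
    have rI: "r \<in> I"
      using closed_segment_subset[OF I(2,3)] I(1) r(1) is_interval_convex_1 by blast
    have pos: "sqrt (q r + e) > 0"
      using nonneg[OF rI] e by simp
    have "\<bar>q' r\<bar> \<le> 2 * C * sqrt (q r + e)"
      using bound[OF rI] mult_left_mono[of "sqrt (q r)" "sqrt (q r + e)" "2 * C"] C e by auto
    then have "\<bar>q' r / (2 * sqrt (q r + e))\<bar> \<le> C"
      using pos by (simp add: abs_mult field_simps)
    then show ?thesis
      unfolding r(2) abs_mult by (metis abs_ge_zero mult.commute mult_right_mono)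
  qed
  have "((\<lambda>e. \<bar>sqrt (q t + e) - sqrt (q s + e)\<bar>) \<longlongrightarrow> \<bar>sqrt (q t + 0) - sqrt (q s + 0)\<bar>) (at_right 0)"
    by (intro tendsto_intros)
  then have "\<bar>sqrt (q t + 0) - sqrt (q s + 0)\<bar> \<le> C * \<bar>t - s\<bar>"
    by (rule tendsto_upperbound) (use * in \<open>auto simp: eventually_at_filter\<close>)
  then show ?thesis
    by simp
qed

text \<open>Where \<open>q t > 0\<close> this is the chain rule. At a zero with p > 1, sqrt q is
  Lipschitz and vanishes, so q^(p/2) is at most (C |s - t|)^p = o(|s - t|); the asserted derivative
  is 0 there since \<open>0 powr a = 0\<close>.\<close>

lemma has_real_derivative_powr_half:
  fixes q q' :: "real \<Rightarrow> real"
  assumes I: "is_interval I" "t \<in> I" and p: "1 \<le> p"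
    and q: "\<And>r. r \<in> I \<Longrightarrow> (q has_real_derivative q' r) (at r within I)"
    and nonneg: "\<And>r. r \<in> I \<Longrightarrow> q r \<ge> 0"
    and bound: "\<And>r. r \<in> I \<Longrightarrow> \<bar>q' r\<bar> \<le> 2 * C * sqrt (q r)" and C: "C \<ge> 0"
    and pos: "p = 1 \<Longrightarrow> q t \<noteq> 0"
  shows "((\<lambda>r. q r powr (p / 2)) has_real_derivative p / 2 * q t powr (p / 2 - 1) * q' t) (at t within I)"
proof (cases "q t = 0")
  case False
  then have "q t > 0"
    using nonneg[OF I(2)] by simp
  from DERIV_chain2[OF has_real_derivative_powr[OF this, of "p / 2"] q[OF I(2)]] show ?thesis .
next
  case True
  then have p: "p > 1"
    using p pos by force
  have est: "q s powr (p / 2) \<le> (C * \<bar>s - t\<bar>) powr p" if "s \<in> I" for s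
  proof -
    have "sqrt (q s) \<le> C * \<bar>s - t\<bar>"
      using sqrt_Lipschitz_of_derivative_bound[OF I that q nonneg bound C] True nonneg[OF that] by simp
    then have "sqrt (q s) powr p \<le> (C * \<bar>s - t\<bar>) powr p"
      using p nonneg[OF that] by (intro powr_mono2) auto
    then show ?thesis
      using nonneg[OF that] by (simp add: powr_half_sqrt[symmetric] powr_powr)
  qed
  have "((\<lambda>s. C powr p * \<bar>s - t\<bar> powr (p - 1)) \<longlongrightarrow> C powr p * \<bar>t - t\<bar> powr (p - 1)) (at t within I)"
    using p by (intro tendsto_intros tendsto_powr') auto
  then have lim: "((\<lambda>s. C powr p * \<bar>s - t\<bar> powr (p - 1)) \<longlongrightarrow> 0) (at t within I)"
    by simp
  have "\<forall>\<^sub>F s in at t within I. norm ((q s powr (p / 2) - q t powr (p / 2)) / (s - t)) \<le> C powr p * \<bar>s - t\<bar> powr (p - 1)"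
    unfolding eventually_at_filter
  proof (intro always_eventually allI impI)
    fix s assume s: "s \<noteq> t" "s \<in> I"
    have "q s powr (p / 2) \<le> C powr p * (\<bar>s - t\<bar> powr (p - 1) * \<bar>s - t\<bar>)"
      using est[OF s(2)] C s(1) by (simp add: powr_mult powr_diff)
    then show "norm ((q s powr (p / 2) - q t powr (p / 2)) / (s - t)) \<le> C powr p * \<bar>s - t\<bar> powr (p - 1)"
      using s(1) True by (simp add: pos_divide_le_eq mult.assoc)
  qed
  from Lim_null_comparison[OF this lim] show ?thesis
    using True by (simp add: has_field_derivative_iff)
qed

text \<open>Dominated convergence of difference quotients. The hypothesis \<open>bound\<close> makes
  sqrt Q Lipschitz in time with a constant independent of the point. Applied with Q = |\<nabla>f|^2
  for the energy and Q = f^2 for the normalisation; \<open>w\<close> carries the conformal factor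
  and the weight.\<close>

lemma integral_powr_half_has_real_derivative:
  fixes Q Q' w w' K :: "real \<Rightarrow> 'm::topological_space \<Rightarrow> real"
  assumes cpt: "compact (UNIV :: 'm set)" and fin: "finite_measure \<nu>" and sets: "sets \<nu> = sets borel"
    and t: "t \<in> {0..<T}" and p: "1 \<le> p"
    and cont: "spacetime_continuous T Q" "spacetime_continuous T Q'" "spacetime_continuous T w"
      "spacetime_continuous T w'" "spacetime_continuous T K"
    and Q: "\<And>t x. t \<in> {0..<T} \<Longrightarrow> ((\<lambda>s. Q s x) has_real_derivative Q' t x) (at t within {0..<T})"
    and w: "\<And>t x. t \<in> {0..<T} \<Longrightarrow> ((\<lambda>s. w s x) has_real_derivative w' t x) (at t within {0..<T})"
    and nonneg: "\<And>t x. t \<in> {0..<T} \<Longrightarrow> Q t x \<ge> 0"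
    and bound: "\<And>t x. t \<in> {0..<T} \<Longrightarrow> \<bar>Q' t x\<bar> \<le> 2 * K t x * sqrt (Q t x)"
    and pos: "p = 1 \<Longrightarrow> AE x in \<nu>. Q t x \<noteq> 0"
  shows "((\<lambda>t. LINT x|\<nu>. Q t x powr (p / 2) * w t x) has_real_derivative
      (LINT x|\<nu>. p / 2 * Q t x powr (p / 2 - 1) * Q' t x * w t x) + (LINT x|\<nu>. Q t x powr (p / 2) * w' t x))
      (at t within {0..<T})"
proof -
  \<comment> \<open>Any time strictly between \<open>t\<close> and \<open>T\<close> serves: the
    bounds hold up to \<open>t1\<close>, and the derivative at \<open>t\<close> is unaffected by
    later times.\<close>
  define t1 where "t1 = (t + T) / 2"
  have t1: "t < t1" "t1 < T" "0 \<le> t"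
    using t by (auto simp: t1_def)
  define I where "I = {0..t1}"
  have I: "is_interval I" "t \<in> I" "I \<subseteq> {0..<T}"
    using t1 by (auto simp: I_def is_interval_cc)
  have at_eq: "at t within {0..<T} = at t within I"
    using t1 by (intro at_within_nhd[of _ "{..<t1}"]) (auto simp: I_def)
  obtain B where B: "B > 0" "\<And>t x. t \<in> I \<Longrightarrow> \<bar>Q t x\<bar> \<le> B"
    using spacetime_continuous_bounded[OF cont(1) cpt t1(2)] unfolding I_def by blast
  obtain W where W: "W > 0" "\<And>t x. t \<in> I \<Longrightarrow> \<bar>w t x\<bar> \<le> W"
    using spacetime_continuous_bounded[OF cont(3) cpt t1(2)] unfolding I_def by blast
  obtain W' where W': "W' > 0" "\<And>t x. t \<in> I \<Longrightarrow> \<bar>w' t x\<bar> \<le> W'"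
    using spacetime_continuous_bounded[OF cont(4) cpt t1(2)] unfolding I_def by blast
  obtain C where C: "C > 0" "\<And>t x. t \<in> I \<Longrightarrow> \<bar>K t x\<bar> \<le> C"
    using spacetime_continuous_bounded[OF cont(5) cpt t1(2)] unfolding I_def by blast
  have QI: "((\<lambda>s. Q s x) has_real_derivative Q' s x) (at s within I)"
    and wI: "((\<lambda>s. w s x) has_real_derivative w' s x) (at s within I)" if "s \<in> I" for s x
    using that I(3) by (blast intro: DERIV_subset Q w)+
  have nonnegI: "Q s x \<ge> 0" if "s \<in> I" for s x
    using that I(3) nonneg by auto
  have boundI: "\<bar>Q' s x\<bar> \<le> 2 * C * sqrt (Q s x)" if "s \<in> I" for s x
  proof -
    have "K s x \<le> C"
      using C(2)[OF that, of x] by simp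
    then have "2 * K s x * sqrt (Q s x) \<le> 2 * C * sqrt (Q s x)"
      using nonnegI[OF that] by (intro mult_right_mono) auto
    then show ?thesis
      using bound[of s x] that I(3) by fastforce
  qed
  define H where "H s x = Q s x powr (p / 2)" for s x
  define H' where "H' x = p / 2 * Q t x powr (p / 2 - 1) * Q' t x" for x
  \<comment> \<open>The Lipschitz constant of y^p on [0, sqrt B] times the Lipschitz constant
    \<open>C\<close> of sqrt Q.\<close>
  define M where "M = p * sqrt B powr (p - 1) * C"
  have M: "M \<ge> 0"
    using p C by (simp add: M_def)
  have H_eq: "H s x = sqrt (Q s x) powr p" if "s \<in> I" for s x
    using nonnegI[OF that] by (simp add: H_def powr_half_sqrt[symmetric] powr_powr)
  have H_bound: "\<bar>H s x\<bar> \<le> B powr (p / 2)" if "s \<in> I" for s x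
    using nonnegI[OF that, of x] B(2)[OF that, of x] p unfolding H_def by (auto intro: powr_mono2)
  have H_Lip: "\<bar>H s x - H t x\<bar> \<le> M * \<bar>s - t\<bar>" if s: "s \<in> I" for s x
  proof -
    have "\<bar>H s x - H t x\<bar> \<le> p * sqrt B powr (p - 1) * \<bar>sqrt (Q s x) - sqrt (Q t x)\<bar>"
      unfolding H_eq[OF s] H_eq[OF I(2)]
      using nonnegI[OF s, of x] nonnegI[OF I(2), of x] B(2)[OF s, of x] B(2)[OF I(2), of x] p
      by (intro powr_diff_le) auto
    also have "\<dots> \<le> p * sqrt B powr (p - 1) * (C * \<bar>s - t\<bar>)"
      using sqrt_Lipschitz_of_derivative_bound[OF I(1,2) s, of "\<lambda>s. Q s x" "\<lambda>s. Q' s x" C] QI nonnegI boundI C(1) p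
      by (intro mult_left_mono) auto
    finally show ?thesis
      by (simp add: M_def mult.assoc)
  qed
  have w_Lip: "\<bar>w s x - w t x\<bar> \<le> W' * \<bar>s - t\<bar>" if s: "s \<in> I" for s x
  proof -
    obtain r where r: "r \<in> closed_segment t s" "w s x - w t x = (s - t) * w' r x"
      using mvt_within_interval[OF I(1,2) s, of "\<lambda>s. w s x" "\<lambda>s. w' s x"] wI by blast
    have "r \<in> I"
      using closed_segment_subset[OF I(2) s] I(1) r(1) is_interval_convex_1 by blast
    then show ?thesis
      using mult_right_mono[OF W'(2)[of r x], of "\<bar>s - t\<bar>"] by (simp add: r(2) abs_mult mult.commute)
  qed
  \<comment> \<open>The Lipschitz constant of a product, from the bounds and Lipschitz constants of
    its two factors.\<close>
  define L where "L = M * W + B powr (p / 2) * W'"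
  have quot_bound: "\<bar>(H s x * w s x - H t x * w t x) / (s - t)\<bar> \<le> L" if s: "s \<in> I" "s \<noteq> t" for s x
  proof -
    have "H s x * w s x - H t x * w t x = (H s x - H t x) * w s x + H t x * (w s x - w t x)"
      by (simp add: algebra_simps)
    also have "\<bar>\<dots>\<bar> \<le> \<bar>H s x - H t x\<bar> * \<bar>w s x\<bar> + \<bar>H t x\<bar> * \<bar>w s x - w t x\<bar>"
      by (rule order_trans[OF abs_triangle_ineq]) (simp add: abs_mult)
    also have "\<dots> \<le> (M * \<bar>s - t\<bar>) * W + B powr (p / 2) * (W' * \<bar>s - t\<bar>)"
      by (intro add_mono mult_mono H_Lip w_Lip H_bound W(2) s I(2)) (use M W(1) in auto)
    also have "\<dots> = L * \<bar>s - t\<bar>"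
      by (simp add: L_def algebra_simps)
    finally show ?thesis
      using s(2) by (simp add: abs_divide pos_divide_le_eq)
  qed
  have meas: "u s \<in> borel_measurable \<nu>" if "spacetime_continuous T u" "s \<in> I" for u s
    using borel_measurable_continuous_onI[OF spacetime_continuous_slice[OF that(1)]] that(2) I(3) sets
    by (auto simp: measurable_cong_sets[OF sets refl])
  have Hw_int: "integrable \<nu> (\<lambda>x. H s x * w s x)" if s: "s \<in> I" for s
  proof (rule finite_measure.integrable_const_bound[OF fin, where B = "B powr (p / 2) * W"])
    show "AE x in \<nu>. norm (H s x * w s x) \<le> B powr (p / 2) * W"
      using H_bound[OF s] W(2)[OF s] by (auto simp: abs_mult intro!: AE_I2 mult_mono)
    show "(\<lambda>x. H s x * w s x) \<in> borel_measurable \<nu>"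
      using meas[OF cont(1) s] meas[OF cont(3) s] unfolding H_def by measurable
  qed
  have "((\<lambda>s. ((LINT x|\<nu>. H s x * w s x) - (LINT x|\<nu>. H t x * w t x)) / (s - t)) \<longlongrightarrow>
      (LINT x|\<nu>. H' x * w t x + H t x * w' t x)) (at t within I)"
    unfolding tendsto_at_iff_sequentially
  proof (intro allI impI)
    fix X :: "nat \<Rightarrow> real"
    assume X: "\<forall>i. X i \<in> I - {t}" "X \<longlonglongrightarrow> t"
    have "(\<lambda>i. LINT x|\<nu>. (H (X i) x * w (X i) x - H t x * w t x) / (X i - t)) \<longlonglongrightarrow>
        (LINT x|\<nu>. H' x * w t x + H t x * w' t x)"
    proof (rule integral_dominated_convergence[where w = "\<lambda>_. L"])
      show "integrable \<nu> (\<lambda>_. L)"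
        using fin by (simp add: finite_measure.integrable_const)
      show "(\<lambda>x. H' x * w t x + H t x * w' t x) \<in> borel_measurable \<nu>"
        using meas[OF cont(1) I(2)] meas[OF cont(2) I(2)] meas[OF cont(3) I(2)] meas[OF cont(4) I(2)]
        unfolding H_def H'_def by measurable
      show "(\<lambda>x. (H (X i) x * w (X i) x - H t x * w t x) / (X i - t)) \<in> borel_measurable \<nu>" for i
        using borel_measurable_integrable[OF Hw_int[of "X i"]] borel_measurable_integrable[OF Hw_int[of t]] X I(2)
        by auto
      show "AE x in \<nu>. norm ((H (X i) x * w (X i) x - H t x * w t x) / (X i - t)) \<le> L" for i
        using quot_bound[of "X i"] X by (auto intro!: AE_I2)
      \<comment> \<open>Only for p = 1 can a zero of \<open>Q\<close> destroy pointwise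
        differentiability, and then the zeros form a null set.\<close>
      have "AE x in \<nu>. p = 1 \<longrightarrow> Q t x \<noteq> 0"
        using pos by (cases "p = 1") auto
      then show "AE x in \<nu>. (\<lambda>i. (H (X i) x * w (X i) x - H t x * w t x) / (X i - t)) \<longlonglongrightarrow>
          H' x * w t x + H t x * w' t x"
      proof eventually_elim
        case (elim x)
        have "((\<lambda>s. H s x) has_real_derivative H' x) (at t within I)"
          unfolding H_def H'_def
          by (rule has_real_derivative_powr_half[OF I(1,2) p, where C = C])
             (use QI nonnegI boundI C(1) elim in auto)
        from DERIV_mult'[OF this wI[OF I(2)]]
        have "((\<lambda>s. (H s x * w s x - H t x * w t x) / (s - t)) \<longlongrightarrow> H t x * w' t x + H' x * w t x) (at t within I)"
          by (simp add: has_field_derivative_iff)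
        then show ?case
          using X unfolding tendsto_at_iff_sequentially o_def by (auto simp: add.commute)
      qed
    qed
    moreover have "(LINT x|\<nu>. (H (X i) x * w (X i) x - H t x * w t x) / (X i - t)) =
        ((LINT x|\<nu>. H (X i) x * w (X i) x) - (LINT x|\<nu>. H t x * w t x)) / (X i - t)" for i
      using Hw_int[of "X i"] Hw_int[of t] X I(2) by simp
    ultimately show "((\<lambda>s. ((LINT x|\<nu>. H s x * w s x) - (LINT x|\<nu>. H t x * w t x)) / (s - t)) \<circ> X)
        \<longlonglongrightarrow> (LINT x|\<nu>. H' x * w t x + H t x * w' t x)"
      unfolding o_def by (simp only:)
  qed
  moreover have "(LINT x|\<nu>. H' x * w t x + H t x * w' t x) = (LINT x|\<nu>. H' x * w t x) + (LINT x|\<nu>. H t x * w' t x)"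
  proof (rule Bochner_Integration.integral_add)
    \<comment> \<open>The singular factor Q^(p/2 - 1) is compensated by the sqrt Q in the bound on
      \<open>Q'\<close>; what remains is sqrt Q to the power p - 1, bounded since
      \<open>1 \<le> p\<close>.\<close>
    have "\<bar>H' x\<bar> \<le> M" for x
    proof (cases "Q t x = 0")
      case False
      then have Q: "Q t x > 0"
        using nonnegI[OF I(2), of x] by simp
      have "\<bar>H' x\<bar> = p / 2 * Q t x powr (p / 2 - 1) * \<bar>Q' t x\<bar>"
        using p by (simp add: H'_def abs_mult)
      also have "\<dots> \<le> p / 2 * Q t x powr (p / 2 - 1) * (2 * C * sqrt (Q t x))"
        using p by (intro mult_left_mono boundI[OF I(2)]) auto
      also have "\<dots> = p * C * sqrt (Q t x) powr (p - 1)"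
      proof -
        have "Q t x powr (p / 2 - 1) * sqrt (Q t x) = Q t x powr ((p / 2 - 1) + 1 / 2)"
          using Q by (subst powr_add) (simp add: powr_half_sqrt)
        also have "(p / 2 - 1) + 1 / 2 = 1 / 2 * (p - 1)"
          by (simp add: field_simps)
        also have "Q t x powr (1 / 2 * (p - 1)) = sqrt (Q t x) powr (p - 1)"
          using Q powr_powr[of "Q t x" "1 / 2" "p - 1"] by (simp add: powr_half_sqrt)
        finally have "Q t x powr (p / 2 - 1) * sqrt (Q t x) = sqrt (Q t x) powr (p - 1)" .
        then show ?thesis
          by (simp add: mult_ac)
      qed
      also have "\<dots> \<le> p * C * sqrt B powr (p - 1)"
        using p C(1) Q B(2)[OF I(2), of x] by (intro mult_left_mono powr_mono2) auto
      finally show ?thesis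
        by (simp add: M_def mult_ac)
    qed (use M in \<open>simp add: H'_def\<close>)
    then have "\<bar>H' x * w t x\<bar> \<le> M * W" for x
      unfolding abs_mult using W(2)[OF I(2)] M by (intro mult_mono) auto
    moreover have "(\<lambda>x. H' x * w t x) \<in> borel_measurable \<nu>"
      using meas[OF cont(1) I(2)] meas[OF cont(2) I(2)] meas[OF cont(3) I(2)] unfolding H'_def by measurable
    ultimately show "integrable \<nu> (\<lambda>x. H' x * w t x)"
      by (intro finite_measure.integrable_const_bound[OF fin, where B = "M * W"]) auto
    have "\<bar>H t x * w' t x\<bar> \<le> B powr (p / 2) * W'" for x
      unfolding abs_mult using W'(2)[OF I(2)] H_bound[OF I(2)] by (intro mult_mono) auto
    moreover have "(\<lambda>x. H t x * w' t x) \<in> borel_measurable \<nu>"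
      using meas[OF cont(1) I(2)] meas[OF cont(4) I(2)] unfolding H_def by measurable
    ultimately show "integrable \<nu> (\<lambda>x. H t x * w' t x)"
      by (intro finite_measure.integrable_const_bound[OF fin, where B = "B powr (p / 2) * W'"]) auto
  qed
  ultimately show ?thesis
    unfolding at_eq has_field_derivative_iff H_def H'_def by simp
qed

section \<open>The volume measure\<close>

lemma atlas_finite_cover:
  fixes A :: "('m::{t2_space,second_countable_topology}) chart set"
  assumes "closed_oriented_surface A"
  obtains C where "finite C" "C \<subseteq> A" "(\<Union>c\<in>C. cdom c) = UNIV"
proof -
  have "compact (UNIV :: 'm set)" "\<And>c. c \<in> A \<Longrightarrow> open (cdom c)" "UNIV \<subseteq> (\<Union>c\<in>A. cdom c)"
    using assms by (auto simp: closed_oriented_surface_def oriented_atlas_def is_chart_def)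
  from compactE_image[OF this] obtain C where "C \<subseteq> A" "finite C" "UNIV \<subseteq> (\<Union>c\<in>C. cdom c)"
    by blast
  then show ?thesis
    by (intro that[of C]) auto
qed

text \<open>Splitting off one open set at a time decomposes any Borel set into pieces inside single
  charts, where the volume measure is prescribed.\<close>

lemma measure_eqI_finite_open_cover:
  fixes \<nu> \<nu>' :: "'m::topological_space measure"
  assumes C: "finite C" "(\<Union>c\<in>C. U c) = UNIV" "\<And>c. c \<in> C \<Longrightarrow> open (U c)"
    and sets: "sets \<nu> = sets borel" "sets \<nu>' = sets borel"
    and eq: "\<And>c B. c \<in> C \<Longrightarrow> B \<in> sets borel \<Longrightarrow> B \<subseteq> U c \<Longrightarrow> emeasure \<nu> B = emeasure \<nu>' B"
  shows "\<nu> = \<nu>'"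
proof (rule measure_eqI)
  have *: "emeasure \<nu> B = emeasure \<nu>' B" if "finite C'" "C' \<subseteq> C" "B \<in> sets borel" "B \<subseteq> (\<Union>c\<in>C'. U c)" for C' B
    using that
  proof (induction C' arbitrary: B)
    case (insert c C')
    have B: "B \<inter> U c \<in> sets borel" "B - U c \<in> sets borel"
      using insert.prems C(3) by auto
    have "emeasure \<nu> B = emeasure \<nu> (B \<inter> U c) + emeasure \<nu> (B - U c)"
      using B sets by (subst plus_emeasure) (auto intro!: arg_cong[where f = "emeasure \<nu>"])
    also have "\<dots> = emeasure \<nu>' (B \<inter> U c) + emeasure \<nu>' (B - U c)"
      using insert.prems B by (intro arg_cong2[where f = plus] eq[of c] insert.IH) auto
    also have "\<dots> = emeasure \<nu>' B"
      using B sets by (subst plus_emeasure) (auto intro!: arg_cong[where f = "emeasure \<nu>'"])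
    finally show ?case .
  qed simp
  show "emeasure \<nu> B = emeasure \<nu>' B" if "B \<in> sets \<nu>" for B
    using *[OF C(1) subset_refl, of B] that sets C(2) by auto
qed (simp add: sets)

lemma continuous_on_det_metric:
  assumes "riemannian_metric A g" "c \<in> A"
  shows "continuous_on (cimg c) (\<lambda>y. det (g c (chart_inv c y)))"
proof -
  have "Ck_on 0 (cimg c) (g c \<circ> chart_inv c)"
    using assms unfolding riemannian_metric_def smooth_on_def by blast
  then have "continuous_on (cimg c) (\<lambda>y. g c (chart_inv c y))"
    by (simp add: o_def)
  then show ?thesis
    unfolding det_2 by (intro continuous_intros)
qed

lemma volume_measureD:
  assumes "volume_measure A g \<nu>" "c \<in> A" "B \<in> sets borel" "B \<subseteq> cdom c"
  shows "emeasure \<nu> B =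
    (\<integral>\<^sup>+ y. indicator (snd c ` B) y * ennreal (sqrt (det (g c (chart_inv c y)))) \<partial>lborel)"
  using assms unfolding volume_measure_def by blast

text \<open>The definition prescribes measures of sets. It says that the restriction of
  \<open>\<nu>\<close> to the chart domain is the image of sqrt(det g) dx under the inverse chart,
  and image measures and densities then extend this to integrals.\<close>

lemma volume_measure_nn_integral:
  fixes A :: "('m::topological_space) chart set"
  assumes g: "riemannian_metric A g" and vol: "volume_measure A g \<nu>"
    and c: "c \<in> A" "is_chart c" and u: "u \<in> borel_measurable borel"
  shows "(\<integral>\<^sup>+ x. indicator (cdom c) x * u x \<partial>\<nu>) =
    (\<integral>\<^sup>+ y. indicator (cimg c) y * (ennreal (sqrt (det (g c (chart_inv c y)))) * u (chart_inv c y)) \<partial>lborel)"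
proof -
  have sets: "sets \<nu> = sets borel"
    using vol by (simp add: volume_measure_def)
  have op: "open (cdom c)" "open (cimg c)"
    using c by (auto simp: is_chart_def)
  \<comment> \<open>An everywhere defined Borel extension of the inverse chart; its arbitrary value
    outside the chart image carries no mass because the density \<open>D\<close> vanishes
    there.\<close>
  define e where "e y = (if y \<in> cimg c then chart_inv c y else undefined)" for y
  have e: "e \<in> borel_measurable borel"
    unfolding e_def using op(2) continuous_on_chart(2)[OF c(2)]
    by (intro borel_measurable_continuous_on_if) (auto intro: continuous_intros)
  define D where "D y = indicator (cimg c) y *\<^sub>R sqrt (det (g c (chart_inv c y)))" for y
  have D: "D \<in> borel_measurable borel"
    unfolding D_def using op(2)
    by (intro borel_measurable_continuous_on_indicator continuous_on_real_sqrt continuous_on_det_metric[OF g c(1)]) auto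
  define N where "N = distr (density lborel (\<lambda>y. ennreal (D y))) borel e"
  have e': "e \<in> measurable (density lborel (\<lambda>y. ennreal (D y))) borel"
    using e by simp
  have "density \<nu> (indicator (cdom c)) = N"
  proof (rule measure_eqI)
    show "sets (density \<nu> (indicator (cdom c))) = sets N"
      by (simp add: N_def sets)
    fix X assume "X \<in> sets (density \<nu> (indicator (cdom c)))"
    then have X: "X \<in> sets borel"
      by (simp add: sets)
    have "emeasure (density \<nu> (indicator (cdom c))) X = (\<integral>\<^sup>+ x. indicator (cdom c \<inter> X) x \<partial>\<nu>)"
      using X op(1) by (simp add: emeasure_density sets measurable_cong_sets[OF sets refl] indicator_inter_arith del: nn_integral_indicator)
    also have "\<dots> = emeasure \<nu> (cdom c \<inter> X)"
      using X op(1) by (intro nn_integral_indicator) (auto simp: sets)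
    also have "\<dots> = (\<integral>\<^sup>+ y. indicator (snd c ` (cdom c \<inter> X)) y * ennreal (sqrt (det (g c (chart_inv c y)))) \<partial>lborel)"
    proof -
      have "cdom c \<inter> X \<in> sets borel"
        using X op(1) by auto
      then show ?thesis
        by (rule volume_measureD[OF vol c(1)]) auto
    qed
    also have "\<dots> = (\<integral>\<^sup>+ y. ennreal (D y) * indicator (e -` X) y \<partial>lborel)"
    proof (rule nn_integral_cong)
      fix y
      have "y \<in> snd c ` (cdom c \<inter> X) \<longleftrightarrow> y \<in> cimg c \<and> e y \<in> X"
        using chart_inv_simps[OF c(2)] by (auto simp: e_def image_iff intro!: bexI[of _ "chart_inv c y"])
      then show "indicator (snd c ` (cdom c \<inter> X)) y * ennreal (sqrt (det (g c (chart_inv c y)))) =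
          ennreal (D y) * indicator (e -` X) y"
        by (auto simp: D_def indicator_def)
    qed
    also have "\<dots> = emeasure N X"
      unfolding N_def using X D measurable_sets[OF e X]
      by (simp add: emeasure_distr[OF e' X] emeasure_density)
    finally show "emeasure (density \<nu> (indicator (cdom c))) X = emeasure N X" .
  qed
  then have "(\<integral>\<^sup>+ x. u x \<partial>density \<nu> (indicator (cdom c))) = (\<integral>\<^sup>+ x. u x \<partial>N)"
    by simp
  also have "(\<integral>\<^sup>+ x. u x \<partial>density \<nu> (indicator (cdom c))) = (\<integral>\<^sup>+ x. indicator (cdom c) x * u x \<partial>\<nu>)"
    using u op(1) by (intro nn_integral_density) (auto simp: sets measurable_cong_sets[OF sets refl])
  also have "(\<integral>\<^sup>+ x. u x \<partial>N) = (\<integral>\<^sup>+ y. ennreal (D y) * u (e y) \<partial>lborel)"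
    unfolding N_def using u D e by (simp add: nn_integral_distr[OF e'] nn_integral_density)
  also have "\<dots> = (\<integral>\<^sup>+ y. indicator (cimg c) y * (ennreal (sqrt (det (g c (chart_inv c y)))) * u (chart_inv c y)) \<partial>lborel)"
    by (intro nn_integral_cong) (auto simp: D_def e_def indicator_def)
  finally show ?thesis .
qed

lemma volume_measure_null:
  assumes vol: "volume_measure A g \<nu>" and c: "c \<in> A" and B: "B \<in> sets borel" "B \<subseteq> cdom c"
    and null: "AE y in lborel. y \<notin> snd c ` B"
  shows "emeasure \<nu> B = 0"
proof -
  have "emeasure \<nu> B = (\<integral>\<^sup>+ y. indicator (snd c ` B) y * ennreal (sqrt (det (g c (chart_inv c y)))) \<partial>lborel)"
    by (rule volume_measureD[OF vol c B])
  also have "\<dots> = (\<integral>\<^sup>+ y. 0 \<partial>(lborel :: (real^2) measure))"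
    using null by (intro nn_integral_cong_AE) (auto simp: indicator_def)
  finally show ?thesis
    by simp
qed

text \<open>Every point has a neighbourhood whose image lies in a closed ball inside the chart
  image, where det g is bounded; finitely many such neighbourhoods cover the compact
  surface.\<close>

lemma volume_measure_finite:
  fixes A :: "('m::{t2_space,second_countable_topology}) chart set"
  assumes surface: "closed_oriented_surface A" and g: "riemannian_metric A g" and vol: "volume_measure A g \<nu>"
  shows "finite_measure \<nu>"
proof
  have sets: "sets \<nu> = sets borel" and A: "oriented_atlas A" and cpt: "compact (UNIV :: 'm set)"
    using vol surface by (auto simp: volume_measure_def closed_oriented_surface_def)
  have "\<exists>U. open U \<and> x \<in> U \<and> emeasure \<nu> U < \<infinity>" for x
  proof -
    define c where "c = chart_at A x"
    have c: "c \<in> A" "x \<in> cdom c" "is_chart c"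
      unfolding c_def by (rule chart_at[OF A])+
    have op: "open (cdom c)" "open (cimg c)" "snd c x \<in> cimg c"
      using c by (auto simp: is_chart_def)
    obtain r where r: "r > 0" "cball (snd c x) r \<subseteq> cimg c"
      using op open_contains_cball by metis
    define U where "U = cdom c \<inter> snd c -` ball (snd c x) r"
    have U: "open U" "x \<in> U" "U \<subseteq> cdom c"
      unfolding U_def using continuous_open_preimage[OF continuous_on_chart(1)[OF c(3)] op(1)] c(2) r(1) by auto
    have "continuous_on (cball (snd c x) r) (\<lambda>y. sqrt (det (g c (chart_inv c y))))"
      using continuous_on_det_metric[OF g c(1)] r(2) by (intro continuous_intros) (auto intro: continuous_on_subset)
    then have "bounded ((\<lambda>y. sqrt (det (g c (chart_inv c y)))) ` cball (snd c x) r)"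
      by (intro compact_imp_bounded compact_continuous_image) auto
    then obtain K where K': "\<forall>z\<in>(\<lambda>y. sqrt (det (g c (chart_inv c y)))) ` cball (snd c x) r. norm z \<le> K"
      unfolding bounded_iff by blast
    have K: "sqrt (det (g c (chart_inv c y))) \<le> K" if "y \<in> cball (snd c x) r" for y
      using order_trans[OF abs_ge_self bspec[OF K' imageI[OF that], unfolded real_norm_def]] .
    have "emeasure \<nu> U = (\<integral>\<^sup>+ y. indicator (snd c ` U) y * ennreal (sqrt (det (g c (chart_inv c y)))) \<partial>lborel)"
      using U by (intro volume_measureD[OF vol c(1)]) auto
    also have "\<dots> \<le> (\<integral>\<^sup>+ y. ennreal K * indicator (cball (snd c x) r) y \<partial>lborel)"
    proof (rule nn_integral_mono)
      fix y
      show "indicator (snd c ` U) y * ennreal (sqrt (det (g c (chart_inv c y)))) \<le> ennreal K * indicator (cball (snd c x) r) y"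
      proof (cases "y \<in> snd c ` U")
        case True
        then have "y \<in> cball (snd c x) r"
          by (auto simp: U_def)
        then show ?thesis
          using K True by (simp add: ennreal_leI)
      qed simp
    qed
    also have "\<dots> = ennreal K * emeasure lborel (cball (snd c x) r)"
      by (subst nn_integral_cmult_indicator) auto
    also have "\<dots> < \<infinity>"
      using emeasure_bounded_finite[of "cball (snd c x) r"] by (simp add: ennreal_mult_less_top)
    finally show ?thesis
      using U by blast
  qed
  then obtain U where "\<forall>x. open (U x) \<and> x \<in> U x \<and> emeasure \<nu> (U x) < \<infinity>"
    by metis
  then have U: "open (U x)" "x \<in> U x" "emeasure \<nu> (U x) < \<infinity>" for x
    by blast+
  have U_sets: "U x \<in> sets \<nu>" for x
    using U(1) sets by simp
  obtain F where F: "finite F" "UNIV \<subseteq> (\<Union>x\<in>F. U x)"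
    by (rule compactE_image[OF cpt, of UNIV U]) (use U(1,2) in auto)
  have "emeasure \<nu> (space \<nu>) \<le> emeasure \<nu> (\<Union>x\<in>F. U x)"
    by (rule emeasure_mono[OF subset_trans[OF subset_UNIV F(2)] sets.finite_UN[OF F(1) U_sets]])
  also have "\<dots> \<le> (\<Sum>x\<in>F. emeasure \<nu> (U x))"
    by (rule emeasure_subadditive_finite[OF F(1) image_subsetI[OF U_sets]])
  also have "\<dots> < \<infinity>"
    using F(1) U(3) by (simp add: less_top[symmetric])
  finally show "emeasure \<nu> (space \<nu>) \<noteq> \<infinity>"
    by simp
qed

text \<open>In dimension two the determinant scales with a^2, so the area density scales with
  a.\<close>

lemma volume_measure_conformal:
  fixes A :: "('m::{t2_space,second_countable_topology}) chart set"
  assumes surface: "closed_oriented_surface A"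
    and g: "riemannian_metric A g" "riemannian_metric A g'"
    and vol: "volume_measure A g \<nu>" "volume_measure A g' \<nu>'"
    and a: "continuous_on UNIV a" "\<And>x. a x > 0" "\<And>c x. c \<in> A \<Longrightarrow> x \<in> cdom c \<Longrightarrow> g' c x = a x *\<^sub>R g c x"
  shows "\<nu>' = density \<nu> (\<lambda>x. ennreal (a x))"
proof -
  have sets: "sets \<nu> = sets borel" "sets \<nu>' = sets borel"
    using vol by (auto simp: volume_measure_def)
  have A: "oriented_atlas A"
    using surface by (simp add: closed_oriented_surface_def)
  obtain C where C: "finite C" "C \<subseteq> A" "(\<Union>c\<in>C. cdom c) = UNIV"
    using atlas_finite_cover[OF surface] .
  have am: "a \<in> borel_measurable borel"
    using a(1) by (rule borel_measurable_continuous_onI)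
  show ?thesis
  proof (rule measure_eqI_finite_open_cover[OF C(1,3)])
    show "open (cdom c)" if "c \<in> C" for c
      using A C(2) that by (auto simp: oriented_atlas_def is_chart_def)
    show "sets \<nu>' = sets borel" "sets (density \<nu> (\<lambda>x. ennreal (a x))) = sets borel"
      by (simp_all add: sets)
    fix c B assume cB: "c \<in> C" "B \<in> sets borel" "B \<subseteq> cdom c"
    have c: "c \<in> A" "is_chart c"
      using A C(2) cB(1) by (auto simp: oriented_atlas_def)
    have "emeasure (density \<nu> (\<lambda>x. ennreal (a x))) B = (\<integral>\<^sup>+ x. ennreal (a x) * indicator B x \<partial>\<nu>)"
      using am cB(2) by (intro emeasure_density) (auto simp: sets measurable_cong_sets[OF sets(1) refl])
    also have "\<dots> = (\<integral>\<^sup>+ x. indicator (cdom c) x * (ennreal (a x) * indicator B x) \<partial>\<nu>)"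
      using cB(3) by (intro nn_integral_cong) (auto simp: indicator_def)
    also have "\<dots> = (\<integral>\<^sup>+ y. indicator (cimg c) y * (ennreal (sqrt (det (g c (chart_inv c y)))) *
        (ennreal (a (chart_inv c y)) * indicator B (chart_inv c y))) \<partial>lborel)"
      using am cB(2) by (intro volume_measure_nn_integral[OF g(1) vol(1) c]) auto
    also have "\<dots> = (\<integral>\<^sup>+ y. indicator (snd c ` B) y * ennreal (sqrt (det (g' c (chart_inv c y)))) \<partial>lborel)"
    proof (rule nn_integral_cong)
      fix y
      have B: "y \<in> snd c ` B \<longleftrightarrow> y \<in> cimg c \<and> chart_inv c y \<in> B"
        using chart_inv_simps[OF c(2)] cB(3) by (auto simp: image_iff intro!: bexI[of _ "chart_inv c y"])
      have det: "sqrt (det (g' c x)) = sqrt (det (g c x)) * a x" if "x \<in> cdom c" for x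
      proof -
        have "det (g' c x) = det (g c x) * (a x)\<^sup>2"
          using a(3)[OF c(1) that] by (simp add: det_2 power2_eq_square algebra_simps)
        then show ?thesis
          using a(2)[of x] by (simp add: real_sqrt_mult less_imp_le)
      qed
      have "det (g c x) > 0" if "x \<in> cdom c" for x
        using posdef_2(3)[OF riemannian_metric_posdef[OF g(1) c(1) that]] .
      then show "indicator (cimg c) y * (ennreal (sqrt (det (g c (chart_inv c y)))) *
          (ennreal (a (chart_inv c y)) * indicator B (chart_inv c y))) =
          indicator (snd c ` B) y * ennreal (sqrt (det (g' c (chart_inv c y))))"
        using det[of "chart_inv c y"] chart_inv_simps(3)[OF c(2), of y] a(2)[of "chart_inv c y"] B
        by (auto simp: indicator_def ennreal_mult less_imp_le)
    qed
    also have "\<dots> = emeasure \<nu>' B"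
      by (rule volume_measureD[OF vol(2) c(1) cB(2,3), symmetric])
    finally show "emeasure \<nu>' B = emeasure (density \<nu> (\<lambda>x. ennreal (a x))) B" ..
  qed
qed

section \<open>Weak gradients of continuously differentiable functions\<close>

lemma
  fixes h :: "'a::euclidean_space \<Rightarrow> real"
  assumes V: "open V" and K: "compact K" "K \<subseteq> V" and h: "continuous_on V h" "\<And>y. y \<notin> K \<Longrightarrow> h y = 0"
  shows compact_support_continuous: "continuous_on UNIV h"
    and compact_support_integrable: "integrable lborel h"
proof -
  have "continuous_on (- K) h"
    using h(2) by (subst continuous_on_cong[where g = "\<lambda>_. 0"]) auto
  then have "continuous_on (V \<union> - K) h"
    using V K(1) h(1) by (intro continuous_on_open_Un) (auto simp: compact_imp_closed)
  moreover have "V \<union> - K = UNIV"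
    using K(2) by auto
  ultimately show "continuous_on UNIV h"
    by simp
  have "integrable lborel (\<lambda>y. indicator K y *\<^sub>R h y)"
    using K h(1) by (intro borel_integrable_compact) (auto intro: continuous_on_subset)
  moreover have "(\<lambda>y. indicator K y *\<^sub>R h y) = h"
  proof
    show "indicator K y *\<^sub>R h y = h y" for y
      by (cases "y \<in> K") (simp_all add: h(2))
  qed
  ultimately show "integrable lborel h"
    by simp
qed

text \<open>The difference quotients of \<open>k\<close> integrate to \<open>0\<close> by translation invariance.\<close>

lemma integral_directional_derivative_eq_0:
  fixes k :: "'a::euclidean_space \<Rightarrow> real"
  assumes K: "compact K" "\<And>y. y \<notin> K \<Longrightarrow> k y = 0"
    and k: "\<And>y. (k has_derivative D y) (at y)" and D: "continuous_on UNIV (\<lambda>y. D y e)"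
  shows "(LINT y|lborel. D y e) = 0"
proof -
  have D0: "D y e = 0" if "y \<notin> K" for y
  proof -
    have "((\<lambda>_. 0) has_derivative D y) (at y)"
      by (rule has_derivative_transform_within_open[OF k, of "- K"])
         (use K that in \<open>auto simp: compact_imp_closed\<close>)
    from has_derivative_unique[OF this has_derivative_const] show ?thesis
      by simp
  qed
  have kc: "continuous_on UNIV k"
    using k has_derivative_continuous continuous_at_imp_continuous_on by blast
  have k_int: "integrable lborel k"
    using K kc by (intro compact_support_integrable[of UNIV K]) auto
  have "bounded ((\<lambda>y. D y e) ` K)"
    by (intro compact_imp_bounded compact_continuous_image continuous_on_subset[OF D] K(1)) simp
  then obtain M0 where M0: "\<forall>z\<in>(\<lambda>y. D y e) ` K. norm z \<le> M0"
    unfolding bounded_iff by blast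
  define M where "M = max M0 0"
  have M: "\<bar>D y e\<bar> \<le> M" for y
  proof (cases "y \<in> K")
    case True
    from bspec[OF M0 imageI[OF this]] show ?thesis
      by (simp add: M_def)
  qed (simp add: D0 M_def)
  obtain R where "\<forall>y\<in>K. norm y \<le> R"
    using compact_imp_bounded[OF K(1)] unfolding bounded_iff by blast
  then have R: "K \<subseteq> cball 0 R"
    by auto
  define q where "q n y = (k ((1 / real (Suc n)) *\<^sub>R e + y) - k y) * real (Suc n)" for n y
  have deriv: "((\<lambda>h. k (y + h *\<^sub>R e)) has_real_derivative D (y + h *\<^sub>R e) e) (at h)" for y h
    by (rule has_real_derivative_along_line[OF k])
  \<comment> \<open>The steps have length at most that of \<open>e\<close>, so all quotients are
    supported in one ball of radius R + |e| and bounded by \<open>M\<close> there through the mean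
    value theorem.\<close>
  have "(\<lambda>n. LINT y|lborel. q n y) \<longlonglongrightarrow> (LINT y|lborel. D y e)"
  proof (rule integral_dominated_convergence[where w = "\<lambda>y. M * indicator (cball 0 (R + norm e)) y"])
    show "(\<lambda>y. D y e) \<in> borel_measurable lborel"
      using borel_measurable_continuous_onI[OF D] by simp
    show "q n \<in> borel_measurable lborel" for n
    proof -
      have "continuous_on UNIV (q n)"
        unfolding q_def by (intro continuous_intros continuous_on_compose2[OF kc]) auto
      then show ?thesis
        using borel_measurable_continuous_onI by simp
    qed
    show "integrable lborel (\<lambda>y. M * indicator (cball (0 :: 'a) (R + norm e)) y)"
      using borel_integrable_compact[of "cball (0 :: 'a) (R + norm e)" "\<lambda>_. 1 :: real"] by simp
    show "AE y in lborel. (\<lambda>n. q n y) \<longlonglongrightarrow> D y e"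
    proof (rule AE_I2)
      fix y
      have "((\<lambda>h. (k (y + h *\<^sub>R e) - k y) / h) \<longlongrightarrow> D y e) (at 0)"
        using deriv[of y 0] by (simp add: has_field_derivative_iff)
      then have "((\<lambda>h. (k (y + h *\<^sub>R e) - k y) / h) \<circ> (\<lambda>n. 1 / real (Suc n))) \<longlonglongrightarrow> D y e"
        unfolding tendsto_at_iff_sequentially
        by (elim allE[of _ "\<lambda>n. 1 / real (Suc n)"] impE) (use LIMSEQ_Suc[OF lim_1_over_n[where 'a = real]] in auto)
      then show "(\<lambda>n. q n y) \<longlonglongrightarrow> D y e"
        by (simp add: o_def q_def add.commute)
    qed
    show "AE y in lborel. norm (q n y) \<le> M * indicator (cball 0 (R + norm e)) y" for n
    proof (rule AE_I2)
      fix y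
      define h where "h = 1 / real (Suc n)"
      have h: "0 < h" "h \<le> 1"
        by (auto simp: h_def)
      show "norm (q n y) \<le> M * indicator (cball 0 (R + norm e)) y"
      proof (cases "y \<in> cball 0 (R + norm e)")
        case True
        obtain r where "k (y + h *\<^sub>R e) - k (y + 0 *\<^sub>R e) = (h - 0) * D (y + r *\<^sub>R e) e"
          using MVT2[OF h(1), of "\<lambda>h. k (y + h *\<^sub>R e)" "\<lambda>h. D (y + h *\<^sub>R e) e"] deriv by blast
        then have "q n y = D (y + r *\<^sub>R e) e"
          by (simp add: q_def h_def add.commute)
        then show ?thesis
          using True M by simp
      next
        case False
        have "norm y \<le> R" if "y \<in> K"
          using that R by auto
        then have "y \<notin> K"
          using False norm_ge_zero[of e] by fastforce
        moreover have "h *\<^sub>R e + y \<notin> K"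
        proof
          assume "h *\<^sub>R e + y \<in> K"
          then have "norm (h *\<^sub>R e + y) \<le> R"
            using R by auto
          moreover have "norm y \<le> norm (h *\<^sub>R e + y) + norm (h *\<^sub>R e)"
            using norm_triangle_ineq4[of "h *\<^sub>R e + y" "h *\<^sub>R e"] by simp
          moreover have "norm (h *\<^sub>R e) \<le> norm e"
            using h by (simp add: mult_left_le_one_le)
          ultimately show False
            using False by simp
        qed
        ultimately show ?thesis
          using False K(2) by (simp add: q_def h_def)
      qed
    qed
  qed
  moreover have "(LINT y|lborel. q n y) = 0" for n
  proof -
    define a where "a = (1 / real (Suc n)) *\<^sub>R e"
    have k_meas: "k \<in> borel_measurable borel"
      using kc by (rule borel_measurable_continuous_onI)
    have "(LINT y|lborel. k y) = (LINT y|distr lborel borel ((+) a). k y)"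
      using lborel_distr_plus[of a] by simp
    also have "\<dots> = (LINT y|lborel. k (a + y))"
      using k_meas by (intro integral_distr) auto
    finally have eq: "(LINT y|lborel. k (a + y)) = (LINT y|lborel. k y)" ..
    have "integrable (distr lborel borel ((+) a)) k"
      using lborel_distr_plus[of a] k_int by simp
    then have "integrable lborel (\<lambda>y. k (a + y))"
      using k_meas by (subst (asm) integrable_distr_eq) auto
    then show ?thesis
      using k_int eq unfolding q_def a_def[symmetric] by simp
  qed
  ultimately have "(\<lambda>n :: nat. 0 :: real) \<longlonglongrightarrow> (LINT y|lborel. D y e)"
    by simp
  from LIMSEQ_unique[OF this tendsto_const] show ?thesis .
qed

section \<open>The fundamental lemma of the calculus of variations\<close>

abbreviation test_function_on :: "('a::real_normed_vector) set \<Rightarrow> ('a \<Rightarrow> real) \<Rightarrow> bool" where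
  "test_function_on V \<eta> \<equiv> smooth_on UNIV \<eta> \<and> compact (closure {y. \<eta> y \<noteq> 0}) \<and> closure {y. \<eta> y \<noteq> 0} \<subseteq> V"

text \<open>Lebesgue differentiation: almost everywhere z(x) is the limit of its averages over small
  cubes with corner x, and all these averages vanish.\<close>

lemma integral_zero_on_boxes_imp_AE_zero:
  fixes z :: "'a::euclidean_space \<Rightarrow> real"
  assumes z: "integrable lborel z" and zero: "\<And>a b. (LINT y|lborel. indicator (box a b) y * z y) = 0"
  shows "AE y in lborel. z y = 0"
proof -
  have on: "z integrable_on cbox a b" for a b
    using integrable_on_lborel[OF z] integrable_on_subcbox by blast
  obtain N where N: "negligible N" and lim: "\<And>x e. x \<notin> N \<Longrightarrow> 0 < e \<Longrightarrow>
      \<exists>d>0. \<forall>h. 0 < h \<and> h < d \<longrightarrow> norm (integral (cbox x (x + h *\<^sub>R One)) z /\<^sub>R h ^ DIM('a) - z x) < e"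
    using integrable_ccontinuous_explicit[OF on] by blast
  have int0: "integral (cbox a b) z = 0" for a b
  proof -
    have "set_integrable lborel (box a b) z"
      unfolding set_integrable_def using z by (intro integrable_mult_indicator) auto
    then have "integral (box a b) z = (LINT y:box a b|lborel. z y)"
      by (rule set_borel_integral_eq_integral(2)[symmetric])
    also have "\<dots> = 0"
      using zero[of a b] by (simp add: set_lebesgue_integral_def)
    finally show ?thesis
      by (simp add: integral_open_interval)
  qed
  have "z x = 0" if xN: "x \<notin> N" for x
  proof (rule ccontr)
    assume "z x \<noteq> 0"
    then obtain d where d: "d > 0" "\<And>h. 0 < h \<Longrightarrow> h < d \<Longrightarrow>
        norm (integral (cbox x (x + h *\<^sub>R One)) z /\<^sub>R h ^ DIM('a) - z x) < \<bar>z x\<bar>"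
      using lim[OF xN, of "\<bar>z x\<bar>"] by auto
    from d(2)[of "d / 2"] d(1) show False
      by (simp add: int0)
  qed
  then have "{x. z x \<noteq> 0} \<subseteq> N"
    by auto
  then have "AE x in lebesgue. z x = 0"
    using N by (intro AE_I'[of N]) (auto simp: negligible_iff_null_sets)
  then show ?thesis
    by (simp add: AE_completion_iff)
qed

text \<open>Multiplication by a bump \<open>\<eta>\<close> that is nonzero exactly on an open box
  makes \<open>z\<close> globally integrable. Products of test functions are test functions, so z
  \<eta> is orthogonal to all box bumps, hence to indicators of boxes, hence zero almost everywhere.
  Countably many boxes exhaust \<open>V\<close>.\<close>

lemma fundamental_lemma_calculus_of_variations:
  fixes z :: "real^'n \<Rightarrow> real"
  assumes V: "open V"
    and z: "\<And>\<eta>. test_function_on V \<eta> \<Longrightarrow> integrable lborel (\<lambda>y. z y * \<eta> y)"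
      "\<And>\<eta>. test_function_on V \<eta> \<Longrightarrow> (LINT y|lborel. z y * \<eta> y) = 0"
  shows "AE y in lborel. y \<in> V \<longrightarrow> z y = 0"
proof -
  have on_box: "AE y in lborel. y \<in> cbox a b \<longrightarrow> z y = 0" if ab: "cbox a b \<subseteq> V" for a b
  proof -
    define \<eta> where "\<eta> = box_bump 1 a b"
    have \<eta>: "test_function_on V \<eta>"
      unfolding \<eta>_def using smooth_on_box_bump support_box_bump[of 1 a b] ab by auto
    have "AE y in lborel. z y * \<eta> y = 0"
    proof (rule integral_zero_on_boxes_imp_AE_zero)
      show int: "integrable lborel (\<lambda>y. z y * \<eta> y)"
        using z(1)[OF \<eta>] .
      \<comment> \<open>These boxes are arbitrary and may leave \<open>V\<close>; the factor
        \<open>\<eta>\<close> keeps the support of the product inside.\<close>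
      fix a' b' :: "real^'n"
      have bump_meas: "box_bump n a' b' \<in> borel_measurable lborel" for n
      proof -
        have "continuous_on UNIV (box_bump n a' b')"
          using smooth_on_box_bump[of n a' b'] unfolding smooth_on_def by (metis Ck_on.simps(1))
        then show ?thesis
          using borel_measurable_continuous_onI by simp
      qed
      have "(\<lambda>n. LINT y|lborel. box_bump (real n) a' b' y * (z y * \<eta> y)) \<longlonglongrightarrow>
          (LINT y|lborel. indicator (box a' b') y * (z y * \<eta> y))"
      proof (rule integral_dominated_convergence[where w = "\<lambda>y. norm (z y * \<eta> y)"])
        show "AE y in lborel. (\<lambda>n. box_bump (real n) a' b' y * (z y * \<eta> y)) \<longlonglongrightarrow>
            indicator (box a' b') y * (z y * \<eta> y)"
          by (intro AE_I2 tendsto_mult box_bump_tendsto_indicator tendsto_const)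
        show "AE y in lborel. norm (box_bump (real n) a' b' y * (z y * \<eta> y)) \<le> norm (z y * \<eta> y)" for n
          by (intro AE_I2) (simp add: abs_mult box_bump_bounds mult_left_le_one_le)
        show "(\<lambda>y. box_bump (real n) a' b' y * (z y * \<eta> y)) \<in> borel_measurable lborel" for n
          using borel_measurable_integrable[OF int] bump_meas[of "real n"] by measurable
      qed (use int borel_measurable_integrable[OF int] in auto)
      moreover have "(LINT y|lborel. box_bump (real n) a' b' y * (z y * \<eta> y)) = 0" for n
      proof -
        let ?\<eta> = "\<lambda>y. \<eta> y * box_bump (real n) a' b' y"
        have "smooth_on UNIV ?\<eta>"
          using \<eta> smooth_on_box_bump unfolding smooth_on_def by (blast intro: Ck_on_mult_UNIV)
        moreover have sub: "closure {y. ?\<eta> y \<noteq> 0} \<subseteq> closure {y. \<eta> y \<noteq> 0}"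
          by (intro closure_mono) auto
        moreover have "compact (closure {y. ?\<eta> y \<noteq> 0})"
          using compact_Int_closed[OF _ closed_closure, of "closure {y. \<eta> y \<noteq> 0}" "{y. ?\<eta> y \<noteq> 0}"] \<eta> sub
          by (simp add: inf.absorb2)
        ultimately have "test_function_on V ?\<eta>"
          using \<eta> by auto
        from z(2)[OF this] show ?thesis
          by (simp add: mult_ac)
      qed
      ultimately have "(\<lambda>n :: nat. 0 :: real) \<longlonglongrightarrow> (LINT y|lborel. indicator (box a' b') y * (z y * \<eta> y))"
        by simp
      from LIMSEQ_unique[OF this tendsto_const]
      show "(LINT y|lborel. indicator (box a' b') y * (z y * \<eta> y)) = 0" .
    qed
    \<comment> \<open>\<open>\<eta>\<close> vanishes on the boundary of the box and gives no
      information there, but the boundary is a null set.\<close>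
    moreover have "AE y in lborel. y \<notin> cbox a b - box a b"
    proof -
      have "AE y in lebesgue. y \<notin> cbox a b - box a b"
        using negligible_frontier_interval[of a b] by (intro AE_not_in) (simp add: negligible_iff_null_sets)
      then show ?thesis
        by (simp add: AE_completion_iff)
    qed
    ultimately show ?thesis
    proof eventually_elim
      case (elim y)
      then show ?case
        using box_bump_nonzero[of 1 a b y] by (auto simp: \<eta>_def)
    qed
  qed
  have "\<exists>\<D>. countable \<D> \<and> \<D> \<subseteq> Pow V \<and> (\<forall>X\<in>\<D>. \<exists>a b. X = cbox a b) \<and> \<Union>\<D> = V"
  proof (rule open_countable_Union_open_cbox[OF V])
    fix \<D> :: "(real^'n) set set"
    assume *: "countable \<D>" "\<D> \<subseteq> Pow V" "\<And>X. X \<in> \<D> \<Longrightarrow> \<exists>a b. X = cbox a b" "\<Union>\<D> = V"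
    show ?thesis
      by (intro exI[of _ \<D>] conjI ballI *)
  qed
  then obtain \<D> where \<D>: "countable \<D>" "\<D> \<subseteq> Pow V" "\<forall>X\<in>\<D>. \<exists>a b. X = cbox a b" "\<Union>\<D> = V"
    by (elim exE conjE)
  have "AE y in lborel. y \<in> X \<longrightarrow> z y = 0" if X: "X \<in> \<D>" for X
  proof -
    obtain a b where ab: "X = cbox a b"
      using bspec[OF \<D>(3) X] by (elim exE)
    have "X \<subseteq> V"
      using \<D>(2) X by (rule set_mp[THEN PowD])
    then show ?thesis
      unfolding ab by (rule on_box)
  qed
  then have "AE y in lborel. \<forall>X\<in>\<D>. y \<in> X \<longrightarrow> z y = 0"
    unfolding AE_ball_countable[OF \<D>(1)] by blast
  then show ?thesis
    by eventually_elim (use \<D>(4)[symmetric] in \<open>simp only: Union_iff, blast\<close>)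
qed

section \<open>Regularity of the metric, the differential and the gradient\<close>

lemma continuous_on_metric:
  assumes g: "riemannian_metric A g" and c: "c \<in> A" "is_chart c"
  shows "continuous_on (cdom c) (g c)"
proof -
  have "Ck_on 0 (cimg c) (g c \<circ> chart_inv c)"
    using g c unfolding riemannian_metric_def smooth_on_def by blast
  then have "continuous_on (cimg c) (g c \<circ> chart_inv c)"
    by simp
  from continuous_on_compose[OF continuous_on_chart(1)[OF c(2)] this]
  show ?thesis
    by (rule continuous_on_eq) (simp add: chart_inv_simps[OF c(2)])
qed

lemma continuous_on_matrix_inv_metric:
  assumes g: "riemannian_metric A g" and c: "c \<in> A" "is_chart c"
  shows "continuous_on (cdom c) (\<lambda>x. matrix_inv (g c x) $ i $ j)"
proof -
  have comp: "continuous_on (cdom c) (\<lambda>x. g c x $ k $ l)" for k l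
    by (intro continuous_intros continuous_on_metric[OF assms])
  have det: "continuous_on (cdom c) (\<lambda>x. det (g c x))"
    unfolding det_2 by (intro continuous_intros comp)
  have dn: "\<forall>x\<in>cdom c. det (g c x) \<noteq> 0"
    using posdef_2(3)[OF riemannian_metric_posdef[OF g c(1)]] by force
  have quot: "continuous_on (cdom c) (\<lambda>x. a * g c x $ k $ l / det (g c x))" for a k l
    using dn by (intro continuous_intros comp det)
  have m: "matrix_inv (g c x) $ 1 $ 1 = 1 * g c x $ 2 $ 2 / det (g c x)"
    "matrix_inv (g c x) $ 1 $ 2 = - 1 * g c x $ 1 $ 2 / det (g c x)"
    "matrix_inv (g c x) $ 2 $ 1 = - 1 * g c x $ 2 $ 1 / det (g c x)"
    "matrix_inv (g c x) $ 2 $ 2 = 1 * g c x $ 1 $ 1 / det (g c x)" if "x \<in> cdom c" for x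
    using dn that by (simp_all add: matrix_inv_2)
  have "continuous_on (cdom c) (\<lambda>x. matrix_inv (g c x) $ 1 $ 1)" "continuous_on (cdom c) (\<lambda>x. matrix_inv (g c x) $ 1 $ 2)"
    "continuous_on (cdom c) (\<lambda>x. matrix_inv (g c x) $ 2 $ 1)" "continuous_on (cdom c) (\<lambda>x. matrix_inv (g c x) $ 2 $ 2)"
    by (rule continuous_on_eq[OF quot m(1)[symmetric]] continuous_on_eq[OF quot m(2)[symmetric]]
        continuous_on_eq[OF quot m(3)[symmetric]] continuous_on_eq[OF quot m(4)[symmetric]], assumption)+
  then show ?thesis
    using exhaust_2[of i] exhaust_2[of j] by auto
qed

lemma continuous_on_pd:
  assumes A: "oriented_atlas A" and u: "C1_fun A u" and c: "c \<in> A"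
  shows "continuous_on (cdom c) (pd c i u)"
proof -
  have ch: "is_chart c" "open (cimg c)"
    using A c by (auto simp: oriented_atlas_def is_chart_def)
  have "continuous_on (cimg c) (\<lambda>y. frechet_derivative (u \<circ> chart_inv c) (at y within cimg c) (axis i 1))"
    using u c unfolding C1_fun_def Ck_on_1_iff by blast
  then have "continuous_on (cimg c) (\<lambda>y. frechet_derivative (u \<circ> chart_inv c) (at y) (axis i 1))"
    by (rule continuous_on_eq) (simp add: frechet_derivative_within_open[OF ch(2)])
  from continuous_on_compose[OF continuous_on_chart(1)[OF ch(1)] this]
  show ?thesis
    by (simp add: pd_def[abs_def] o_def)
qed

lemma C1_fun_continuous_on:
  assumes A: "oriented_atlas A" and u: "C1_fun A u" and c: "c \<in> A"
  shows "continuous_on (cimg c) (\<lambda>y. u (chart_inv c y))"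
proof -
  have "\<forall>x\<in>cimg c. (u \<circ> chart_inv c) differentiable (at x within cimg c)"
    using u c unfolding C1_fun_def Ck_on_1_iff by blast
  then have "continuous_on (cimg c) (u \<circ> chart_inv c)"
    unfolding continuous_on_eq_continuous_within using differentiable_imp_continuous_within by blast
  then show ?thesis
    by (simp add: o_def)
qed

lemma continuous_on_grad:
  assumes A: "oriented_atlas A" and g: "riemannian_metric A g" and u: "C1_fun A u" and c: "c \<in> A"
  shows "continuous_on (cdom c) (grad g u c)"
proof -
  have ch: "is_chart c"
    using A c by (auto simp: oriented_atlas_def)
  have "continuous_on (cdom c) (\<lambda>x. \<chi> i. \<Sum>j\<in>UNIV. matrix_inv (g c x) $ i $ j * pd c j u x)"
    by (intro continuous_on_vec_lambda continuous_intros continuous_on_matrix_inv_metric[OF g c ch] continuous_on_pd[OF A u c])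
  then show ?thesis
    by (simp add: grad_def[abs_def] matrix_vector_mult_def)
qed

section \<open>Weak and classical gradients\<close>

text \<open>Integration by parts: the product of \<open>u\<close> with a test function, extended by
  0, is C^1 with compact support in the plane, so its directional derivative has integral 0.\<close>

lemma has_weak_grad_grad:
  fixes A :: "('m::{t2_space,second_countable_topology}) chart set"
  assumes A: "oriented_atlas A" and g: "riemannian_metric A g" and u: "C1_fun A u"
  shows "has_weak_grad A g u (grad g u)"
  unfolding has_weak_grad_def Let_def
proof (intro conjI ballI allI impI)
  show "vector_field A (grad g u)"
    by (rule vector_field_grad[OF A g u])
  fix c assume c: "c \<in> A"
  then have ch: "is_chart c" "open (cdom c)" "open (cimg c)"
    using A by (auto simp: oriented_atlas_def is_chart_def)
  show "(\<lambda>x. indicator (cdom c) x *\<^sub>R grad g u c x) \<in> borel_measurable borel"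
    using ch(2) by (intro borel_measurable_continuous_on_indicator continuous_on_grad[OF A g u c]) auto
  fix i and \<eta> :: "real^2 \<Rightarrow> real"
  assume \<eta>: "test_function_on (cimg c) \<eta>"
  define K where "K = closure {y. \<eta> y \<noteq> 0}"
  have K: "compact K" "K \<subseteq> cimg c"
    using \<eta> by (auto simp: K_def)
  have \<eta>0: "\<eta> y = 0" if "y \<notin> K" for y
    using that closure_subset[of "{y. \<eta> y \<noteq> 0}"] by (auto simp: K_def)
  have "Ck_on 1 UNIV \<eta>"
    using \<eta> by (auto simp: smooth_on_def)
  then have \<eta>1: "\<And>y. \<eta> differentiable (at y)" "\<And>v. continuous_on UNIV (\<lambda>y. frechet_derivative \<eta> (at y) v)"
    by (auto simp: Ck_on_1_iff)
  have \<eta>_der: "(\<eta> has_derivative frechet_derivative \<eta> (at y)) (at y)" for y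
    using \<eta>1(1) by (simp add: frechet_derivative_works)
  have \<eta>_cont: "continuous_on UNIV \<eta>"
    using \<eta>1(1) by (simp add: differentiable_imp_continuous_within continuous_at_imp_continuous_on)
  have d\<eta>0: "frechet_derivative \<eta> (at y) v = 0" if "y \<notin> K" for y v
  proof -
    have "((\<lambda>_. 0) has_derivative frechet_derivative \<eta> (at y)) (at y)"
      by (rule has_derivative_transform_within_open[OF \<eta>_der, of "- K"])
         (use K \<eta>0 that in \<open>auto simp: compact_imp_closed\<close>)
    from has_derivative_unique[OF this has_derivative_const] show ?thesis
      by simp
  qed
  let ?e = "axis i 1 :: real^2"
  let ?u = "\<lambda>y. u (chart_inv c y)"
  let ?p = "\<lambda>y. pd c i u (chart_inv c y)"
  have metric: "(g c (chart_inv c y) *v grad g u c (chart_inv c y)) $ i = ?p y" if "y \<in> cimg c" for y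
    using metric_grad[of g c "chart_inv c y" u, OF riemannian_metric_posdef[OF g c chart_inv_simps(3)[OF ch(1) that]]]
    by (simp add: differential_def)
  have p_cont: "continuous_on (cimg c) ?p"
    using continuous_on_compose2[OF continuous_on_pd[OF A u c] continuous_on_chart(2)[OF ch(1)]]
      chart_inv_simps(3)[OF ch(1)] by blast
  have w_eq: "(\<lambda>y. (g c (chart_inv c y) *v grad g u c (chart_inv c y)) $ i * \<eta> y) = (\<lambda>y. ?p y * \<eta> y)"
  proof
    show "(g c (chart_inv c y) *v grad g u c (chart_inv c y)) $ i * \<eta> y = ?p y * \<eta> y" for y
      using metric[of y] \<eta>0[of y] K(2) by (cases "y \<in> cimg c") auto
  qed
  have u'_cont: "continuous_on (cimg c) (\<lambda>y. ?u y * frechet_derivative \<eta> (at y) ?e)"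
    by (intro continuous_intros C1_fun_continuous_on[OF A u c] continuous_on_subset[OF \<eta>1(2)]) auto
  have w_cont: "continuous_on (cimg c) (\<lambda>y. ?p y * \<eta> y)"
    by (intro continuous_intros p_cont continuous_on_subset[OF \<eta>_cont]) auto
  show u'_int: "integrable lborel (\<lambda>y. ?u y * frechet_derivative \<eta> (at y) ?e)"
    by (rule compact_support_integrable[OF ch(3) K u'_cont]) (simp add: d\<eta>0)
  have w_int: "integrable lborel (\<lambda>y. ?p y * \<eta> y)"
    by (rule compact_support_integrable[OF ch(3) K w_cont]) (simp add: \<eta>0)
  then show "integrable lborel (\<lambda>y. (g c (chart_inv c y) *v grad g u c (chart_inv c y)) $ i * \<eta> y)"
    by (simp only: w_eq)
  \<comment> \<open>The derivative of the product, set to 0 outside the chart image, where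
    \<open>chart_inv\<close> carries no information but the test function vanishes.\<close>
  define D where "D y v = (if y \<in> cimg c then ?u y * frechet_derivative \<eta> (at y) v +
      (differential c u (chart_inv c y) \<bullet> v) * \<eta> y else 0)" for y v
  have De: "D y ?e = ?u y * frechet_derivative \<eta> (at y) ?e + ?p y * \<eta> y" for y
  proof (cases "y \<in> cimg c")
    case False
    then have "y \<notin> K"
      using K(2) by auto
    then show ?thesis
      using False by (simp add: D_def \<eta>0 d\<eta>0)
  qed (simp add: D_def differential_def inner_axis)
  have "(LINT y|lborel. D y ?e) = 0"
  proof (rule integral_directional_derivative_eq_0[OF K(1), where k = "\<lambda>y. ?u y * \<eta> y"])
    show "?u y * \<eta> y = 0" if "y \<notin> K" for y
      using \<eta>0[OF that] by simp
    show "((\<lambda>y. ?u y * \<eta> y) has_derivative D y) (at y)" for y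
    proof (cases "y \<in> cimg c")
      case True
      have "(?u has_derivative (\<lambda>v. differential c u (chart_inv c y) \<bullet> v)) (at y)"
        using C1_fun_differentiable[OF A u c chart_inv_simps(3)[OF ch(1) True]]
        by (simp add: chart_inv_simps(2)[OF ch(1) True] o_def)
      from has_derivative_mult[OF this \<eta>_der] show ?thesis
        using True by (simp add: D_def[abs_def])
    next
      case False
      then have "y \<notin> K"
        using K(2) by auto
      have "((\<lambda>_. 0) has_derivative D y) (at y)"
        using False by (simp add: D_def[abs_def])
      then show ?thesis
        by (rule has_derivative_transform_within_open[where s = "- K"])
           (use K \<eta>0 \<open>y \<notin> K\<close> in \<open>auto simp: compact_imp_closed\<close>)
    qed
    show "continuous_on UNIV (\<lambda>y. D y ?e)"
      unfolding De
      by (rule compact_support_continuous[OF ch(3) K]) (simp_all add: continuous_on_add u'_cont w_cont \<eta>0 d\<eta>0)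
  qed
  then show "(LINT y|lborel. ?u y * frechet_derivative \<eta> (at y) ?e) =
      - (LINT y|lborel. (g c (chart_inv c y) *v grad g u c (chart_inv c y)) $ i * \<eta> y)"
    unfolding De w_eq using Bochner_Integration.integral_add[OF u'_int w_int] by simp
qed

text \<open>The test equations determine the covector gX component by component; the invertible
  metric then recovers X.\<close>

lemma has_weak_grad_unique_chart:
  assumes A: "oriented_atlas A" and g: "riemannian_metric A g"
    and X: "has_weak_grad A g u X" "has_weak_grad A g u Y" and c: "c \<in> A"
  shows "AE y in lborel. y \<in> cimg c \<longrightarrow> X c (chart_inv c y) = Y c (chart_inv c y)"
proof -
  have ch: "is_chart c" "open (cimg c)"
    using A c by (auto simp: oriented_atlas_def is_chart_def)
  define W where "W Z i y = (g c (chart_inv c y) *v Z c (chart_inv c y)) $ i" for Z i y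
  have W: "integrable lborel (\<lambda>y. W Z i y * \<eta> y)"
    "(LINT y|lborel. u (chart_inv c y) * frechet_derivative \<eta> (at y) (axis i 1)) = - (LINT y|lborel. W Z i y * \<eta> y)"
    if "has_weak_grad A g u Z" "test_function_on (cimg c) \<eta>" for Z i \<eta>
    using that c unfolding has_weak_grad_def Let_def W_def by blast+
  have "AE y in lborel. y \<in> cimg c \<longrightarrow> W X i y - W Y i y = 0" for i
  proof (rule fundamental_lemma_calculus_of_variations[OF ch(2)])
    fix \<eta> assume \<eta>: "test_function_on (cimg c) \<eta>"
    show "integrable lborel (\<lambda>y. (W X i y - W Y i y) * \<eta> y)"
      using Bochner_Integration.integrable_diff[OF W(1)[OF X(1) \<eta>, of i] W(1)[OF X(2) \<eta>, of i]]
      by (simp add: left_diff_distrib)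
    show "(LINT y|lborel. (W X i y - W Y i y) * \<eta> y) = 0"
      using Bochner_Integration.integral_diff[OF W(1)[OF X(1) \<eta>, of i] W(1)[OF X(2) \<eta>, of i]]
        W(2)[OF X(1) \<eta>, of i] W(2)[OF X(2) \<eta>, of i]
      by (simp add: left_diff_distrib)
  qed
  then have "AE y in lborel. \<forall>i\<in>UNIV. y \<in> cimg c \<longrightarrow> W X i y - W Y i y = 0"
    unfolding AE_ball_countable[OF countable_finite[OF finite]] by blast
  then show ?thesis
  proof eventually_elim
    case (elim y)
    show ?case
    proof
      assume y: "y \<in> cimg c"
      define x where "x = chart_inv c y"
      have "posdef (g c x)"
        unfolding x_def by (rule riemannian_metric_posdef[OF g c chart_inv_simps(3)[OF ch(1) y]])
      then have inv: "matrix_inv (g c x) ** g c x = mat 1"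
        by (intro matrix_inv_mult posdef_invertible)
      have "g c x *v X c x = g c x *v Y c x"
        using elim y by (simp add: vec_eq_iff W_def x_def)
      then have "matrix_inv (g c x) *v (g c x *v X c x) = matrix_inv (g c x) *v (g c x *v Y c x)"
        by simp
      then show "X c (chart_inv c y) = Y c (chart_inv c y)"
        by (simp add: matrix_vector_mul_assoc inv x_def[symmetric])
    qed
  qed
qed

text \<open>\<open>weak_grad\<close> is an arbitrary choice: the classical gradient shows that a
  choice exists, and uniqueness in charts compares the two. The exceptional set is assembled from a
  finite subatlas and serves for all charts simultaneously.\<close>

lemma weak_grad_eq_grad_AE:
  fixes A :: "('m::{t2_space,second_countable_topology}) chart set"
  assumes surface: "closed_oriented_surface A" and g: "riemannian_metric A g"
    and vol: "volume_measure A g \<nu>" and u: "C1_fun A u"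
  shows "AE x in \<nu>. \<forall>c\<in>A. x \<in> cdom c \<longrightarrow> weak_grad A g u c x = grad g u c x"
proof -
  have A: "oriented_atlas A"
    using surface by (simp add: closed_oriented_surface_def)
  have sets: "sets \<nu> = sets borel"
    using vol by (simp add: volume_measure_def)
  have Y: "has_weak_grad A g u (grad g u)"
    by (rule has_weak_grad_grad[OF A g u])
  then have X: "has_weak_grad A g u (weak_grad A g u)"
    unfolding weak_grad_def by (rule someI[where P = "has_weak_grad A g u"])
  obtain C where C: "finite C" "C \<subseteq> A" "(\<Union>c\<in>C. cdom c) = UNIV"
    using atlas_finite_cover[OF surface] .
  have on_chart: "AE x in \<nu>. x \<in> cdom c \<longrightarrow> weak_grad A g u c x = grad g u c x" if "c \<in> C" for c
  proof -
    have c: "c \<in> A" and ch: "is_chart c" "open (cdom c)"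
      using that C(2) A by (auto simp: oriented_atlas_def is_chart_def)
    \<comment> \<open>Cut off by the indicator, both fields are Borel on the whole surface, so the
      set of disagreement is Borel and the volume formula applies to it.\<close>
    define B where "B = {x. indicator (cdom c) x *\<^sub>R weak_grad A g u c x \<noteq> indicator (cdom c) x *\<^sub>R grad g u c x}"
    have "(\<lambda>x. indicator (cdom c) x *\<^sub>R Z c x) \<in> borel_measurable borel" if "has_weak_grad A g u Z" for Z
      using that c unfolding has_weak_grad_def by blast
    note meas = this[OF X] this[OF Y]
    have B: "B \<in> sets borel"
    proof -
      have "B = - {x \<in> space borel. indicator (cdom c) x *\<^sub>R weak_grad A g u c x = indicator (cdom c) x *\<^sub>R grad g u c x}"
        unfolding B_def space_borel by blast
      then show ?thesis
        using borel_comp[OF measurable_equality_set[OF meas]] by (simp only:)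
    qed
    have B_sub: "B \<subseteq> cdom c"
      by (auto simp: B_def indicator_def)
    have "AE y in lborel. y \<notin> snd c ` B"
      using has_weak_grad_unique_chart[OF A g X Y c]
    proof eventually_elim
      case (elim y)
      show ?case
      proof
        assume "y \<in> snd c ` B"
        then obtain x where x: "x \<in> B" "y = snd c x"
          by blast
        then have xc: "x \<in> cdom c"
          using B_sub by blast
        then have "weak_grad A g u c x = grad g u c x"
          using elim x(2) chart_inv_simps(1)[OF ch(1) xc] by auto
        then show False
          using x(1) by (simp add: B_def)
      qed
    qed
    then have "emeasure \<nu> B = 0"
      by (rule volume_measure_null[OF vol c B B_sub])
    then have "AE x in \<nu>. x \<notin> B"
      using B sets by (intro AE_not_in) (simp add: null_sets_def)
    then show ?thesis
      by eventually_elim (auto simp: B_def)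
  qed
  have "AE x in \<nu>. \<forall>c\<in>C. x \<in> cdom c \<longrightarrow> weak_grad A g u c x = grad g u c x"
    unfolding AE_ball_countable[OF countable_finite[OF C(1)]] using on_chart by blast
  then show ?thesis
  proof eventually_elim
    case (elim x)
    show ?case
    proof (intro ballI impI)
      \<comment> \<open>The atlas may be uncountable, so null sets cannot be united over all its
        charts; the transformation law passes from the finite subatlas to any other chart.\<close>
      fix c' assume c': "c' \<in> A" "x \<in> cdom c'"
      obtain c where c: "c \<in> C" "x \<in> cdom c"
        using C(3) by blast
      have "weak_grad A g u c' x = jacobian c c' x *v weak_grad A g u c x"
        using X c c' C(2) unfolding has_weak_grad_def vector_field_def by blast
      also have "\<dots> = grad g u c' x"
        using elim c grad_change_chart[OF A g u _ c'(1) c(2) c'(2)] C(2) by auto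
      finally show "weak_grad A g u c' x = grad g u c' x" .
    qed
  qed
qed

section \<open>The flow as a conformal deformation\<close>

lemma continuous_on_time_slice_compose:
  assumes "continuous_on S F" "\<And>x. x \<in> X \<Longrightarrow> (t, x) \<in> S"
  shows "continuous_on X (\<lambda>x. F (t, x))"
  by (rule continuous_on_compose2[OF assms(1)]) (use assms(2) in \<open>auto intro: continuous_intros\<close>)

lemma in_chart_Ck_1_continuous:
  assumes "oriented_atlas A" "\<And>c. c \<in> A \<Longrightarrow> Ck_on 1 ({0..<T} \<times> cimg c) (in_chart c u)"
  shows "spacetime_continuous T (u :: real \<Rightarrow> 'm::t2_space \<Rightarrow> real)"
proof (rule continuous_on_atlas[OF assms(1)])
  fix c assume c: "c \<in> A"
  then have ch: "is_chart c"
    using assms(1) by (auto simp: oriented_atlas_def)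
  have "Ck_on 0 ({0..<T} \<times> cimg c) (in_chart c u)"
    using assms(2)[OF c] unfolding One_nat_def by (rule Ck_on_Suc_imp)
  then show "continuous_on ({0..<T} \<times> cdom c) (\<lambda>(t, x). u t x)"
    by (intro in_chart_continuous_on_cdom[OF ch]) simp
qed

lemma in_chart_time_derivative_continuous:
  assumes A: "oriented_atlas A" and u: "\<And>c. c \<in> A \<Longrightarrow> Ck_on 1 ({0..<T} \<times> cimg c) (in_chart c u)"
    and u': "\<And>t x. t \<in> {0..<T} \<Longrightarrow> ((\<lambda>s. u s x) has_real_derivative u' t x) (at t within {0..<T})"
  shows "spacetime_continuous T (u' :: real \<Rightarrow> 'm::t2_space \<Rightarrow> real)"
proof (rule continuous_on_atlas[OF A])
  fix c assume c: "c \<in> A"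
  then have ch: "is_chart c"
    using A by (auto simp: oriented_atlas_def)
  show "continuous_on ({0..<T} \<times> cdom c) (\<lambda>(t, x). u' t x)"
    using u' by (intro continuous_on_in_chart_time_derivative[OF ch u[OF c]])
      (simp add: has_real_derivative_iff_has_vector_derivative)
qed

lemma in_chart_C1_fun:
  assumes A: "oriented_atlas A" and u: "\<And>c. c \<in> A \<Longrightarrow> Ck_on 1 ({0..<T} \<times> cimg c) (in_chart c u)"
    and t: "t \<in> {0..<T}"
  shows "C1_fun A (u t)"
  unfolding C1_fun_def Ck_on_1_iff
proof (intro ballI conjI allI)
  fix c assume c: "c \<in> A"
  then have ch: "is_chart c" "open (cimg c)"
    using A by (auto simp: oriented_atlas_def is_chart_def)
  have D: "((u t \<circ> chart_inv c) has_derivative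
      (\<lambda>v. frechet_derivative (in_chart c u) (at (t, y) within {0..<T} \<times> cimg c) (0, v))) (at y)"
    if y: "y \<in> cimg c" for y
    using in_chart_space_derivative[OF ch(1) u[OF c] t chart_inv_simps(3)[OF ch(1) y]]
    unfolding chart_inv_simps(2)[OF ch(1) y] .
  show "(u t \<circ> chart_inv c) differentiable (at y within cimg c)" if "y \<in> cimg c" for y
    using D[OF that] unfolding at_within_open[OF that ch(2)] differentiable_def by blast
  fix v
  have "continuous_on ({0..<T} \<times> cimg c)
      (\<lambda>z. frechet_derivative (in_chart c u) (at z within {0..<T} \<times> cimg c) (0, v))"
    using u[OF c] unfolding Ck_on_1_iff by blast
  then have "continuous_on (cimg c)
      (\<lambda>y. frechet_derivative (in_chart c u) (at (t, y) within {0..<T} \<times> cimg c) (0, v))"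
    by (rule continuous_on_time_slice_compose) (use t in auto)
  then show "continuous_on (cimg c) (\<lambda>y. frechet_derivative (u t \<circ> chart_inv c) (at y within cimg c) v)"
    by (rule continuous_on_eq)
       (simp add: at_within_open[OF _ ch(2)] frechet_derivative_at[OF D, symmetric])
qed

text \<open>\<open>scalar_curv\<close> is evaluated in the chart \<open>chart_at A x\<close>, so the
  surface identity for the Ricci tensor is applied in that chart and gives -2 (R/2) + 2 \<rho> R as
  factor. Congruence with the time-independent Jacobian carries the equation to any other
  chart.\<close>

lemma ricci_bourguignon_conformal:
  fixes A :: "('m::{t2_space,second_countable_topology}) chart set"
  assumes A: "oriented_atlas A" and flow: "ricci_bourguignon_flow A \<rho> T g0 g"
    and c: "c \<in> A" "x \<in> cdom c" and t: "t \<in> {0..<T}"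
  shows "((\<lambda>s. g s c x) has_vector_derivative (- (1 - 2 * \<rho>) * scalar_curv A (g t) x) *\<^sub>R g t c x) (at t within {0..<T})"
proof -
  define c0 where "c0 = chart_at A x"
  have c0: "c0 \<in> A" "x \<in> cdom c0" "is_chart c0"
    unfolding c0_def by (rule chart_at[OF A])+
  have metric: "riemannian_metric A (g s)" if "s \<in> {0..<T}" for s
    using flow that unfolding ricci_bourguignon_flow_def by blast
  have "ricci (g t) c0 x = (scalar_curv A (g t) x / 2) *\<^sub>R g t c0 x"
    unfolding scalar_curv_def Let_def c0_def[symmetric]
  proof (rule ricci_surface[OF c0(3) _ _ c0(2)])
    show "smooth_on (cimg c0) (g t c0 \<circ> chart_inv c0)"
      using metric[OF t] c0(1) unfolding riemannian_metric_def by blast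
    show "posdef (g t c0 y)" if "y \<in> cdom c0" for y
      by (rule riemannian_metric_posdef[OF metric[OF t] c0(1) that])
  qed
  moreover have "((\<lambda>s. g s c0 x) has_vector_derivative
      (- 2 *\<^sub>R ricci (g t) c0 x + (2 * \<rho> * scalar_curv A (g t) x) *\<^sub>R g t c0 x)) (at t within {0..<T})"
    using flow c0 t unfolding ricci_bourguignon_flow_def by blast
  ultimately have d0: "((\<lambda>s. g s c0 x) has_vector_derivative
      (- (1 - 2 * \<rho>) * scalar_curv A (g t) x) *\<^sub>R g t c0 x) (at t within {0..<T})"
    by (simp add: scaleR_left_distrib[symmetric] algebra_simps del: scaleR_left_distrib)
  define J where "J = jacobian c c0 x"
  have trans: "g s c x = transpose J ** g s c0 x ** J" if "s \<in> {0..<T}" for s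
    using metric[OF that] c c0 unfolding riemannian_metric_def J_def by blast
  have lin: "linear (\<lambda>M. transpose J ** M ** J)"
    by (rule linearI) (simp_all add: vec_eq_iff forall_2 matrix_matrix_mult_def sum_2 algebra_simps)
  then have "bounded_linear (\<lambda>M. transpose J ** M ** J)"
    by (simp add: linear_conv_bounded_linear)
  from bounded_linear.has_vector_derivative[OF this d0]
  have "((\<lambda>s. transpose J ** g s c0 x ** J) has_vector_derivative
      transpose J ** ((- (1 - 2 * \<rho>) * scalar_curv A (g t) x) *\<^sub>R g t c0 x) ** J) (at t within {0..<T})" .
  then have "((\<lambda>s. transpose J ** g s c0 x ** J) has_vector_derivative
      (- (1 - 2 * \<rho>) * scalar_curv A (g t) x) *\<^sub>R g t c x) (at t within {0..<T})"
    unfolding trans[OF t] linear_cmul[OF lin] .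
  then show ?thesis
    by (rule has_vector_derivative_transform[OF t, rotated]) (rule trans)
qed

text \<open>Each entry of the metric solves y' = h y in time, and so does the area density, because
  in dimension two the determinant has derivative 2 h det g. Quotients of solutions are constant, so
  \<open>a\<close> is a ratio of area densities and no exponential of a time integral of
  \<open>h\<close> is formed.\<close>

lemma conformal_flow_integrate:
  fixes A :: "('m::{t2_space,second_countable_topology}) chart set"
  assumes A: "oriented_atlas A"
    and metric: "\<And>t. t \<in> {0..<T} \<Longrightarrow> riemannian_metric A (g t)"
    and smooth: "\<And>c. c \<in> A \<Longrightarrow> smooth_on ({0..<T} \<times> cimg c) (in_chart c (\<lambda>t. g t c))"
    and flow: "\<And>c x t. c \<in> A \<Longrightarrow> x \<in> cdom c \<Longrightarrow> t \<in> {0..<T} \<Longrightarrow>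
      ((\<lambda>s. g s c x) has_vector_derivative h t x *\<^sub>R g t c x) (at t within {0..<T})"
    and t0: "t\<^sub>0 \<in> {0..<T}"
  obtains a where "spacetime_continuous T a" "spacetime_continuous T h" "\<And>t x. t \<in> {0..<T} \<Longrightarrow> a t x > 0"
    "\<And>t x. t \<in> {0..<T} \<Longrightarrow> ((\<lambda>s. a s x) has_real_derivative h t x * a t x) (at t within {0..<T})"
    "\<And>c t x. c \<in> A \<Longrightarrow> x \<in> cdom c \<Longrightarrow> t \<in> {0..<T} \<Longrightarrow> g t c x = a t x *\<^sub>R g t\<^sub>0 c x"
    "\<And>x. a t\<^sub>0 x = 1"
proof -
  define d where "d t x = sqrt (det (g t (chart_at A x) x))" for t x
  define a where "a t x = d t x / d t\<^sub>0 x" for t x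
  have pos: "posdef (g t c x)" if "c \<in> A" "x \<in> cdom c" "t \<in> {0..<T}" for c t x
    by (rule riemannian_metric_posdef[OF metric[OF that(3)] that(1,2)])
  have entry: "((\<lambda>s. g s c x $ i $ j) has_real_derivative h t x * g t c x $ i $ j) (at t within {0..<T})"
    if "c \<in> A" "x \<in> cdom c" "t \<in> {0..<T}" for c x t i j
  proof -
    have "bounded_linear (\<lambda>M::real^2^2. M $ i $ j)"
      by (intro bounded_linear_compose[OF bounded_linear_vec_nth] bounded_linear_vec_nth)
    from bounded_linear.has_vector_derivative[OF this flow[OF that]] show ?thesis
      by (simp add: has_real_derivative_iff_has_vector_derivative)
  qed
  have d_pos: "d t x > 0" if "t \<in> {0..<T}" for t x
    using posdef_2(3)[OF pos[OF chart_at(1,2)[OF A] that]] by (simp add: d_def)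
  have d_der: "((\<lambda>s. d s x) has_real_derivative h t x * d t x) (at t within {0..<T})" if t: "t \<in> {0..<T}" for t x
  proof -
    note e = entry[OF chart_at(1,2)[OF A] t, of x]
    let ?G = "g t (chart_at A x) x"
    have dt: "det ?G > 0"
      using posdef_2(3)[OF pos[OF chart_at(1,2)[OF A] t]] .
    have "((\<lambda>s. det (g s (chart_at A x) x)) has_real_derivative 2 * h t x * det ?G) (at t within {0..<T})"
      unfolding det_2 by (auto intro!: derivative_eq_intros e simp: algebra_simps)
    from DERIV_chain2[OF DERIV_real_sqrt[OF dt] this]
    have "((\<lambda>s. sqrt (det (g s (chart_at A x) x))) has_real_derivative
        inverse (sqrt (det ?G)) / 2 * (2 * h t x * det ?G)) (at t within {0..<T})" .
    moreover have "inverse (sqrt (det ?G)) / 2 * (2 * h t x * det ?G) = h t x * sqrt (det ?G)"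
      using dt real_sqrt_mult_self[of "det ?G"] by (simp add: field_simps)
    ultimately show ?thesis
      unfolding d_def by (simp only:)
  qed
  have a_pos: "a t x > 0" if "t \<in> {0..<T}" for t x
    using d_pos[OF that] d_pos[OF t0] by (simp add: a_def)
  have a_der: "((\<lambda>s. a s x) has_real_derivative h t x * a t x) (at t within {0..<T})" if "t \<in> {0..<T}" for t x
    unfolding a_def using DERIV_cdivide[OF d_der[OF that]] by simp
  have conf0: "g t (chart_at A x) x = a t x *\<^sub>R g t\<^sub>0 (chart_at A x) x" if t: "t \<in> {0..<T}" for t x
  proof -
    have "g t (chart_at A x) x $ i $ j = a t x * g t\<^sub>0 (chart_at A x) x $ i $ j" for i j
    proof -
      \<comment> \<open>Numerator and denominator have the same logarithmic derivative
        \<open>h\<close>, so the quotient rule gives 0.\<close>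
      have "((\<lambda>s. g s (chart_at A x) x $ i $ j / d s x) has_real_derivative 0) (at s within {0..<T})"
        if s: "s \<in> {0..<T}" for s
        using DERIV_divide[OF entry[OF chart_at(1,2)[OF A] s, of x i j] d_der[OF s, of x]] d_pos[OF s, of x] by simp
      then obtain k where k: "\<forall>s\<in>{0..<T}. g s (chart_at A x) x $ i $ j / d s x = k"
        using has_field_derivative_zero_constant[of "{0..<T}"] by blast
      have "g t (chart_at A x) x $ i $ j / d t x = g t\<^sub>0 (chart_at A x) x $ i $ j / d t\<^sub>0 x"
        using k t t0 by simp
      then show ?thesis
        using d_pos[OF t, of x] d_pos[OF t0, of x] by (simp add: a_def field_simps)
    qed
    then show ?thesis
      by (simp add: vec_eq_iff)
  qed
  have conf: "g t c x = a t x *\<^sub>R g t\<^sub>0 c x" if c: "c \<in> A" "x \<in> cdom c" and t: "t \<in> {0..<T}" for c t x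
  proof -
    define J where "J = jacobian c (chart_at A x) x"
    have trans: "g s c x = transpose J ** g s (chart_at A x) x ** J" if "s \<in> {0..<T}" for s
      using metric[OF that] c chart_at(1,2)[OF A] unfolding riemannian_metric_def J_def by blast
    show ?thesis
      unfolding trans[OF t] trans[OF t0] conf0[OF t, of x] by (simp add: matrix_scalar_ac scalar_matrix_assoc)
  qed
  have entry_pos: "g t c x $ 1 $ 1 > 0" if "c \<in> A" "x \<in> cdom c" "t \<in> {0..<T}" for c t x
    by (rule posdef_2(2)[OF pos[OF that]])
  have C1: "Ck_on 1 ({0..<T} \<times> cimg c) (in_chart c (\<lambda>t. g t c))" if "c \<in> A" for c
    using smooth[OF that] by (simp add: smooth_on_def)
  have g_cont: "continuous_on ({0..<T} \<times> cdom c) (\<lambda>(t, x). g t c x)" if c: "c \<in> A" for c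
  proof (rule in_chart_continuous_on_cdom)
    show "is_chart c"
      using A c by (auto simp: oriented_atlas_def)
    have "Ck_on 0 ({0..<T} \<times> cimg c) (in_chart c (\<lambda>t. g t c))"
      using smooth[OF c] unfolding smooth_on_def by blast
    then show "continuous_on ({0..<T} \<times> cimg c) (in_chart c (\<lambda>t. g t c))"
      by simp
  qed
  have comp: "continuous_on S (\<lambda>p. F (fst p) (snd p) $ 1 $ 1)"
    if "continuous_on S (\<lambda>(t, x). F t x)" for S and F :: "real \<Rightarrow> 'm \<Rightarrow> real^2^2"
    using that by (intro continuous_intros) (simp add: case_prod_unfold)
  have "spacetime_continuous T a"
  proof (rule continuous_on_atlas[OF A])
    fix c assume c: "c \<in> A"
    have "continuous_on ({0..<T} \<times> cdom c) (\<lambda>p. (\<lambda>(t, x). g t c x) (t\<^sub>0, snd p))"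
      by (rule continuous_on_compose2[OF g_cont[OF c]]) (use t0 in \<open>auto intro!: continuous_intros\<close>)
    then have "continuous_on ({0..<T} \<times> cdom c) (\<lambda>(t, x). g t\<^sub>0 c x)"
      by (simp add: case_prod_unfold)
    \<comment> \<open>In each chart \<open>a\<close> is a ratio of first diagonal entries, which are
      positive; this replaces the definition through \<open>chart_at\<close>, which does not vary
      continuously.\<close>
    from continuous_on_divide[OF comp[OF g_cont[OF c]] comp[OF this]]
    have "continuous_on ({0..<T} \<times> cdom c) (\<lambda>p. g (fst p) c (snd p) $ 1 $ 1 / g t\<^sub>0 c (snd p) $ 1 $ 1)"
      using entry_pos[OF c _ t0] by fastforce
    then show "continuous_on ({0..<T} \<times> cdom c) (\<lambda>(t, x). a t x)"
    proof (rule continuous_on_eq)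
      fix p assume "p \<in> {0..<T} \<times> cdom c"
      then have p: "fst p \<in> {0..<T}" "snd p \<in> cdom c"
        by auto
      show "g (fst p) c (snd p) $ 1 $ 1 / g t\<^sub>0 c (snd p) $ 1 $ 1 = (case p of (t, x) \<Rightarrow> a t x)"
        using entry_pos[OF c p(2) t0] by (simp add: conf[OF c p(2,1)] case_prod_unfold)
    qed
  qed
  moreover have "spacetime_continuous T h"
  proof (rule continuous_on_atlas[OF A])
    fix c assume c: "c \<in> A"
    then have ch: "is_chart c"
      using A by (auto simp: oriented_atlas_def)
    have "continuous_on ({0..<T} \<times> cdom c) (\<lambda>(t, x). h t x *\<^sub>R g t c x)"
      by (rule continuous_on_in_chart_time_derivative[OF ch C1[OF c]]) (rule flow[OF c])
    \<comment> \<open>Likewise \<open>h\<close> is the time derivative of the first diagonal entry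
      divided by that entry, so its continuity follows from the C^1 regularity of the
      metric.\<close>
    from continuous_on_divide[OF comp[OF this] comp[OF g_cont[OF c]]]
    have "continuous_on ({0..<T} \<times> cdom c)
        (\<lambda>p. (h (fst p) (snd p) *\<^sub>R g (fst p) c (snd p)) $ 1 $ 1 / g (fst p) c (snd p) $ 1 $ 1)"
      using entry_pos[OF c] by fastforce
    then show "continuous_on ({0..<T} \<times> cdom c) (\<lambda>(t, x). h t x)"
    proof (rule continuous_on_eq)
      fix p assume "p \<in> {0..<T} \<times> cdom c"
      then have p: "fst p \<in> {0..<T}" "snd p \<in> cdom c"
        by auto
      show "(h (fst p) (snd p) *\<^sub>R g (fst p) c (snd p)) $ 1 $ 1 / g (fst p) c (snd p) $ 1 $ 1 = (case p of (t, x) \<Rightarrow> h t x)"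
        using entry_pos[OF c p(2,1)] by (simp add: case_prod_unfold)
    qed
  qed
  moreover have "a t\<^sub>0 x = 1" for x
    using d_pos[OF t0, of x] by (simp add: a_def)
  ultimately show ?thesis
    using a_pos a_der conf by (intro that[of a]) auto
qed

section \<open>Products of time-dependent gradients in a fixed metric\<close>

lemma cometric_expand:
  "cometric g u v c x = (\<Sum>i\<in>UNIV. (\<Sum>j\<in>UNIV. matrix_inv (g c x) $ i $ j * pd c j u x) * pd c i v x)"
  by (simp add: cometric_def grad_altdef inner_vec_def matrix_vector_mult_def differential_def)

lemma cometric_commute:
  assumes "posdef (g c x)"
  shows "cometric g u v c x = cometric g v u c x"
  using posdef_matrix_inv[OF assms] inner_symmetric_matrix[of "matrix_inv (g c x)" "differential c u x" "differential c v x"]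
  unfolding cometric_def grad_altdef posdef_def by (simp add: inner_commute)

lemma cometric_spacetime_continuous:
  fixes A :: "('m::{t2_space,second_countable_topology}) chart set"
  assumes A: "oriented_atlas A" and g: "riemannian_metric A g"
    and u: "\<And>c. c \<in> A \<Longrightarrow> Ck_on 1 ({0..<T} \<times> cimg c) (in_chart c u)"
    and v: "\<And>c. c \<in> A \<Longrightarrow> Ck_on 1 ({0..<T} \<times> cimg c) (in_chart c v)"
  shows "spacetime_continuous T (\<lambda>t x. cometric g (u t) (v t) (chart_at A x) x)"
proof (rule continuous_on_atlas[OF A])
  fix c assume c: "c \<in> A"
  then have ch: "is_chart c"
    using A by (auto simp: oriented_atlas_def)
  have pd: "continuous_on ({0..<T} \<times> cdom c) (\<lambda>p. pd c i (w (fst p)) (snd p))"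
    if "Ck_on 1 ({0..<T} \<times> cimg c) (in_chart c w)" for w i
    using continuous_on_in_chart_pd[OF ch that] by (simp add: case_prod_unfold)
  have inv: "continuous_on ({0..<T} \<times> cdom c) (\<lambda>p. matrix_inv (g c (snd p)) $ i $ j)" for i j
    by (rule continuous_on_compose2[OF continuous_on_matrix_inv_metric[OF g c ch]]) (auto intro: continuous_intros)
  have "continuous_on ({0..<T} \<times> cdom c) (\<lambda>p. cometric g (u (fst p)) (v (fst p)) c (snd p))"
    unfolding cometric_expand by (intro continuous_intros inv pd u[OF c] v[OF c])
  then show "continuous_on ({0..<T} \<times> cdom c) (\<lambda>(t, x). cometric g (u t) (v t) (chart_at A x) x)"
  proof (rule continuous_on_eq)
    fix p assume "p \<in> {0..<T} \<times> cdom c"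
    then have p: "fst p \<in> {0..<T}" "snd p \<in> cdom c"
      by auto
    have "cometric g (u (fst p)) (v (fst p)) c (snd p) = cometric g (u (fst p)) (v (fst p)) (chart_at A (snd p)) (snd p)"
      using p in_chart_C1_fun[OF A u p(1)] in_chart_C1_fun[OF A v p(1)]
      by (intro cometric_change_chart[OF A g] c chart_at[OF A])
    then show "cometric g (u (fst p)) (v (fst p)) c (snd p) = (case p of (t, x) \<Rightarrow> cometric g (u t) (v t) (chart_at A x) x)"
      by (simp add: case_prod_unfold)
  qed
qed

text \<open>The metric is frozen, so only the differentials vary with time; symmetry of the inverse
  metric merges the two product-rule terms.\<close>

lemma cometric_time_derivative:
  assumes c: "is_chart c" "x \<in> cdom c" and pos: "posdef (g c x)"
    and u: "Ck_on 1 ({0..<T} \<times> cimg c) (in_chart c u)"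
    and v: "Ck_on 1 ({0..<T} \<times> cimg c) (in_chart c v)"
    and uv: "\<And>t x. t \<in> {0..<T} \<Longrightarrow> x \<in> cdom c \<Longrightarrow>
      ((\<lambda>s. u s x) has_real_derivative v t x) (at t within {0..<T})"
    and t: "t \<in> {0..<T}"
  shows "((\<lambda>s. cometric g (u s) (u s) c x) has_real_derivative 2 * cometric g (u t) (v t) c x) (at t within {0..<T})"
proof -
  have "((\<lambda>s. cometric g (u s) (u s) c x) has_real_derivative
      cometric g (v t) (u t) c x + cometric g (u t) (v t) c x) (at t within {0..<T})"
    unfolding cometric_expand sum_2
    by (auto intro!: derivative_eq_intros pd_time_derivative[OF c(1) u v uv t c(2)] simp: algebra_simps)
  then show ?thesis
    by (simp add: cometric_commute[of g c x "v t", OF pos])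
qed

section \<open>The eigenvalue equation on continuously differentiable functions\<close>

text \<open>\<open>chart_at\<close> selects charts without any regularity in the point, so
  measurability is checked on a finite cover by fixed charts.\<close>

lemma borel_measurable_atlas:
  fixes A :: "('m::{t2_space,second_countable_topology}) chart set" and F :: "'m \<Rightarrow> real"
  assumes surface: "closed_oriented_surface A"
    and F: "\<And>c. c \<in> A \<Longrightarrow> G c \<in> borel_measurable borel" "\<And>c x. c \<in> A \<Longrightarrow> x \<in> cdom c \<Longrightarrow> F x = G c x"
  shows "F \<in> borel_measurable borel"
proof -
  obtain C where C: "finite C" "C \<subseteq> A" "(\<Union>c\<in>C. cdom c) = UNIV"
    using atlas_finite_cover[OF surface] .
  show ?thesis
  proof (rule measurable_piecewise_restrict[of "cdom ` C"])
    show "countable (cdom ` C)"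
      using C(1) by (simp add: countable_finite)
    show "space borel \<subseteq> \<Union> (cdom ` C)"
      using C(3) by simp
    fix U assume "U \<in> cdom ` C"
    then obtain c where c: "c \<in> A" "U = cdom c"
      using C(2) by blast
    have "open (cdom c)"
      using surface c(1) by (auto simp: closed_oriented_surface_def oriented_atlas_def is_chart_def)
    then show "U \<inter> space borel \<in> sets borel"
      by (simp add: c(2))
    have "G c \<in> borel_measurable (restrict_space borel U)"
      using F(1)[OF c(1)] by (rule measurable_restrict_space1)
    then show "F \<in> borel_measurable (restrict_space borel U)"
      by (rule measurable_cong[THEN iffD2, rotated]) (simp add: c(2) F(2)[OF c(1)] space_restrict_space)
  qed
qed

lemma borel_measurable_inner_vector_field:
  fixes A :: "('m::{t2_space,second_countable_topology}) chart set"
  assumes surface: "closed_oriented_surface A" and X: "vector_field A X"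
    and meas: "\<And>c. c \<in> A \<Longrightarrow> (\<lambda>x. indicator (cdom c) x *\<^sub>R X c x) \<in> borel_measurable borel"
    and v: "C1_fun A v"
  shows "(\<lambda>x. X (chart_at A x) x \<bullet> differential (chart_at A x) v x) \<in> borel_measurable borel"
proof (rule borel_measurable_atlas[OF surface])
  have A: "oriented_atlas A"
    using surface by (simp add: closed_oriented_surface_def)
  fix c assume c: "c \<in> A"
  then have "open (cdom c)"
    using A by (auto simp: oriented_atlas_def is_chart_def)
  moreover have "continuous_on (cdom c) (differential c v)"
    unfolding differential_def[abs_def] by (intro continuous_on_vec_lambda continuous_on_pd[OF A v c])
  ultimately have "(\<lambda>x. indicator (cdom c) x *\<^sub>R differential c v x) \<in> borel_measurable borel"
    by (intro borel_measurable_continuous_on_indicator) auto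
  with meas[OF c]
  show "(\<lambda>x. (indicator (cdom c) x *\<^sub>R X c x) \<bullet> (indicator (cdom c) x *\<^sub>R differential c v x)) \<in> borel_measurable borel"
    by (rule borel_measurable_inner)
  fix x assume x: "x \<in> cdom c"
  then show "X (chart_at A x) x \<bullet> differential (chart_at A x) v x =
      (indicator (cdom c) x *\<^sub>R X c x) \<bullet> (indicator (cdom c) x *\<^sub>R differential c v x)"
    using vector_field_inner_change_chart[OF A X v chart_at(1)[OF A] c chart_at(2)[OF A] x] by simp
qed

lemma metric_norm_change_chart:
  assumes g: "riemannian_metric A g" and X: "vector_field A X"
    and c: "c \<in> A" "c' \<in> A" and x: "x \<in> cdom c" "x \<in> cdom c'"
  shows "X c x \<bullet> (g c x *v X c x) = X c' x \<bullet> (g c' x *v X c' x)"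
proof -
  define J where "J = jacobian c c' x"
  have "g c x = transpose J ** g c' x ** J" "X c' x = J *v X c x"
    using g X c x unfolding riemannian_metric_def vector_field_def J_def by blast+
  then have "g c x *v X c x = transpose J *v (g c' x *v X c' x)"
    by (simp only: matrix_vector_mul_assoc matrix_mul_assoc)
  then show ?thesis
    using dot_lmul_matrix[of "g c' x *v X c' x" J "X c x"] \<open>X c' x = J *v X c x\<close>
    by (simp add: inner_commute)
qed

lemma borel_measurable_vnorm:
  fixes A :: "('m::{t2_space,second_countable_topology}) chart set"
  assumes surface: "closed_oriented_surface A" and g: "riemannian_metric A g" and X: "vector_field A X"
    and meas: "\<And>c. c \<in> A \<Longrightarrow> (\<lambda>x. indicator (cdom c) x *\<^sub>R X c x) \<in> borel_measurable borel"
  shows "vnorm A g X \<in> borel_measurable borel"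
proof (rule borel_measurable_atlas[OF surface])
  have A: "oriented_atlas A"
    using surface by (simp add: closed_oriented_surface_def)
  fix c assume c: "c \<in> A"
  then have ch: "is_chart c" "open (cdom c)"
    using A by (auto simp: oriented_atlas_def is_chart_def)
  have "(\<lambda>x. indicator (cdom c) x *\<^sub>R g c x) \<in> borel_measurable borel"
    using ch(2) by (intro borel_measurable_continuous_on_indicator continuous_on_metric[OF g c ch(1)]) auto
  moreover have "continuous_on UNIV (\<lambda>p::(real^2^2) \<times> (real^2). fst p *v snd p)"
    unfolding matrix_vector_mult_def by (intro continuous_on_vec_lambda continuous_intros)
  ultimately have "(\<lambda>x. (indicator (cdom c) x *\<^sub>R g c x) *v (indicator (cdom c) x *\<^sub>R X c x)) \<in> borel_measurable borel"
    by (rule borel_measurable_continuous_Pair[OF _ meas[OF c], where H = "\<lambda>M v. M *v v"])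
  from borel_measurable_inner[OF meas[OF c] this]
  show "(\<lambda>x. sqrt ((indicator (cdom c) x *\<^sub>R X c x) \<bullet>
      ((indicator (cdom c) x *\<^sub>R g c x) *v (indicator (cdom c) x *\<^sub>R X c x)))) \<in> borel_measurable borel"
    by (rule measurable_compose[OF _ borel_measurable_sqrt])
  fix x assume x: "x \<in> cdom c"
  then show "vnorm A g X x = sqrt ((indicator (cdom c) x *\<^sub>R X c x) \<bullet>
      ((indicator (cdom c) x *\<^sub>R g c x) *v (indicator (cdom c) x *\<^sub>R X c x)))"
    using metric_norm_change_chart[OF g X chart_at(1)[OF A] c chart_at(2)[OF A] x] by (simp add: vnorm_def Let_def)
qed

text \<open>The weak gradient is only known almost everywhere, so its pairing with a classical
  differential has to be shown measurable before the integrals can be compared.\<close>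

lemma p_laplacian_C1:
  fixes A :: "('m::{t2_space,second_countable_topology}) chart set"
  assumes surface: "closed_oriented_surface A" and g: "riemannian_metric A g" and vol: "volume_measure A g \<nu>"
    and u: "C1_fun A u" and v: "C1_fun A v" and \<phi>: "\<phi> \<in> borel_measurable borel"
    and \<psi>: "\<And>x. exp (\<phi> x) * \<psi> x = v x"
  shows "p_laplacian A g \<nu> \<phi> p u \<psi> = - (LINT x|\<nu>. exp (- \<phi> x) *
    (cometric g u u (chart_at A x) x powr (p / 2 - 1) * cometric g u v (chart_at A x) x))"
proof -
  have A: "oriented_atlas A"
    using surface by (simp add: closed_oriented_surface_def)
  have sets: "sets \<nu> = sets borel"
    using vol by (simp add: volume_measure_def)
  define F where "F X x = exp (- \<phi> x) * (vnorm A g X x powr (p - 2) *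
      (X (chart_at A x) x \<bullet> differential (chart_at A x) v x))" for X x
  have F_meas: "F X \<in> borel_measurable \<nu>" if X: "has_weak_grad A g u X" for X
  proof -
    have X': "vector_field A X" "\<And>c. c \<in> A \<Longrightarrow> (\<lambda>x. indicator (cdom c) x *\<^sub>R X c x) \<in> borel_measurable borel"
      using X unfolding has_weak_grad_def by blast+
    have "F X \<in> borel_measurable borel"
      using borel_measurable_vnorm[OF surface g X'] borel_measurable_inner_vector_field[OF surface X' v] \<phi>
      unfolding F_def by measurable
    then show ?thesis
      by (simp add: measurable_cong_sets[OF sets refl])
  qed
  have grad: "has_weak_grad A g u (grad g u)"
    by (rule has_weak_grad_grad[OF A g u])
  then have weak: "has_weak_grad A g u (weak_grad A g u)"
    unfolding weak_grad_def by (rule someI[where P = "has_weak_grad A g u"])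
  have "p_laplacian A g \<nu> \<phi> p u \<psi> = - (LINT x|\<nu>. F (weak_grad A g u) x)"
    unfolding p_laplacian_def mult_distr_def div_distr_def Let_def \<psi> F_def
    by (simp add: inner_vec_def differential_def sum_distrib_left mult_ac)
  also have "(LINT x|\<nu>. F (weak_grad A g u) x) = (LINT x|\<nu>. F (grad g u) x)"
  proof (rule integral_cong_AE[OF F_meas[OF weak] F_meas[OF grad]])
    show "AE x in \<nu>. F (weak_grad A g u) x = F (grad g u) x"
      using weak_grad_eq_grad_AE[OF surface g vol u]
    proof eventually_elim
      case (elim x)
      then have "weak_grad A g u (chart_at A x) x = grad g u (chart_at A x) x"
        using chart_at(1,2)[OF A] by blast
      then show ?case
        by (simp add: F_def vnorm_def Let_def)
    qed
  qed
  also have "F (grad g u) = (\<lambda>x. exp (- \<phi> x) * (cometric g u u (chart_at A x) x powr (p / 2 - 1) *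
      cometric g u v (chart_at A x) x))"
  proof
    fix x
    have "cometric g u u (chart_at A x) x \<ge> 0"
      by (rule cometric_nonneg) (rule riemannian_metric_posdef[OF g chart_at(1,2)[OF A]])
    then have "vnorm A g (grad g u) x powr (p - 2) = cometric g u u (chart_at A x) x powr (p / 2 - 1)"
      using powr_powr[of "cometric g u u (chart_at A x) x" "1 / 2" "p - 2"]
      by (simp add: vnorm_grad[OF A g u chart_at(1,2)[OF A]] powr_half_sqrt diff_divide_distrib)
    then show "F (grad g u) x = exp (- \<phi> x) * (cometric g u u (chart_at A x) x powr (p / 2 - 1) *
        cometric g u v (chart_at A x) x)"
      by (simp add: F_def cometric_def)
  qed
  finally show ?thesis .
qed

text \<open>Testing with exp(-\<phi>) u removes the outer weight exp(\<phi>) of the operator and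
  pairs du with itself. q^(p/2 - 1) q = q^(p/2) also holds at q = 0, both sides being 0.\<close>

lemma p_energy_C1:
  fixes A :: "('m::{t2_space,second_countable_topology}) chart set"
  assumes surface: "closed_oriented_surface A" and g: "riemannian_metric A g" and vol: "volume_measure A g \<nu>"
    and u: "C1_fun A u" and \<phi>: "\<phi> \<in> borel_measurable borel" and p: "p \<noteq> 0"
  shows "p_energy A g \<nu> \<phi> p u = (LINT x|\<nu>. exp (- \<phi> x) * cometric g u u (chart_at A x) x powr (p / 2))"
proof -
  have A: "oriented_atlas A"
    using surface by (simp add: closed_oriented_surface_def)
  have "p_energy A g \<nu> \<phi> p u = (LINT x|\<nu>. exp (- \<phi> x) *
      (cometric g u u (chart_at A x) x powr (p / 2 - 1) * cometric g u u (chart_at A x) x))"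
    unfolding p_energy_def integral_distr_def mult_distr_def
    by (subst p_laplacian_C1[OF surface g vol u u \<phi>]) (simp_all add: exp_minus field_simps)
  moreover have "cometric g u u (chart_at A x) x powr (p / 2 - 1) * cometric g u u (chart_at A x) x =
      cometric g u u (chart_at A x) x powr (p / 2)" for x
  proof -
    have "cometric g u u (chart_at A x) x \<ge> 0"
      by (rule cometric_nonneg) (rule riemannian_metric_posdef[OF g chart_at(1,2)[OF A]])
    then show ?thesis
      by (cases "cometric g u u (chart_at A x) x = 0") (auto simp: powr_diff)
  qed
  ultimately show ?thesis
    by simp
qed

section \<open>Consequences of the eigenvalue equation\<close>

lemma Ck_on_1_exp_mult:
  fixes k l :: "'a::real_normed_vector \<Rightarrow> real"
  assumes V: "open V" and k: "Ck_on 1 V k" and l: "Ck_on 1 V l"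
  shows "Ck_on 1 V (\<lambda>y. exp (- k y) * l y)"
  unfolding Ck_on_1_iff
proof (intro conjI ballI allI)
  let ?k' = "\<lambda>y. frechet_derivative k (at y within V)"
  let ?l' = "\<lambda>y. frechet_derivative l (at y within V)"
  have d: "((\<lambda>y. exp (- k y) * l y) has_derivative
      (\<lambda>h. exp (- k y) * ?l' y h - exp (- k y) * ?k' y h * l y)) (at y within V)" if "y \<in> V" for y
  proof -
    have "(k has_derivative ?k' y) (at y within V)" "(l has_derivative ?l' y) (at y within V)"
      using k l that by (auto simp: Ck_on_1_iff frechet_derivative_works)
    then show ?thesis
      by (auto intro!: derivative_eq_intros simp: fun_eq_iff algebra_simps)
  qed
  then show "(\<lambda>y. exp (- k y) * l y) differentiable (at y within V)" if "y \<in> V" for y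
    using that unfolding differentiable_def by blast
  fix h
  have kl: "continuous_on V k" "continuous_on V l"
    using k l Ck_on_Suc_imp[of 0 V] by simp_all
  have "continuous_on V (\<lambda>y. exp (- k y) * ?l' y h - exp (- k y) * ?k' y h * l y)"
    using k l unfolding Ck_on_1_iff by (intro continuous_intros kl) blast+
  then show "continuous_on V (\<lambda>y. frechet_derivative (\<lambda>y. exp (- k y) * l y) (at y within V) h)"
  proof (rule continuous_on_eq)
    fix y assume y: "y \<in> V"
    show "exp (- k y) * ?l' y h - exp (- k y) * ?k' y h * l y = frechet_derivative (\<lambda>y. exp (- k y) * l y) (at y within V) h"
      using frechet_derivative_at[OF d[OF y, unfolded at_within_open[OF y V]]]
      unfolding at_within_open[OF y V] by metis
  qed
qed

text \<open>The test function exp(-\<phi>) v produces the weighted measure on the right and cancels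
  exp(\<phi>) in the operator on the left. With v = \<partial>_t f this evaluates the variation of
  the gradient term.\<close>

lemma eigenfunction_C1_identity:
  fixes A :: "('m::{t2_space,second_countable_topology}) chart set"
  assumes surface: "closed_oriented_surface A" and g: "riemannian_metric A g" and vol: "volume_measure A g \<nu>"
    and u: "C1_fun A u" and v: "C1_fun A v" and \<phi>: "C1_fun A \<phi>" "\<phi> \<in> borel_measurable borel"
    and eigen: "eigenfunction A g \<nu> \<phi> p \<Lambda> u"
  shows "(LINT x|\<nu>. exp (- \<phi> x) *
      (cometric g u u (chart_at A x) x powr (p / 2 - 1) * cometric g u v (chart_at A x) x)) =
    \<Lambda> * (LINT x|\<nu>. exp (- \<phi> x) * (\<bar>u x\<bar> powr (p - 2) * u x * v x))"
proof -
  define \<psi> where "\<psi> x = exp (- \<phi> x) * v x" for x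
  have "C1_fun A \<psi>"
    unfolding C1_fun_def
  proof
    fix c assume c: "c \<in> A"
    then have "open (cimg c)"
      using surface by (auto simp: closed_oriented_surface_def oriented_atlas_def is_chart_def)
    moreover have "Ck_on 1 (cimg c) (\<phi> \<circ> chart_inv c)" "Ck_on 1 (cimg c) (v \<circ> chart_inv c)"
      using \<phi>(1) v c unfolding C1_fun_def by blast+
    ultimately have "Ck_on 1 (cimg c) (\<lambda>y. exp (- (\<phi> \<circ> chart_inv c) y) * (v \<circ> chart_inv c) y)"
      by (rule Ck_on_1_exp_mult)
    then show "Ck_on 1 (cimg c) (\<psi> \<circ> chart_inv c)"
      by (simp only: \<psi>_def[abs_def] o_def)
  qed
  then have "- p_laplacian A g \<nu> \<phi> p u \<psi> = fun_distr \<nu> (\<lambda>x. \<Lambda> * (\<bar>u x\<bar> powr (p - 2) * u x)) \<psi>"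
    using eigen unfolding eigenfunction_def by blast
  moreover have "p_laplacian A g \<nu> \<phi> p u \<psi> = - (LINT x|\<nu>. exp (- \<phi> x) *
      (cometric g u u (chart_at A x) x powr (p / 2 - 1) * cometric g u v (chart_at A x) x))"
    by (rule p_laplacian_C1[OF surface g vol u v \<phi>(2)]) (simp add: \<psi>_def exp_minus field_simps)
  moreover have "fun_distr \<nu> (\<lambda>x. \<Lambda> * (\<bar>u x\<bar> powr (p - 2) * u x)) \<psi> =
      \<Lambda> * (LINT x|\<nu>. exp (- \<phi> x) * (\<bar>u x\<bar> powr (p - 2) * u x * v x))"
    unfolding fun_distr_def integral_mult_right_zero[symmetric] by (simp add: \<psi>_def mult_ac)
  ultimately show ?thesis
    by simp
qed

text \<open>Transfers the nondegeneracy demanded for p = 1 from the weak to the classical gradient,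
  as needed for differentiating under the integral at the zeros of |\<nabla>f|^2 and f^2.\<close>

lemma eigenfunction_C1_nonzero:
  fixes A :: "('m::{t2_space,second_countable_topology}) chart set"
  assumes surface: "closed_oriented_surface A" and g: "riemannian_metric A g" and vol: "volume_measure A g \<nu>"
    and u: "C1_fun A u" and eigen: "eigenfunction A g \<nu> \<phi> 1 \<Lambda> u"
  shows "AE x in \<nu>. u x \<noteq> 0" "AE x in \<nu>. cometric g u u (chart_at A x) x \<noteq> 0"
proof -
  have A: "oriented_atlas A"
    using surface by (simp add: closed_oriented_surface_def)
  have e: "AE x in \<nu>. u x \<noteq> 0 \<and> vnorm A g (weak_grad A g u) x \<noteq> 0"
    using eigen unfolding eigenfunction_def by blast
  then show "AE x in \<nu>. u x \<noteq> 0"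
    by eventually_elim blast
  show "AE x in \<nu>. cometric g u u (chart_at A x) x \<noteq> 0"
    using e weak_grad_eq_grad_AE[OF surface g vol u]
  proof eventually_elim
    case (elim x)
    then have "weak_grad A g u (chart_at A x) x = grad g u (chart_at A x) x"
      using chart_at(1,2)[OF A] by blast
    then have "vnorm A g (grad g u) x \<noteq> 0"
      using elim(1) by (simp add: vnorm_def Let_def)
    then show ?case
      by (simp add: vnorm_grad[OF A g u chart_at(1,2)[OF A]])
  qed
qed

section \<open>The first variation\<close>

text \<open>Puts |f|^p into the form (f^2)^(p/2), so that the lemma differentiating the energy also
  covers the normalisation.\<close>

lemma power2_powr_half: "(y\<^sup>2) powr (p / 2) = \<bar>y\<bar> powr p" for y p :: real
  using powr_powr[of "y\<^sup>2" "1 / 2" p] by (simp add: powr_half_sqrt)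

lemma integrable_continuous_compact_space:
  fixes u :: "'m::topological_space \<Rightarrow> real"
  assumes cpt: "compact (UNIV :: 'm set)" and fin: "finite_measure \<nu>" and sets: "sets \<nu> = sets borel"
    and u: "continuous_on UNIV u"
  shows "integrable \<nu> u"
proof -
  have "bounded (range u)"
    using cpt u by (intro compact_imp_bounded compact_continuous_image)
  then obtain B where B: "\<forall>z\<in>range u. norm z \<le> B"
    unfolding bounded_iff by blast
  show ?thesis
  proof (rule finite_measure.integrable_const_bound[OF fin, where B = B])
    show "AE x in \<nu>. norm (u x) \<le> B"
      using B by auto
    show "u \<in> borel_measurable \<nu>"
      using borel_measurable_continuous_onI[OF u] by (simp add: measurable_cong_sets[OF sets refl])
  qed
qed

lemma real_derivative_unique_atLeastLessThan:
  fixes u :: "real \<Rightarrow> real"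
  assumes "t \<in> {0..<T}" "(u has_real_derivative D) (at t within {0..<T})" "(u has_real_derivative E) (at t within {0..<T})"
  shows "D = E"
  using vector_derivative_unique_within[OF at_within_atLeastLessThan_neq_bot[OF assms(1)]] assms(2,3)
  unfolding has_real_derivative_iff_has_vector_derivative by blast

text \<open>Formulated for an arbitrary conformal factor \<open>h\<close> and weight derivative
  \<open>\<phi>'\<close>; curvature enters afterwards through \<open>h\<close> alone.\<close>

lemma p_energy_conformal_derivative:
  fixes A :: "('m::{t2_space,second_countable_topology}) chart set"
  assumes surface: "closed_oriented_surface A" and p: "1 \<le> p" and t0: "t\<^sub>0 \<in> {0..<T}"
    and metric: "\<And>t. t \<in> {0..<T} \<Longrightarrow> riemannian_metric A (g t)"
    and smooth: "\<And>c. c \<in> A \<Longrightarrow> smooth_on ({0..<T} \<times> cimg c) (in_chart c (\<lambda>t. g t c))"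
    and flow: "\<And>c x t. c \<in> A \<Longrightarrow> x \<in> cdom c \<Longrightarrow> t \<in> {0..<T} \<Longrightarrow>
      ((\<lambda>s. g s c x) has_vector_derivative h t x *\<^sub>R g t c x) (at t within {0..<T})"
    and vol: "\<And>t. t \<in> {0..<T} \<Longrightarrow> volume_measure A (g t) (\<nu> t)"
    and \<phi>: "\<And>c. c \<in> A \<Longrightarrow> Ck_on 1 ({0..<T} \<times> cimg c) (in_chart c \<phi>)"
    and \<phi>': "\<And>t x. t \<in> {0..<T} \<Longrightarrow> ((\<lambda>s. \<phi> s x) has_real_derivative \<phi>' t x) (at t within {0..<T})"
    and f: "\<And>c. c \<in> A \<Longrightarrow> Ck_on 1 ({0..<T} \<times> cimg c) (in_chart c f)"
    and f': "\<And>c. c \<in> A \<Longrightarrow> Ck_on 1 ({0..<T} \<times> cimg c) (in_chart c f')"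
    and ff': "\<And>t x. t \<in> {0..<T} \<Longrightarrow> ((\<lambda>s. f s x) has_real_derivative f' t x) (at t within {0..<T})"
    and norm: "\<And>t. t \<in> {0..<T} \<Longrightarrow> (LINT x|weighted (\<phi> t) (\<nu> t). \<bar>f t x\<bar> powr p) = 1"
    and eigen: "eigenfunction A (g t\<^sub>0) (\<nu> t\<^sub>0) (\<phi> t\<^sub>0) p \<Lambda> (f t\<^sub>0)"
  shows "((\<lambda>t. p_energy A (g t) (\<nu> t) (\<phi> t) p (f t)) has_real_derivative
      (LINT x|\<nu> t\<^sub>0. cometric (g t\<^sub>0) (f t\<^sub>0) (f t\<^sub>0) (chart_at A x) x powr (p / 2) *
          (((1 - p / 2) * h t\<^sub>0 x - \<phi>' t\<^sub>0 x) * exp (- \<phi> t\<^sub>0 x)))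
      - \<Lambda> * (LINT x|\<nu> t\<^sub>0. \<bar>f t\<^sub>0 x\<bar> powr p * ((h t\<^sub>0 x - \<phi>' t\<^sub>0 x) * exp (- \<phi> t\<^sub>0 x))))
      (at t\<^sub>0 within {0..<T})"
proof -
  have A: "oriented_atlas A" and cpt: "compact (UNIV :: 'm set)"
    using surface by (auto simp: closed_oriented_surface_def)
  obtain a where a: "spacetime_continuous T a" "spacetime_continuous T h" "\<And>t x. t \<in> {0..<T} \<Longrightarrow> a t x > 0"
    "\<And>t x. t \<in> {0..<T} \<Longrightarrow> ((\<lambda>s. a s x) has_real_derivative h t x * a t x) (at t within {0..<T})"
    "\<And>c t x. c \<in> A \<Longrightarrow> x \<in> cdom c \<Longrightarrow> t \<in> {0..<T} \<Longrightarrow> g t c x = a t x *\<^sub>R g t\<^sub>0 c x"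
    "\<And>x. a t\<^sub>0 x = 1"
    using conformal_flow_integrate[OF A metric smooth flow t0] by blast
  define \<gamma> where "\<gamma> = g t\<^sub>0"
  define n where "n = \<nu> t\<^sub>0"
  have \<gamma>: "riemannian_metric A \<gamma>" and n: "volume_measure A \<gamma> n"
    using metric[OF t0] vol[OF t0] by (auto simp: \<gamma>_def n_def)
  have sets: "sets n = sets borel"
    using n by (simp add: volume_measure_def)
  have fin: "finite_measure n"
    by (rule volume_measure_finite[OF surface \<gamma> n])
  have pos: "posdef (\<gamma> (chart_at A x) x)" for x
    by (rule riemannian_metric_posdef[OF \<gamma> chart_at(1,2)[OF A]])
  have density: "\<nu> t = density n (\<lambda>x. ennreal (a t x))" if t: "t \<in> {0..<T}" for t
    using a(3)[OF t] a(5)[OF _ _ t] unfolding n_def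
    by (intro volume_measure_conformal[OF surface metric[OF t0] metric[OF t] vol[OF t0] vol[OF t]]
        spacetime_continuous_slice[OF a(1) t]) auto
  have \<phi>_cont: "spacetime_continuous T \<phi>" and f_cont: "spacetime_continuous T f" and f'_cont: "spacetime_continuous T f'"
    using in_chart_Ck_1_continuous[OF A] \<phi> f f' by blast+
  have \<phi>'_cont: "spacetime_continuous T \<phi>'"
    by (rule in_chart_time_derivative_continuous[OF A \<phi> \<phi>'])
  have cont_pair: "continuous_on ({0..<T} \<times> UNIV) (\<lambda>p. u (fst p) (snd p))"
    if "spacetime_continuous T u" for u :: "real \<Rightarrow> 'm \<Rightarrow> real"
    using that by (simp add: case_prod_unfold)
  have meas: "u t \<in> borel_measurable n" "u t \<in> borel_measurable borel"
    if "spacetime_continuous T u" "t \<in> {0..<T}" for u :: "real \<Rightarrow> 'm \<Rightarrow> real" and t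
    using borel_measurable_continuous_onI[OF spacetime_continuous_slice[OF that]]
    by (simp_all add: measurable_cong_sets[OF sets refl])

  define Q where "Q t x = cometric \<gamma> (f t) (f t) (chart_at A x) x" for t x
  define P where "P t x = cometric \<gamma> (f t) (f' t) (chart_at A x) x" for t x
  define K where "K t x = sqrt (cometric \<gamma> (f' t) (f' t) (chart_at A x) x)" for t x
  define w where "w t x = a t x powr (1 - p / 2) * exp (- \<phi> t x)" for t x
  define w' where "w' t x = ((1 - p / 2) * h t x - \<phi>' t x) * w t x" for t x
  \<comment> \<open>The normalisation contains no gradient, so it carries the full volume factor
    \<open>a\<close> where the energy carries a^(1 - p/2).\<close>
  define v where "v t x = a t x * exp (- \<phi> t x)" for t x
  define v' where "v' t x = (h t x - \<phi>' t x) * v t x" for t x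
  have Q_cont: "spacetime_continuous T Q" and P_cont: "spacetime_continuous T P"
    unfolding Q_def[abs_def] P_def[abs_def]
    by (intro cometric_spacetime_continuous[OF A \<gamma>] f f'; assumption)+
  have K_cont: "spacetime_continuous T K"
    using continuous_on_real_sqrt[OF cometric_spacetime_continuous[OF A \<gamma> f' f']]
    by (simp add: K_def[abs_def] case_prod_unfold)
  have a_nz: "\<forall>p\<in>{0..<T} \<times> UNIV. a (fst p) (snd p) \<noteq> 0"
  proof
    fix p :: "real \<times> 'm"
    assume "p \<in> {0..<T} \<times> UNIV"
    then show "a (fst p) (snd p) \<noteq> 0"
      using a(3)[of "fst p" "snd p"] by auto
  qed
  have w_cont: "spacetime_continuous T w"
    unfolding w_def[abs_def] case_prod_unfold
    by (intro continuous_intros cont_pair a(1) \<phi>_cont a_nz)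
  have w'_cont: "spacetime_continuous T w'"
    unfolding w'_def[abs_def] case_prod_unfold
    by (intro continuous_intros cont_pair a(2) \<phi>'_cont w_cont)
  have v_cont: "spacetime_continuous T v"
    unfolding v_def[abs_def] case_prod_unfold by (intro continuous_intros cont_pair a(1) \<phi>_cont)
  have v'_cont: "spacetime_continuous T v'"
    unfolding v'_def[abs_def] case_prod_unfold
    by (intro continuous_intros cont_pair a(2) \<phi>'_cont v_cont)
  have w_der: "((\<lambda>s. w s x) has_real_derivative w' t x) (at t within {0..<T})" if t: "t \<in> {0..<T}" for t x
  proof -
    have "((\<lambda>s. a s x powr (1 - p / 2)) has_real_derivative
        (1 - p / 2) * a t x powr (1 - p / 2 - 1) * (h t x * a t x)) (at t within {0..<T})"
      by (rule DERIV_chain2[OF has_real_derivative_powr[OF a(3)[OF t]] a(4)[OF t]])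
    moreover have "(1 - p / 2) * a t x powr (1 - p / 2 - 1) * (h t x * a t x) = (1 - p / 2) * h t x * a t x powr (1 - p / 2)"
    proof -
      have "a t x powr (1 - p / 2) = a t x powr (1 - p / 2 - 1) * a t x"
        using powr_add[of "a t x" "1 - p / 2 - 1" 1] a(3)[OF t, of x] by simp
      then show ?thesis
        by (simp only: mult_ac)
    qed
    ultimately have 1: "((\<lambda>s. a s x powr (1 - p / 2)) has_real_derivative
        (1 - p / 2) * h t x * a t x powr (1 - p / 2)) (at t within {0..<T})"
      by (simp only:)
    have 2: "((\<lambda>s. exp (- \<phi> s x)) has_real_derivative - \<phi>' t x * exp (- \<phi> t x)) (at t within {0..<T})"
      by (auto intro!: derivative_eq_intros \<phi>'[OF t])
    show ?thesis
      using DERIV_mult[OF 1 2] unfolding w_def w'_def by (simp add: algebra_simps)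
  qed
  have v_der: "((\<lambda>s. v s x) has_real_derivative v' t x) (at t within {0..<T})" if t: "t \<in> {0..<T}" for t x
    unfolding v_def v'_def by (auto intro!: derivative_eq_intros \<phi>'[OF t] a(4)[OF t] simp: algebra_simps)
  have Q_nonneg: "Q t x \<ge> 0" for t x
    unfolding Q_def by (rule cometric_nonneg[of \<gamma> "chart_at A x" x, OF pos])

  have E_eq: "p_energy A (g t) (\<nu> t) (\<phi> t) p (f t) = (LINT x|n. Q t x powr (p / 2) * w t x)" if t: "t \<in> {0..<T}" for t
  proof -
    have "p_energy A (g t) (\<nu> t) (\<phi> t) p (f t) =
        (LINT x|\<nu> t. exp (- \<phi> t x) * cometric (g t) (f t) (f t) (chart_at A x) x powr (p / 2))"
      using p by (intro p_energy_C1[OF surface metric[OF t] vol[OF t]] in_chart_C1_fun[OF A f t] meas(2)[OF \<phi>_cont t]) auto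
    also have "\<dots> = (LINT x|density n (\<lambda>x. ennreal (a t x)). exp (- \<phi> t x) * (Q t x / a t x) powr (p / 2))"
    proof -
      have "cometric (g t) (f t) (f t) (chart_at A x) x = Q t x / a t x" for x
        unfolding Q_def using a(3)[OF t, of x] a(5)[OF chart_at(1,2)[OF A] t, of x]
        by (intro cometric_scaleR[of \<gamma> "chart_at A x" x, OF pos]) (auto simp: \<gamma>_def)
      then show ?thesis
        by (simp add: density[OF t])
    qed
    also have "\<dots> = (LINT x|n. a t x *\<^sub>R (exp (- \<phi> t x) * (Q t x / a t x) powr (p / 2)))"
      using meas(1)[OF \<phi>_cont t] meas(1)[OF Q_cont t] meas(1)[OF a(1) t] a(3)[OF t]
      by (intro integral_density) (auto intro!: AE_I2 less_imp_le)
    also have "\<dots> = (LINT x|n. Q t x powr (p / 2) * w t x)"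
      using a(3)[OF t] Q_nonneg[of t]
      by (intro Bochner_Integration.integral_cong) (auto simp: w_def powr_divide powr_diff less_imp_le)
    finally show ?thesis .
  qed
  have N_eq: "(LINT x|n. (f t x)\<^sup>2 powr (p / 2) * v t x) = 1" if t: "t \<in> {0..<T}" for t
  proof -
    have "weighted (\<phi> t) (\<nu> t) = density n (\<lambda>x. ennreal (a t x) * ennreal (exp (- \<phi> t x)))"
      unfolding weighted_def density[OF t]
      using meas(1)[OF \<phi>_cont t] meas(1)[OF a(1) t] by (intro density_density_eq) auto
    also have "\<dots> = density n (\<lambda>x. ennreal (v t x))"
      using a(3)[OF t] by (simp add: v_def ennreal_mult less_imp_le)
    finally have "1 = (LINT x|density n (\<lambda>x. ennreal (v t x)). \<bar>f t x\<bar> powr p)"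
      using norm[OF t] by simp
    also have "\<dots> = (LINT x|n. v t x *\<^sub>R (\<bar>f t x\<bar> powr p))"
      using meas(1)[OF f_cont t] meas(1)[OF v_cont t] a(3)[OF t]
      by (intro integral_density) (auto intro!: AE_I2 simp: v_def less_imp_le)
    finally show ?thesis
      by (simp add: power2_powr_half mult.commute)
  qed

  have E_der: "((\<lambda>t. LINT x|n. Q t x powr (p / 2) * w t x) has_real_derivative
      (LINT x|n. p / 2 * Q t\<^sub>0 x powr (p / 2 - 1) * (2 * P t\<^sub>0 x) * w t\<^sub>0 x) +
      (LINT x|n. Q t\<^sub>0 x powr (p / 2) * w' t\<^sub>0 x)) (at t\<^sub>0 within {0..<T})"
  proof (rule integral_powr_half_has_real_derivative[OF cpt fin sets t0 p Q_cont _ w_cont w'_cont K_cont])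
    show "spacetime_continuous T (\<lambda>t x. 2 * P t x)"
      unfolding case_prod_unfold by (intro continuous_intros cont_pair P_cont)
    fix t x assume t: "t \<in> {0..<T}"
    show "((\<lambda>s. Q s x) has_real_derivative 2 * P t x) (at t within {0..<T})"
      unfolding Q_def P_def using chart_at[OF A]
      by (intro cometric_time_derivative[where g = \<gamma> and c = "chart_at A x", OF _ _ pos f f' ff' t]) auto
    show "\<bar>2 * P t x\<bar> \<le> 2 * K t x * sqrt (Q t x)"
    proof -
      have "(P t x)\<^sup>2 \<le> Q t x * cometric \<gamma> (f' t) (f' t) (chart_at A x) x"
        unfolding P_def Q_def by (rule cometric_Cauchy_Schwarz[of \<gamma> "chart_at A x" x, OF pos])
      then have "\<bar>P t x\<bar> \<le> sqrt (Q t x * cometric \<gamma> (f' t) (f' t) (chart_at A x) x)"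
        by (rule real_le_rsqrt[of "\<bar>P t x\<bar>", simplified])
      then show ?thesis
        by (simp add: K_def real_sqrt_mult mult.commute)
    qed
  next
    assume "p = 1"
    then show "AE x in n. Q t\<^sub>0 x \<noteq> 0"
      using eigenfunction_C1_nonzero(2)[OF surface \<gamma> n in_chart_C1_fun[OF A f t0]] eigen
      unfolding Q_def by (simp add: \<gamma>_def n_def)
  qed (use w_der Q_nonneg in auto)
  have N_der: "((\<lambda>t. LINT x|n. (f t x)\<^sup>2 powr (p / 2) * v t x) has_real_derivative
      (LINT x|n. p / 2 * (f t\<^sub>0 x)\<^sup>2 powr (p / 2 - 1) * (2 * f t\<^sub>0 x * f' t\<^sub>0 x) * v t\<^sub>0 x) +
      (LINT x|n. (f t\<^sub>0 x)\<^sup>2 powr (p / 2) * v' t\<^sub>0 x)) (at t\<^sub>0 within {0..<T})"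
  proof (rule integral_powr_half_has_real_derivative[OF cpt fin sets t0 p _ _ v_cont v'_cont])
    show "spacetime_continuous T (\<lambda>t x. (f t x)\<^sup>2)" "spacetime_continuous T (\<lambda>t x. 2 * f t x * f' t x)"
      "spacetime_continuous T (\<lambda>t x. \<bar>f' t x\<bar>)"
      unfolding case_prod_unfold by (intro continuous_intros cont_pair f_cont f'_cont)+
    show "((\<lambda>s. (f s x)\<^sup>2) has_real_derivative 2 * f t x * f' t x) (at t within {0..<T})" if "t \<in> {0..<T}" for t x
      by (auto intro!: derivative_eq_intros ff'[OF that])
    assume "p = 1"
    then show "AE x in n. (f t\<^sub>0 x)\<^sup>2 \<noteq> 0"
      using eigenfunction_C1_nonzero(1)[OF surface \<gamma> n in_chart_C1_fun[OF A f t0]] eigen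
      by (simp add: \<gamma>_def n_def)
  qed (use v_der in \<open>auto simp: abs_mult\<close>)

  have at_t0: "w t\<^sub>0 x = exp (- \<phi> t\<^sub>0 x)" "v t\<^sub>0 x = exp (- \<phi> t\<^sub>0 x)" for x
    by (simp_all add: w_def v_def a(6))
  \<comment> \<open>The only integral containing \<partial>_t f: it enters the derivative of the
    energy as p \<Lambda> Z and that of the normalisation as p Z, so it can be eliminated.\<close>
  define Z where "Z = (LINT x|n. exp (- \<phi> t\<^sub>0 x) * (\<bar>f t\<^sub>0 x\<bar> powr (p - 2) * f t\<^sub>0 x * f' t\<^sub>0 x))"
  have "(LINT x|n. p / 2 * Q t\<^sub>0 x powr (p / 2 - 1) * (2 * P t\<^sub>0 x) * w t\<^sub>0 x) =
      p * (LINT x|n. exp (- \<phi> t\<^sub>0 x) * (Q t\<^sub>0 x powr (p / 2 - 1) * P t\<^sub>0 x))"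
    unfolding integral_mult_right_zero[symmetric] at_t0 by (simp add: mult_ac)
  also have "\<dots> = p * (\<Lambda> * Z)"
    using eigenfunction_C1_identity[OF surface \<gamma> n in_chart_C1_fun[OF A f t0] in_chart_C1_fun[OF A f' t0]
        in_chart_C1_fun[OF A \<phi> t0] meas(2)[OF \<phi>_cont t0]] eigen
    unfolding Q_def P_def Z_def by (simp add: \<gamma>_def n_def)
  finally have E1: "(LINT x|n. p / 2 * Q t\<^sub>0 x powr (p / 2 - 1) * (2 * P t\<^sub>0 x) * w t\<^sub>0 x) = p * (\<Lambda> * Z)" .
  have "(f t\<^sub>0 x)\<^sup>2 powr (p / 2 - 1) = \<bar>f t\<^sub>0 x\<bar> powr (p - 2)" for x
    using power2_powr_half[of "f t\<^sub>0 x" "p - 2"] by (simp add: diff_divide_distrib)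
  then have N1: "(LINT x|n. p / 2 * (f t\<^sub>0 x)\<^sup>2 powr (p / 2 - 1) * (2 * f t\<^sub>0 x * f' t\<^sub>0 x) * v t\<^sub>0 x) = p * Z"
    unfolding Z_def integral_mult_right_zero[symmetric] at_t0 by (simp add: mult_ac)
  \<comment> \<open>The normalisation is constant on the interval; uniqueness of the possibly
    one-sided derivative at \<open>t\<^sub>0\<close> equates 0 with \<open>N_der\<close>.\<close>
  have "((\<lambda>t. LINT x|n. (f t x)\<^sup>2 powr (p / 2) * v t x) has_real_derivative 0) (at t\<^sub>0 within {0..<T})"
    by (rule has_field_derivative_transform_within[OF DERIV_const[of 1] zero_less_one t0]) (simp add: N_eq)
  from real_derivative_unique_atLeastLessThan[OF t0 N_der this]
  have "p * Z = - (LINT x|n. (f t\<^sub>0 x)\<^sup>2 powr (p / 2) * v' t\<^sub>0 x)"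
    unfolding N1 by simp
  then have "p * (\<Lambda> * Z) + (LINT x|n. Q t\<^sub>0 x powr (p / 2) * w' t\<^sub>0 x) =
      (LINT x|n. Q t\<^sub>0 x powr (p / 2) * (((1 - p / 2) * h t\<^sub>0 x - \<phi>' t\<^sub>0 x) * exp (- \<phi> t\<^sub>0 x))) -
      \<Lambda> * (LINT x|n. \<bar>f t\<^sub>0 x\<bar> powr p * ((h t\<^sub>0 x - \<phi>' t\<^sub>0 x) * exp (- \<phi> t\<^sub>0 x)))"
    unfolding w'_def v'_def at_t0 power2_powr_half by (simp add: mult.left_commute[of p])
  with E_der[unfolded E1]
  have "((\<lambda>t. LINT x|n. Q t x powr (p / 2) * w t x) has_real_derivative
      (LINT x|n. Q t\<^sub>0 x powr (p / 2) * (((1 - p / 2) * h t\<^sub>0 x - \<phi>' t\<^sub>0 x) * exp (- \<phi> t\<^sub>0 x))) -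
      \<Lambda> * (LINT x|n. \<bar>f t\<^sub>0 x\<bar> powr p * ((h t\<^sub>0 x - \<phi>' t\<^sub>0 x) * exp (- \<phi> t\<^sub>0 x)))) (at t\<^sub>0 within {0..<T})"
    by simp
  then show ?thesis
    unfolding n_def[symmetric] \<gamma>_def[symmetric] Q_def[symmetric]
    by (rule has_field_derivative_transform_within[OF _ zero_less_one t0]) (simp add: E_eq)
qed

text \<open>Since \<open>1 - 2 \<rho> \<noteq> 0\<close>, the conformal factor \<open>h = - (1 - 2 \<rho>) R\<close> of the flow shows that \<open>R\<close> is
  continuous; this is what makes all the integrals below exist.\<close>

lemma ricci_bourguignon_p_energy_derivative:
  fixes A :: "('m::{t2_space,second_countable_topology}) chart set"
  assumes surface: "closed_oriented_surface A" and rho: "\<rho> < 1/2" and p: "1 \<le> p"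
    and flow: "ricci_bourguignon_flow A \<rho> T g0 g"
    and vol: "\<And>t. t \<in> {0..<T} \<Longrightarrow> volume_measure A (g t) (\<nu> t)"
    and \<phi>: "smooth_spacetime A T \<phi>"
    and \<mu>: "\<And>t. t \<in> {0..<T} \<Longrightarrow> \<mu> t = weighted (\<phi> t) (\<nu> t)"
    and t0: "t\<^sub>0 \<in> {0..<T}" and f: "smooth_in_time A T f"
    and norm: "\<And>t. t \<in> {0..<T} \<Longrightarrow> (LINT x|\<mu> t. \<bar>f t x\<bar> powr p) = 1"
    and eigen: "eigenfunction A (g t\<^sub>0) (\<nu> t\<^sub>0) (\<phi> t\<^sub>0) p \<Lambda> (f t\<^sub>0)"
    and \<phi>': "\<And>t x. t \<in> {0..<T} \<Longrightarrow> ((\<lambda>s. \<phi> s x) has_real_derivative \<phi>' t x) (at t within {0..<T})"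
  shows "((\<lambda>t. p_energy A (g t) (\<nu> t) (\<phi> t) p (f t)) has_real_derivative
        (1 - 2 * \<rho>) * \<Lambda> * (LINT x|\<mu> t\<^sub>0. scalar_curv A (g t\<^sub>0) x * \<bar>f t\<^sub>0 x\<bar> powr p)
      - (1 + \<rho> * p - 2 * \<rho> - p / 2) *
          (LINT x|\<mu> t\<^sub>0. scalar_curv A (g t\<^sub>0) x * vnorm A (g t\<^sub>0) (grad (g t\<^sub>0) (f t\<^sub>0)) x powr p)
      + \<Lambda> * (LINT x|\<mu> t\<^sub>0. \<phi>' t\<^sub>0 x * \<bar>f t\<^sub>0 x\<bar> powr p)
      - (LINT x|\<mu> t\<^sub>0. \<phi>' t\<^sub>0 x * vnorm A (g t\<^sub>0) (grad (g t\<^sub>0) (f t\<^sub>0)) x powr p))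
      (at t\<^sub>0 within {0..<T})"
proof -
  have A: "oriented_atlas A" and cpt: "compact (UNIV :: 'm set)"
    using surface by (auto simp: closed_oriented_surface_def)
  have metric: "riemannian_metric A (g t)" if "t \<in> {0..<T}" for t
    using flow that unfolding ricci_bourguignon_flow_def by blast
  have smooth: "smooth_on ({0..<T} \<times> cimg c) (in_chart c (\<lambda>t. g t c))" if "c \<in> A" for c
    using flow that unfolding ricci_bourguignon_flow_def by blast
  define h where "h t x = - (1 - 2 * \<rho>) * scalar_curv A (g t) x" for t x
  have flow_h: "((\<lambda>s. g s c x) has_vector_derivative h t x *\<^sub>R g t c x) (at t within {0..<T})"
    if "c \<in> A" "x \<in> cdom c" "t \<in> {0..<T}" for c x t
    unfolding h_def by (rule ricci_bourguignon_conformal[OF A flow that])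
  have h_cont: "spacetime_continuous T h"
    using conformal_flow_integrate[OF A metric smooth flow_h t0] by blast
  obtain F where F: "F 0 = f" "\<And>k c. c \<in> A \<Longrightarrow> Ck_on 1 ({0..<T} \<times> cimg c) (in_chart c (F k))"
    "\<And>k t x. t \<in> {0..<T} \<Longrightarrow> ((\<lambda>s. F k s x) has_real_derivative F (Suc k) t x) (at t within {0..<T})"
    using f unfolding smooth_in_time_def by metis
  note f0 = F(2)[of _ 0, unfolded F(1)] and ff' = F(3)[of _ 0, unfolded F(1)]
  have \<phi>1: "Ck_on 1 ({0..<T} \<times> cimg c) (in_chart c \<phi>)" if "c \<in> A" for c
    using \<phi> that unfolding smooth_spacetime_def smooth_on_def by blast
  define \<gamma> where "\<gamma> = g t\<^sub>0"
  define n where "n = \<nu> t\<^sub>0"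
  have \<gamma>: "riemannian_metric A \<gamma>" and n: "volume_measure A \<gamma> n"
    using metric[OF t0] vol[OF t0] by (auto simp: \<gamma>_def n_def)
  have sets: "sets n = sets borel"
    using n by (simp add: volume_measure_def)
  have fin: "finite_measure n"
    by (rule volume_measure_finite[OF surface \<gamma> n])
  define e where "e x = exp (- \<phi> t\<^sub>0 x)" for x
  have e_nonneg: "e x \<ge> 0" for x
    by (simp add: e_def)
  define u where "u x = \<bar>f t\<^sub>0 x\<bar> powr p" for x
  define G where "G x = cometric \<gamma> (f t\<^sub>0) (f t\<^sub>0) (chart_at A x) x powr (p / 2)" for x
  define R where "R x = scalar_curv A \<gamma> x" for x
  define \<phi>\<^sub>t where "\<phi>\<^sub>t x = \<phi>' t\<^sub>0 x" for x
  have q_nonneg: "cometric \<gamma> (f t\<^sub>0) (f t\<^sub>0) (chart_at A x) x \<ge> 0" for x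
    by (rule cometric_nonneg) (rule riemannian_metric_posdef[OF \<gamma> chart_at(1,2)[OF A]])
  have G: "vnorm A \<gamma> (grad \<gamma> (f t\<^sub>0)) x powr p = G x" for x
    using powr_powr[of "cometric \<gamma> (f t\<^sub>0) (f t\<^sub>0) (chart_at A x) x" "1 / 2" p] q_nonneg[of x]
    by (simp add: vnorm_grad[OF A \<gamma> in_chart_C1_fun[OF A f0 t0] chart_at(1,2)[OF A]] G_def powr_half_sqrt)
  have e_cont: "continuous_on UNIV e"
    unfolding e_def[abs_def]
    by (intro continuous_intros spacetime_continuous_slice[OF in_chart_Ck_1_continuous[OF A \<phi>1] t0])
  have u_cont: "continuous_on UNIV u"
    unfolding u_def[abs_def] using p
    by (intro continuous_on_powr' continuous_intros spacetime_continuous_slice[OF in_chart_Ck_1_continuous[OF A f0] t0]) auto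
  have G_cont: "continuous_on UNIV G"
    unfolding G_def[abs_def] using p q_nonneg
    by (intro continuous_on_powr' continuous_on_const
        spacetime_continuous_slice[OF cometric_spacetime_continuous[OF A \<gamma> f0 f0] t0]) auto
  have R_cont: "continuous_on UNIV R"
  proof -
    have "continuous_on UNIV (\<lambda>x. h t\<^sub>0 x / - (1 - 2 * \<rho>))"
      using rho by (intro continuous_intros spacetime_continuous_slice[OF h_cont t0]) auto
    then show ?thesis
      using rho by (simp add: R_def[abs_def] h_def \<gamma>_def)
  qed
  \<comment> \<open>If \<phi> solves the heat equation, this is also where continuity of its
    Laplacian comes from: it is a time derivative of \<phi>.\<close>
  have \<phi>\<^sub>t_cont: "continuous_on UNIV \<phi>\<^sub>t"
    unfolding \<phi>\<^sub>t_def[abs_def]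
    by (rule spacetime_continuous_slice[OF in_chart_time_derivative_continuous[OF A \<phi>1 \<phi>'] t0])
  have int: "integrable n (\<lambda>x. e x * (k x * l x))" if "continuous_on UNIV k" "continuous_on UNIV l" for k l
    using that by (intro integrable_continuous_compact_space[OF cpt fin sets] continuous_intros e_cont)
  have conv: "(LINT x|\<mu> t\<^sub>0. k x * l x) = (LINT x|n. e x * (k x * l x))"
    if "continuous_on UNIV k" "continuous_on UNIV l" for k l
  proof -
    have "continuous_on UNIV (\<lambda>x. k x * l x)"
      using that by (intro continuous_intros)
    from borel_measurable_continuous_onI[OF this] borel_measurable_continuous_onI[OF e_cont]
    have "(LINT x|density n (\<lambda>x. ennreal (e x)). k x * l x) = (LINT x|n. e x *\<^sub>R (k x * l x))"
      by (intro integral_density) (auto simp: e_nonneg measurable_cong_sets[OF sets refl])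
    then show ?thesis
      by (simp add: \<mu>[OF t0] weighted_def e_def n_def)
  qed
  have der: "((\<lambda>t. p_energy A (g t) (\<nu> t) (\<phi> t) p (f t)) has_real_derivative
      (LINT x|n. G x * (((1 - p / 2) * h t\<^sub>0 x - \<phi>\<^sub>t x) * e x)) - \<Lambda> * (LINT x|n. u x * ((h t\<^sub>0 x - \<phi>\<^sub>t x) * e x)))
      (at t\<^sub>0 within {0..<T})"
    unfolding G_def u_def e_def n_def \<gamma>_def \<phi>\<^sub>t_def
    by (rule p_energy_conformal_derivative[OF surface p t0 metric smooth flow_h vol \<phi>1 \<phi>' f0 F(2)[of _ 1] ff'[unfolded One_nat_def[symmetric]] _ eigen])
       (use norm \<mu> in auto)
  have h: "h t\<^sub>0 x = - (1 - 2 * \<rho>) * R x" for x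
    by (simp add: h_def R_def \<gamma>_def)
  \<comment> \<open>Used with c = 1 for |f|^p and with c = 1 - p/2 for |\<nabla>f|^p; the latter
    yields the coefficient (1 - 2 \<rho>)(1 - p/2).\<close>
  have split: "(LINT x|n. l x * ((c * h t\<^sub>0 x - \<phi>\<^sub>t x) * e x)) =
      - (1 - 2 * \<rho>) * c * (LINT x|\<mu> t\<^sub>0. R x * l x) - (LINT x|\<mu> t\<^sub>0. \<phi>\<^sub>t x * l x)"
    if l: "continuous_on UNIV l" for l c
  proof -
    have "(\<lambda>x. l x * ((c * h t\<^sub>0 x - \<phi>\<^sub>t x) * e x)) =
        (\<lambda>x. - (1 - 2 * \<rho>) * c * (e x * (R x * l x)) - e x * (\<phi>\<^sub>t x * l x))"
      unfolding h by (simp add: algebra_simps)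
    then show ?thesis
      using int[OF R_cont l] int[OF \<phi>\<^sub>t_cont l]
      by (simp add: conv[OF R_cont l] conv[OF \<phi>\<^sub>t_cont l])
  qed
  have "(LINT x|n. G x * (((1 - p / 2) * h t\<^sub>0 x - \<phi>\<^sub>t x) * e x)) - \<Lambda> * (LINT x|n. u x * ((h t\<^sub>0 x - \<phi>\<^sub>t x) * e x)) =
      (1 - 2 * \<rho>) * \<Lambda> * (LINT x|\<mu> t\<^sub>0. R x * u x)
      - (1 + \<rho> * p - 2 * \<rho> - p / 2) * (LINT x|\<mu> t\<^sub>0. R x * G x)
      + \<Lambda> * (LINT x|\<mu> t\<^sub>0. \<phi>\<^sub>t x * u x) - (LINT x|\<mu> t\<^sub>0. \<phi>\<^sub>t x * G x)"
  proof -
    have s1: "(LINT x|n. u x * ((h t\<^sub>0 x - \<phi>\<^sub>t x) * e x)) =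
        - (1 - 2 * \<rho>) * (LINT x|\<mu> t\<^sub>0. R x * u x) - (LINT x|\<mu> t\<^sub>0. \<phi>\<^sub>t x * u x)"
      using split[OF u_cont, of 1] by simp
    show ?thesis
      unfolding s1 split[OF G_cont] by (simp add: field_simps)
  qed
  with der show ?thesis
    unfolding R_def u_def \<phi>\<^sub>t_def G[symmetric] \<gamma>_def by simp
qed

theorem corollary3p10:
  fixes A :: "('m::{t2_space,second_countable_topology}) chart set"
    and g0 :: "'m tensor2"
    and g :: "real \<Rightarrow> 'm tensor2"
    and \<nu> \<mu> :: "real \<Rightarrow> 'm measure"
    and \<phi> f :: "real \<Rightarrow> 'm \<Rightarrow> real"
    and lam :: "real \<Rightarrow> real"
    and \<rho> p T t\<^sub>0 :: real
  assumes surface: "closed_oriented_surface A"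
    and g0: "riemannian_metric A g0"
    and rho: "\<rho> < 1/2"
    and p: "1 \<le> p"
    and flow: "ricci_bourguignon_flow A \<rho> T g0 g"
    and vol: "\<And>t. t \<in> {0..<T} \<Longrightarrow> volume_measure A (g t) (\<nu> t)"
    and phi: "smooth_spacetime A T \<phi>"
    and mu: "\<And>t. t \<in> {0..<T} \<Longrightarrow> \<mu> t = weighted (\<phi> t) (\<nu> t)"
    and first: "\<And>t. t \<in> {0..<T} \<Longrightarrow> first_eigenvalue A (g t) (\<nu> t) (\<phi> t) p (lam t)"
    and lam_C1: "Ck_on 1 {0..<T} lam"
    and t0: "t\<^sub>0 \<in> {0..<T}"
    and f: "smooth_in_time A T f"
    and f_norm: "\<And>t. t \<in> {0..<T} \<Longrightarrow> (LINT x|\<mu> t. \<bar>f t x\<bar> powr p) = 1"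
    and f_eigen: "eigenfunction A (g t\<^sub>0) (\<nu> t\<^sub>0) (\<phi> t\<^sub>0) p (lam t\<^sub>0) (f t\<^sub>0)"
    and energy_smooth: "smooth_on {0..<T} (\<lambda>t. p_energy A (g t) (\<nu> t) (\<phi> t) p (f t))"
  shows "((\<forall>t\<in>{0..<T}. \<forall>x. ((\<lambda>s. \<phi> s x) has_real_derivative laplacian A (g t) (\<phi> t) x)
              (at t within {0..<T})) \<longrightarrow>
      ((\<lambda>t. p_energy A (g t) (\<nu> t) (\<phi> t) p (f t)) has_real_derivative
          (1 - 2 * \<rho>) * lam t\<^sub>0 *
            (LINT x|\<mu> t\<^sub>0. scalar_curv A (g t\<^sub>0) x * \<bar>f t\<^sub>0 x\<bar> powr p)
        - (1 + \<rho> * p - 2 * \<rho> - p / 2) *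
            (LINT x|\<mu> t\<^sub>0. scalar_curv A (g t\<^sub>0) x *
               vnorm A (g t\<^sub>0) (grad (g t\<^sub>0) (f t\<^sub>0)) x powr p)
        + lam t\<^sub>0 * (LINT x|\<mu> t\<^sub>0. laplacian A (g t\<^sub>0) (\<phi> t\<^sub>0) x * \<bar>f t\<^sub>0 x\<bar> powr p)
        - (LINT x|\<mu> t\<^sub>0. laplacian A (g t\<^sub>0) (\<phi> t\<^sub>0) x *
               vnorm A (g t\<^sub>0) (grad (g t\<^sub>0) (f t\<^sub>0)) x powr p))
        (at t\<^sub>0 within {0..<T})) \<and>
     ((\<forall>t\<in>{0..<T}. \<phi> t = \<phi> 0) \<longrightarrow>
      ((\<lambda>t. p_energy A (g t) (\<nu> t) (\<phi> t) p (f t)) has_real_derivative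
          (1 - 2 * \<rho>) * lam t\<^sub>0 *
            (LINT x|\<mu> t\<^sub>0. scalar_curv A (g t\<^sub>0) x * \<bar>f t\<^sub>0 x\<bar> powr p)
        - (1 + \<rho> * p - 2 * \<rho> - p / 2) *
            (LINT x|\<mu> t\<^sub>0. scalar_curv A (g t\<^sub>0) x *
               vnorm A (g t\<^sub>0) (grad (g t\<^sub>0) (f t\<^sub>0)) x powr p))
        (at t\<^sub>0 within {0..<T}))"
proof (intro conjI impI, goal_cases)
  \<comment> \<open>The two assertions are the cases \<Delta>\<phi> and 0 of the time derivative of
    \<phi>.\<close>
  note derivative = ricci_bourguignon_p_energy_derivative[OF surface rho p flow vol phi mu t0 f f_norm f_eigen]
  {
    case 1
    show ?case
      by (rule derivative[where \<phi>' = "\<lambda>t. laplacian A (g t) (\<phi> t)"])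
        (assumption | rule 1[rule_format])+
  next
    case 2
    \<comment> \<open>\<phi> is known to be constant in time on \<open>{0..<T}\<close> only, so the
      derivative is taken within that interval.\<close>
    have zero: "((\<lambda>s. \<phi> s x) has_real_derivative 0) (at t within {0..<T})" if "t \<in> {0..<T}" for t x
      by (rule has_field_derivative_transform_within[OF DERIV_const[of "\<phi> 0 x"] zero_less_one that])
         (rule fun_cong[OF bspec[OF 2], symmetric])
    show ?case
      using derivative[where \<phi>' = "\<lambda>_ _. 0", OF _ _ _ zero] by simp
  }
qed

end
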